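(* Let $(\mathcal M_x)_{x=1}^N$ be a collection of pairwise commuting von Neumann algebras on a Hilbert space $\mathcal H$. If $(\mathcal M_x)_{x=1}^N$ is LU transitive and nontrivial, then it is a universal embezzler.
   Context: Hilbert spaces are separable. The collection is nontrivial if $N\ge2$ and $\mathcal M_x\neq\mathbb C1$ for all $x$. Unit vectors $\Psi,\Phi\in\mathcal H$ are approximately LU equivalent (with respect to the collection) if for all $\varepsilon>0$ there exist unitaries $u_x\in\mathcal M_x$, $x=1,\dots,N$, with $\|\Psi-\prod_xu_x\Phi\|<\varepsilon$. The collection is LU transitive if all pairs of unit vectors in $\mathcal H$ are approximately LU equivalent. A unit vector $\Psi\in\mathcal H$ is embezzling if for all $d\in\mathbb N$ and all unit vectors $\Phi_1,\Phi_2\in(\mathbb C^d)^{\otimes N}$, the vectors $\Psi\otimes\Phi_1$ and $\Psi\otimes\Phi_2$ are approximately LU equivalent with respect to the joint collection $\big(\mathcal M_x\otimes(1^{\otimes(x-1)}\otimes M_d(\mathbb C)\otimes1^{\otimes(N-x)})\big)_{x=1}^N$ on $\mathcal H\otimes(\mathbb C^d)^{\otimes N}$. The collection is a universal embezzler if every unit vector $\Psi\in\mathcal H$ is embezzling. *)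

theory Defs
  imports "HOL-Analysis.Analysis"
begin

section \<open>Complex inner product spaces\<close>

text \<open>Built on top of \<^class>\<open>real_inner\<close>: the real inner product is the real part of the complex
  one, so that norm, metric and topology are the library's. The complex inner product is
  conjugate-linear in its first argument.\<close>

class complex_inner = real_inner +
  fixes scaleC :: "complex \<Rightarrow> 'a \<Rightarrow> 'a"  (infixr "*\<^sub>C" 75)
    and cinner :: "'a \<Rightarrow> 'a \<Rightarrow> complex"
  assumes scaleC_add_right: "c *\<^sub>C (x + y) = c *\<^sub>C x + c *\<^sub>C y"
    and scaleC_add_left: "(c + c') *\<^sub>C x = c *\<^sub>C x + c' *\<^sub>C x"
    and scaleC_scaleC: "c *\<^sub>C (c' *\<^sub>C x) = (c * c') *\<^sub>C x"
    and scaleR_scaleC: "scaleR r x = complex_of_real r *\<^sub>C x"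
    and cinner_commute: "cinner x y = cnj (cinner y x)"
    and cinner_add_right: "cinner x (y + z) = cinner x y + cinner x z"
    and cinner_scaleC_right: "cinner x (c *\<^sub>C y) = c * cinner x y"
    and inner_cinner: "inner x y = Re (cinner x y)"

lemma scaleC_one [simp]: "1 *\<^sub>C x = (x::'a::complex_inner)"
  using scaleR_scaleC[of 1 x] by simp

lemma scaleC_zero_left [simp]: "0 *\<^sub>C x = (0::'a::complex_inner)"
  using scaleR_scaleC[of 0 x] by simp

lemma scaleC_zero_right [simp]: "c *\<^sub>C 0 = (0::'a::complex_inner)"
  using scaleC_add_right[of c 0 "0::'a"] by simp

lemma cinner_zero_right [simp]: "cinner x 0 = 0"
  using cinner_add_right[of x 0 0] by simp

lemma cinner_zero_left [simp]: "cinner 0 x = 0"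
  using cinner_commute[of 0 x] by simp

lemma cinner_add_left: "cinner (x + y) z = cinner x z + cinner y z"
  by (metis cinner_commute cinner_add_right complex_cnj_add)

lemma cinner_scaleC_left: "cinner (c *\<^sub>C x) y = cnj c * cinner x y"
  by (metis cinner_commute cinner_scaleC_right complex_cnj_mult)

class separable_hilbert_space = complex_inner + complete_space + second_countable_topology

instantiation complex :: separable_hilbert_space
begin

definition scaleC_complex :: "complex \<Rightarrow> complex \<Rightarrow> complex" where
  "scaleC_complex c x = c * x"

definition cinner_complex :: "complex \<Rightarrow> complex \<Rightarrow> complex" where
  "cinner_complex x y = cnj x * y"

instance
  by intro_classes
    (auto simp: scaleC_complex_def cinner_complex_def algebra_simps inner_complex_def scaleR_conv_of_real)

end


section \<open>Finitely supported families of vectors\<close>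

text \<open>The algebraic direct sum of copies of \<open>'a\<close> indexed by \<open>'i\<close>, with the \<open>\<ell>\<^sup>2\<close> inner product. It is
  only an ambient (incomplete) inner product space: the Hilbert space \<open>'a \<otimes> \<complex>\<^sup>I\<close> for a finite set
  \<open>I\<close> is its subspace of the families supported on \<open>I\<close>. (The library type of finitely supported
  functions is not usable here, since it already carries an \<open>\<ell>\<^sup>1\<close> metric.)\<close>

typedef (overloaded) ('i, 'a) dsum = "{f :: 'i \<Rightarrow> 'a::zero. finite {i. f i \<noteq> 0}}"
  morphisms coord Abs_dsum
  by (rule exI[of _ "\<lambda>_. 0"]) simp

setup_lifting type_definition_dsum

lemma finite_coord [simp]: "finite {i. coord f i \<noteq> 0}"
  using coord[of f] by simp

lemma dsum_eqI: "(\<And>i. coord f i = coord g i) \<Longrightarrow> f = g"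
  by (metis coord_inject ext)

lemma finite_coord_mono:
  assumes "\<And>i. coord f i = 0 \<Longrightarrow> h i = 0"
  shows "finite {i. h i \<noteq> 0}"
  by (rule finite_subset[OF _ finite_coord[of f]]) (use assms in auto)

instantiation dsum :: (type, complex_inner) complex_inner
begin

lift_definition zero_dsum :: "('a, 'b) dsum" is "\<lambda>_. 0" by simp

lift_definition plus_dsum :: "('a, 'b) dsum \<Rightarrow> ('a, 'b) dsum \<Rightarrow> ('a, 'b) dsum"
  is "\<lambda>f g i. f i + g i"
proof -
  fix f g :: "'a \<Rightarrow> 'b"
  assume "finite {i. f i \<noteq> 0}" "finite {i. g i \<noteq> 0}"
  then show "finite {i. f i + g i \<noteq> 0}"
    by (rule finite_subset[rotated, OF finite_UnI]) auto
qed

lift_definition uminus_dsum :: "('a, 'b) dsum \<Rightarrow> ('a, 'b) dsum" is "\<lambda>f i. - f i" by simp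

definition minus_dsum :: "('a, 'b) dsum \<Rightarrow> ('a, 'b) dsum \<Rightarrow> ('a, 'b) dsum" where
  "minus_dsum f g = f + - g"

lift_definition scaleC_dsum :: "complex \<Rightarrow> ('a, 'b) dsum \<Rightarrow> ('a, 'b) dsum"
  is "\<lambda>c f i. c *\<^sub>C f i"
  by (rule rev_finite_subset) auto

definition scaleR_dsum :: "real \<Rightarrow> ('a, 'b) dsum \<Rightarrow> ('a, 'b) dsum" where
  "scaleR_dsum r f = complex_of_real r *\<^sub>C f"

definition cinner_dsum :: "('a, 'b) dsum \<Rightarrow> ('a, 'b) dsum \<Rightarrow> complex" where
  "cinner_dsum f g = (\<Sum>i | coord f i \<noteq> 0. cinner (coord f i) (coord g i))"

definition inner_dsum :: "('a, 'b) dsum \<Rightarrow> ('a, 'b) dsum \<Rightarrow> real" where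
  "inner_dsum f g = Re (cinner f g)"

definition norm_dsum :: "('a, 'b) dsum \<Rightarrow> real" where
  "norm_dsum f = sqrt (inner f f)"

definition sgn_dsum :: "('a, 'b) dsum \<Rightarrow> ('a, 'b) dsum" where
  "sgn_dsum f = scaleR (inverse (norm f)) f"

definition dist_dsum :: "('a, 'b) dsum \<Rightarrow> ('a, 'b) dsum \<Rightarrow> real" where
  "dist_dsum f g = norm (f - g)"

definition uniformity_dsum :: "(('a, 'b) dsum \<times> ('a, 'b) dsum) filter" where
  "uniformity_dsum = (INF e\<in>{0<..}. principal {(x, y). dist x y < e})"

definition open_dsum :: "('a, 'b) dsum set \<Rightarrow> bool" where
  "open_dsum U \<longleftrightarrow> (\<forall>x\<in>U. eventually (\<lambda>(x', y). x' = x \<longrightarrow> y \<in> U) uniformity)"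

lemma cinner_dsum_superset:
  fixes f g :: "('a, 'b) dsum"
  assumes "finite I" "\<And>i. i \<notin> I \<Longrightarrow> coord f i = 0 \<or> coord g i = 0"
  shows "cinner f g = (\<Sum>i\<in>I. cinner (coord f i) (coord g i))"
proof -
  have "cinner f g = (\<Sum>i\<in>I \<union> {i. coord f i \<noteq> 0}. cinner (coord f i) (coord g i))"
    unfolding cinner_dsum_def by (rule sum.mono_neutral_left) (use assms in auto)
  also have "\<dots> = (\<Sum>i\<in>I. cinner (coord f i) (coord g i))"
    by (rule sum.mono_neutral_right) (use assms in force)+
  finally show ?thesis .
qed

instance
proof
  fix f g h :: "('a, 'b) dsum" and c c' :: complex and r s :: real
  show "f + g + h = f + (g + h)" "f + g = g + f" "0 + f = f" "- f + f = 0"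
    by (transfer; simp add: algebra_simps)+
  show "f - g = f + - g" by (rule minus_dsum_def)
  show cr: "c *\<^sub>C (f + g) = c *\<^sub>C f + c *\<^sub>C g" for f g :: "('a, 'b) dsum" and c
    by transfer (simp add: scaleC_add_right)
  show cl: "(c + c') *\<^sub>C f = c *\<^sub>C f + c' *\<^sub>C f" for f :: "('a, 'b) dsum" and c c'
    by transfer (simp add: scaleC_add_left)
  show cc: "c *\<^sub>C (c' *\<^sub>C f) = (c * c') *\<^sub>C f" for f :: "('a, 'b) dsum" and c c'
    by transfer (simp add: scaleC_scaleC)
  show "scaleR r f = complex_of_real r *\<^sub>C f" by (rule scaleR_dsum_def)
  show "scaleR r (f + g) = scaleR r f + scaleR r g"
    "scaleR (r + s) f = scaleR r f + scaleR s f"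
    "scaleR r (scaleR s f) = scaleR (r * s) f"
    by (simp_all add: scaleR_dsum_def cr cl cc)
  show "scaleR 1 f = f"
    unfolding scaleR_dsum_def by transfer simp
  show "sgn f = scaleR (inverse (norm f)) f" by (rule sgn_dsum_def)
  show "dist f g = norm (f - g)" by (rule dist_dsum_def)
  show "uniformity = (INF e\<in>{0<..}. principal {(x, y). dist (x::('a, 'b) dsum) y < e})"
    by (rule uniformity_dsum_def)
  show "open U \<longleftrightarrow> (\<forall>x\<in>U. eventually (\<lambda>(x', y). x' = x \<longrightarrow> y \<in> U) uniformity)"
    for U :: "('a, 'b) dsum set" by (rule open_dsum_def)
  show "norm f = sqrt (inner f f)" by (rule norm_dsum_def)
  show com: "cinner f g = cnj (cinner g f)" for f g :: "('a, 'b) dsum"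
  proof -
    let ?I = "{i. coord f i \<noteq> 0} \<union> {i. coord g i \<noteq> 0}"
    have "cinner f g = (\<Sum>i\<in>?I. cinner (coord f i) (coord g i))"
      by (rule cinner_dsum_superset) auto
    also have "\<dots> = cnj (\<Sum>i\<in>?I. cinner (coord g i) (coord f i))"
      by (simp flip: cinner_commute)
    also have "(\<Sum>i\<in>?I. cinner (coord g i) (coord f i)) = cinner g f"
      by (rule cinner_dsum_superset[symmetric]) auto
    finally show ?thesis .
  qed
  show ar: "cinner f (g + h) = cinner f g + cinner f h" for f g h :: "('a, 'b) dsum"
    by (simp add: cinner_dsum_def plus_dsum.rep_eq cinner_add_right sum.distrib)
  show sr: "cinner f (c *\<^sub>C g) = c * cinner f g" for f g :: "('a, 'b) dsum" and c
    by (simp add: cinner_dsum_def scaleC_dsum.rep_eq cinner_scaleC_right sum_distrib_left)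
  show "inner f g = Re (cinner f g)" by (rule inner_dsum_def)
  show "inner f g = inner g f"
    unfolding inner_dsum_def by (subst com) simp
  show "inner (f + g) h = inner f h + inner g h"
    unfolding inner_dsum_def by (metis ar com complex_cnj_add plus_complex.simps(1))
  show "inner (scaleR r f) g = r * inner f g"
    unfolding inner_dsum_def scaleR_dsum_def by (subst (1 2) com) (simp add: sr)
  have ff: "inner f f = (\<Sum>i | coord f i \<noteq> 0. inner (coord f i) (coord f i))"
    by (simp add: inner_dsum_def cinner_dsum_def inner_cinner)
  show "0 \<le> inner f f" unfolding ff by (rule sum_nonneg) simp
  show "inner f f = 0 \<longleftrightarrow> f = 0"
  proof
    assume "inner f f = 0"
    then have "\<forall>i\<in>{i. coord f i \<noteq> 0}. inner (coord f i) (coord f i) = 0"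
      unfolding ff by (subst (asm) sum_nonneg_eq_0_iff) auto
    then show "f = 0" by (intro dsum_eqI) (auto simp: zero_dsum.rep_eq)
  qed (simp add: inner_dsum_def cinner_dsum_def zero_dsum.rep_eq)
qed

end

lift_definition family_on :: "'i set \<Rightarrow> ('i \<Rightarrow> 'a::zero) \<Rightarrow> ('i, 'a) dsum"
  is "\<lambda>I f i. if finite I \<and> i \<in> I then f i else 0"
proof -
  fix I :: "'i set" and f :: "'i \<Rightarrow> 'a"
  show "finite {i. (if finite I \<and> i \<in> I then f i else 0) \<noteq> 0}"
    by (cases "finite I") (auto elim: rev_finite_subset)
qed

definition supported_on :: "'i set \<Rightarrow> ('i, 'a::zero) dsum set" where
  "supported_on I = {f. \<forall>i. i \<notin> I \<longrightarrow> coord f i = 0}"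


section \<open>Operators and von Neumann algebras\<close>

text \<open>Operators act on a Hilbert space \<open>S\<close> that is a subspace of the ambient type
  (the whole type when \<open>S = UNIV\<close>); their values outside \<open>S\<close> are irrelevant.\<close>

definition bounded_operators :: "'a::complex_inner set \<Rightarrow> ('a \<Rightarrow> 'a) set" where
  "bounded_operators S = {a. a ` S \<subseteq> S
     \<and> (\<forall>f\<in>S. \<forall>g\<in>S. a (f + g) = a f + a g)
     \<and> (\<forall>c. \<forall>f\<in>S. a (c *\<^sub>C f) = c *\<^sub>C a f)
     \<and> (\<exists>K. \<forall>f\<in>S. norm (a f) \<le> K * norm f)}"

definition adjoint_pair :: "'a::complex_inner set \<Rightarrow> ('a \<Rightarrow> 'a) \<Rightarrow> ('a \<Rightarrow> 'a) \<Rightarrow> bool" where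
  "adjoint_pair S a b \<longleftrightarrow> (\<forall>f\<in>S. \<forall>g\<in>S. cinner (a f) g = cinner f (b g))"

definition unitary_operator :: "'a::complex_inner set \<Rightarrow> ('a \<Rightarrow> 'a) \<Rightarrow> bool" where
  "unitary_operator S u \<longleftrightarrow> u \<in> bounded_operators S
     \<and> (\<exists>v\<in>bounded_operators S. adjoint_pair S u v \<and> (\<forall>f\<in>S. v (u f) = f \<and> u (v f) = f))"

definition commutant :: "'a::complex_inner set \<Rightarrow> ('a \<Rightarrow> 'a) set \<Rightarrow> ('a \<Rightarrow> 'a) set" where
  "commutant S X = {a \<in> bounded_operators S. \<forall>b\<in>X. \<forall>f\<in>S. a (b f) = b (a f)}"

definition von_neumann_algebra :: "'a::complex_inner set \<Rightarrow> ('a \<Rightarrow> 'a) set \<Rightarrow> bool" where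
  "von_neumann_algebra S M \<longleftrightarrow> M \<subseteq> bounded_operators S
     \<and> (\<forall>a\<in>M. \<exists>b\<in>M. adjoint_pair S a b)
     \<and> commutant S (commutant S M) = M"


section \<open>Tensor products with \<open>(\<complex>\<^sup>d)\<^sup>\<otimes>\<^sup>N\<close>\<close>

type_synonym multi_index = "nat \<Rightarrow> nat"

definition multi_indices :: "nat \<Rightarrow> nat \<Rightarrow> multi_index set" where
  "multi_indices N d = {1..N} \<rightarrow>\<^sub>E {..<d}"

text \<open>\<open>qudits N d\<close> is \<open>(\<complex>\<^sup>d)\<^sup>\<otimes>\<^sup>N\<close> at the coefficient type \<open>complex\<close>, and \<open>\<H> \<otimes> (\<complex>\<^sup>d)\<^sup>\<otimes>\<^sup>N\<close> at a coefficient
  space \<open>\<H>\<close>; coordinates refer to the standard product basis.\<close>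

definition qudits :: "nat \<Rightarrow> nat \<Rightarrow> (multi_index, 'a::zero) dsum set" where
  "qudits N d = supported_on (multi_indices N d)"

lift_definition tensor_vec :: "'a::complex_inner \<Rightarrow> ('i, complex) dsum \<Rightarrow> ('i, 'a) dsum"
  is "\<lambda>\<Psi> \<Phi> k. \<Phi> k *\<^sub>C \<Psi>"
  by (rule rev_finite_subset) auto

text \<open>Matrices on \<open>(\<complex>\<^sup>d)\<^sup>\<otimes>\<^sup>N\<close> are indexed by multi-indices; only their entries at
  \<open>multi_indices N d\<close> matter.\<close>

definition tensor_mat :: "nat \<Rightarrow> (nat \<Rightarrow> nat \<Rightarrow> nat \<Rightarrow> complex) \<Rightarrow> multi_index \<Rightarrow> multi_index \<Rightarrow> complex"
  where "tensor_mat N B k l = (\<Prod>y\<in>{1..N}. B y (k y) (l y))"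

definition id_mat :: "nat \<Rightarrow> nat \<Rightarrow> complex" where
  "id_mat i j = (if i = j then 1 else 0)"

definition site_algebra :: "nat \<Rightarrow> nat \<Rightarrow> (multi_index \<Rightarrow> multi_index \<Rightarrow> complex) set" where
  "site_algebra N x = {tensor_mat N (\<lambda>y. if y = x then b else id_mat) | b. True}"

definition tensor_op :: "nat \<Rightarrow> nat \<Rightarrow> ('a::complex_inner \<Rightarrow> 'a) \<Rightarrow> (multi_index \<Rightarrow> multi_index \<Rightarrow> complex)
    \<Rightarrow> (multi_index, 'a) dsum \<Rightarrow> (multi_index, 'a) dsum" where
  "tensor_op N d a T f = family_on (multi_indices N d)
     (\<lambda>k. \<Sum>l\<in>multi_indices N d. T k l *\<^sub>C a (coord f l))"

text \<open>The von Neumann tensor product: the von Neumann algebra generated by the elementary tensors.\<close>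

definition joint_collection ::
    "nat \<Rightarrow> nat \<Rightarrow> (nat \<Rightarrow> ('a::complex_inner \<Rightarrow> 'a) set)
      \<Rightarrow> nat \<Rightarrow> ((multi_index, 'a) dsum \<Rightarrow> (multi_index, 'a) dsum) set" where
  "joint_collection N d M x = commutant (qudits N d) (commutant (qudits N d)
     {tensor_op N d a T | a T. a \<in> M x \<and> T \<in> site_algebra N x})"

lemma finite_multi_indices [simp]: "finite (multi_indices N d)"
  by (simp add: multi_indices_def finite_PiE)

lemma cinner_tensor_vec:
  "cinner (tensor_vec \<Psi> \<Phi>) (tensor_vec \<Psi>' \<Phi>') = cinner \<Psi> \<Psi>' * cinner \<Phi> \<Phi>'"
proof -
  let ?I = "{i. coord \<Phi> i \<noteq> 0}"
  have "cinner (tensor_vec \<Psi> \<Phi>) (tensor_vec \<Psi>' \<Phi>')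
      = (\<Sum>i\<in>?I. cinner (coord (tensor_vec \<Psi> \<Phi>) i) (coord (tensor_vec \<Psi>' \<Phi>') i))"
    by (rule cinner_dsum_superset) (auto simp: tensor_vec.rep_eq)
  also have "\<dots> = cinner \<Psi> \<Psi>' * cinner \<Phi> \<Phi>'"
    by (simp add: tensor_vec.rep_eq cinner_scaleC_left cinner_scaleC_right cinner_dsum_def
        cinner_complex_def sum_distrib_left mult_ac)
  finally show ?thesis .
qed

lemma tensor_op_tensor_vec:
  assumes "\<And>c \<psi>. a (c *\<^sub>C \<psi>) = c *\<^sub>C a \<psi>"
  shows "tensor_op N d a T (tensor_vec \<Psi> \<Phi>) = tensor_vec (a \<Psi>) (tensor_op N d id T \<Phi>)"
proof (rule dsum_eqI)
  fix k
  have sumC: "(\<Sum>l\<in>A. h l *\<^sub>C a \<Psi>) = (\<Sum>l\<in>A. h l) *\<^sub>C a \<Psi>" for A and h :: "multi_index \<Rightarrow> complex"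
    by (induction A rule: infinite_finite_induct) (auto simp: scaleC_add_left)
  show "coord (tensor_op N d a T (tensor_vec \<Psi> \<Phi>)) k
      = coord (tensor_vec (a \<Psi>) (tensor_op N d id T \<Phi>)) k"
    by (simp add: tensor_op_def family_on.rep_eq tensor_vec.rep_eq assms scaleC_scaleC sumC
        scaleC_complex_def[abs_def])
qed


section \<open>Local unitary equivalence and embezzlement\<close>

definition pairwise_commuting :: "nat \<Rightarrow> (nat \<Rightarrow> ('a \<Rightarrow> 'a) set) \<Rightarrow> bool" where
  "pairwise_commuting N M \<longleftrightarrow>
     (\<forall>x\<in>{1..N}. \<forall>y\<in>{1..N}. x \<noteq> y \<longrightarrow> (\<forall>a\<in>M x. \<forall>b\<in>M y. a \<circ> b = b \<circ> a))"

definition local_product :: "nat \<Rightarrow> (nat \<Rightarrow> 'a \<Rightarrow> 'a) \<Rightarrow> 'a \<Rightarrow> 'a" where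
  "local_product N u = foldr (\<lambda>x T. u x \<circ> T) [1..<Suc N] id"

definition approx_LU_equivalent ::
    "'a::complex_inner set \<Rightarrow> nat \<Rightarrow> (nat \<Rightarrow> ('a \<Rightarrow> 'a) set) \<Rightarrow> 'a \<Rightarrow> 'a \<Rightarrow> bool" where
  "approx_LU_equivalent S N M \<Psi> \<Phi> \<longleftrightarrow>
     (\<forall>\<epsilon>>0. \<exists>u. (\<forall>x\<in>{1..N}. u x \<in> M x \<and> unitary_operator S (u x))
        \<and> norm (\<Psi> - local_product N u \<Phi>) < \<epsilon>)"

definition LU_transitive :: "nat \<Rightarrow> (nat \<Rightarrow> ('a::complex_inner \<Rightarrow> 'a) set) \<Rightarrow> bool" where
  "LU_transitive N M \<longleftrightarrow>
     (\<forall>\<Psi> \<Phi>. norm \<Psi> = 1 \<longrightarrow> norm \<Phi> = 1 \<longrightarrow> approx_LU_equivalent UNIV N M \<Psi> \<Phi>)"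

definition nontrivial_collection :: "nat \<Rightarrow> (nat \<Rightarrow> ('a::complex_inner \<Rightarrow> 'a) set) \<Rightarrow> bool" where
  "nontrivial_collection N M \<longleftrightarrow> N \<ge> 2 \<and> (\<forall>x\<in>{1..N}. M x \<noteq> range (\<lambda>c \<psi>. c *\<^sub>C \<psi>))"

definition embezzling :: "nat \<Rightarrow> (nat \<Rightarrow> ('a::complex_inner \<Rightarrow> 'a) set) \<Rightarrow> 'a \<Rightarrow> bool" where
  "embezzling N M \<Psi> \<longleftrightarrow> norm \<Psi> = 1 \<and>
     (\<forall>d. \<forall>\<Phi>\<^sub>1\<in>qudits N d. \<forall>\<Phi>\<^sub>2\<in>qudits N d. norm \<Phi>\<^sub>1 = 1 \<longrightarrow> norm \<Phi>\<^sub>2 = 1 \<longrightarrow>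
        approx_LU_equivalent (qudits N d) N (joint_collection N d M)
          (tensor_vec \<Psi> \<Phi>\<^sub>1) (tensor_vec \<Psi> \<Phi>\<^sub>2))"

definition universal_embezzler :: "nat \<Rightarrow> (nat \<Rightarrow> ('a::complex_inner \<Rightarrow> 'a) set) \<Rightarrow> bool" where
  "universal_embezzler N M \<longleftrightarrow> (\<forall>\<Psi>. norm \<Psi> = 1 \<longrightarrow> embezzling N M \<Psi>)"

end

theory Submission
  imports Defs
begin

text \<open>Every \<open>M x\<close> contains, for each \<open>d\<close>, approximate matrix units at every vector, and this
  is enough to swap a \<open>d\<close>-level register into \<open>\<H>\<close>.

  A unitary of one party, corrected by the others, moves any vector state of \<open>M x\<close> close to any other.
  Self-adjoint elements of \<open>M x\<close> with approximate eigenvalues \<open>0\<close> and \<open>1\<close> exist by nontriviality. Given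
  \<open>m\<close> approximately orthogonal approximate projections in \<open>M x\<close>, one of them can be conjugated so that
  it fixes a vector entangled between \<open>x\<close> and a second party; then it fixes two vectors that \<open>M x\<close> itself
  can separate, so it splits, giving \<open>m + 1\<close>. With \<open>d\<close> projections \<open>p\<^sub>j\<close> and unitaries \<open>u\<^sub>j\<close> moving a
  vector \<open>\<Psi>\<close> to the range of \<open>p\<^sub>j\<close>, the operators \<open>w\<^sub>j = p\<^sub>j u\<^sub>j\<close> satisfy \<open>w\<^sub>i\<^sup>* w\<^sub>j \<Psi> \<approx> \<delta>\<^sub>i\<^sub>j \<Psi>\<close>.
  The Cayley transform of \<open>\<Sum>\<^sub>j (w\<^sub>j \<otimes> |0\<rangle>\<langle>j| - h.c.)\<close> is then a unitary of party \<open>x\<close> that approximately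
  maps \<open>\<Psi> \<otimes> |j\<rangle>\<close> to \<open>w\<^sub>j \<Psi> \<otimes> |0\<rangle>\<close>. Doing this for all parties turns \<open>\<Psi> \<otimes> \<Phi>\<close> into some
  \<open>\<theta> \<otimes> |0 \<dots> 0\<rangle>\<close>, and all \<open>\<theta>\<close> are equivalent by transitivity. Only approximate statements are
  needed, which avoids spectral theory and comparison of projections.\<close>

section \<open>Bounded operators on a subspace\<close>

text \<open>The carrier \<open>S\<close> is either the whole Hilbert space or
  \<open>qudits N d\<close> inside its incomplete ambient type. Working relative to a subspace lets
  the same results serve both levels.\<close>

definition csubspace :: "'a::complex_inner set \<Rightarrow> bool" where
  "csubspace S \<longleftrightarrow> 0 \<in> S \<and> (\<forall>f\<in>S. \<forall>g\<in>S. f + g \<in> S) \<and> (\<forall>c. \<forall>f\<in>S. c *\<^sub>C f \<in> S)"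

lemma csubspace_UNIV [simp]: "csubspace UNIV"
  by (simp add: csubspace_def)

lemma scaleC_minus_one [simp]: "(- 1) *\<^sub>C x = - (x::'a::complex_inner)"
  using scaleR_scaleC[of "-1" x] by simp

lemma scaleC_diff_right: "c *\<^sub>C (x - y) = c *\<^sub>C x - c *\<^sub>C (y::'a::complex_inner)"
  using scaleC_add_right[of c "x - y" y] by simp

lemma scaleC_minus_left: "(- c) *\<^sub>C x = - (c *\<^sub>C (x::'a::complex_inner))"
  using scaleC_scaleC[of "-1" c x] by simp

lemma csubspaceD:
  assumes "csubspace S"
  shows "0 \<in> S" "f \<in> S \<Longrightarrow> g \<in> S \<Longrightarrow> f + g \<in> S" "f \<in> S \<Longrightarrow> c *\<^sub>C f \<in> S"
    "f \<in> S \<Longrightarrow> - f \<in> S" "f \<in> S \<Longrightarrow> g \<in> S \<Longrightarrow> f - g \<in> S" "f \<in> S \<Longrightarrow> r *\<^sub>R f \<in> S"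
proof -
  show *: "0 \<in> S" "f \<in> S \<Longrightarrow> g \<in> S \<Longrightarrow> f + g \<in> S" "f \<in> S \<Longrightarrow> c *\<^sub>C f \<in> S" for f g c
    using assms by (auto simp: csubspace_def)
  show **: "f \<in> S \<Longrightarrow> - f \<in> S" for f
    using *(3)[of f "-1"] by simp
  show "f \<in> S \<Longrightarrow> g \<in> S \<Longrightarrow> f - g \<in> S"
    using *(2)[of f "- g"] ** by simp
  show "f \<in> S \<Longrightarrow> r *\<^sub>R f \<in> S"
    by (simp add: scaleR_scaleC *(3))
qed

lemma csubspace_sum: "csubspace S \<Longrightarrow> (\<And>i. i \<in> I \<Longrightarrow> f i \<in> S) \<Longrightarrow> sum f I \<in> S"
  by (induction I rule: infinite_finite_induct) (auto intro: csubspaceD)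

section \<open>Identities for the complex inner product\<close>

lemma cinner_self: "cinner x x = complex_of_real ((norm (x::'a::complex_inner))\<^sup>2)"
proof -
  have "Im (cinner x x) = 0"
    using arg_cong[OF cinner_commute[of x x], of Im] by simp
  then show ?thesis
    by (simp add: complex_eq_iff inner_cinner[symmetric] power2_norm_eq_inner)
qed

lemma norm_scaleC: "norm (c *\<^sub>C (x::'a::complex_inner)) = cmod c * norm x"
proof -
  have "complex_of_real ((norm (c *\<^sub>C x))\<^sup>2) = complex_of_real ((cmod c * norm x)\<^sup>2)"
    unfolding cinner_self[symmetric] cinner_scaleC_left cinner_scaleC_right
    by (simp add: cinner_self power_mult_distrib complex_norm_square[symmetric] mult.assoc[symmetric])
  then have "(norm (c *\<^sub>C x))\<^sup>2 = (cmod c * norm x)\<^sup>2"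
    using of_real_eq_iff by blast
  then show ?thesis
    by (simp add: power2_eq_iff_nonneg)
qed

lemma cinner_minus_right: "cinner x (- y) = - cinner x y"
  using cinner_scaleC_right[of x "-1" y] by simp

lemma cinner_minus_left: "cinner (- x) y = - cinner x y"
  using cinner_scaleC_left[of "-1" x y] by simp

lemma cinner_diff_right: "cinner x (y - z) = cinner x y - cinner x z"
  using cinner_add_right[of x y "- z"] by (simp add: cinner_minus_right)

lemma cinner_diff_left: "cinner (x - y) z = cinner x z - cinner y z"
  using cinner_add_left[of x "- y" z] by (simp add: cinner_minus_left)

lemma cinner_sum_right: "cinner x (sum f I) = (\<Sum>i\<in>I. cinner x (f i))"
  by (induction I rule: infinite_finite_induct) (auto simp: cinner_add_right)

lemma cinner_sum_left: "cinner (sum f I) x = (\<Sum>i\<in>I. cinner (f i) x)"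
  by (induction I rule: infinite_finite_induct) (auto simp: cinner_add_left)

section \<open>Calculus of bounded operators on a subspace\<close>

lemma bounded_operatorsI:
  assumes "\<And>f. f \<in> S \<Longrightarrow> a f \<in> S"
    and "\<And>f g. f \<in> S \<Longrightarrow> g \<in> S \<Longrightarrow> a (f + g) = a f + a g"
    and "\<And>c f. f \<in> S \<Longrightarrow> a (c *\<^sub>C f) = c *\<^sub>C a f"
    and "\<And>f. f \<in> S \<Longrightarrow> norm (a f) \<le> K * norm f"
  shows "a \<in> bounded_operators S"
  using assms unfolding bounded_operators_def by (auto intro!: exI[of _ K])

lemma bounded_operatorsD:
  assumes "a \<in> bounded_operators S"
  shows "f \<in> S \<Longrightarrow> a f \<in> S"
    and "f \<in> S \<Longrightarrow> g \<in> S \<Longrightarrow> a (f + g) = a f + a g"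
    and "f \<in> S \<Longrightarrow> a (c *\<^sub>C f) = c *\<^sub>C a f"
  using assms unfolding bounded_operators_def by auto

lemma bounded_operators_bound:
  assumes "a \<in> bounded_operators S"
  obtains K where "K \<ge> 0" "\<And>f. f \<in> S \<Longrightarrow> norm (a f) \<le> K * norm f"
proof -
  obtain K where K: "\<And>f. f \<in> S \<Longrightarrow> norm (a f) \<le> K * norm f"
    using assms unfolding bounded_operators_def by blast
  have "norm (a f) \<le> max K 0 * norm f" if "f \<in> S" for f
    by (rule order_trans[OF K[OF that]]) (simp add: mult_right_mono)
  then show ?thesis
    using that[of "max K 0"] by simp
qed

text \<open>Values outside \<open>S\<close> carry no meaning, so membership has to depend on the
  values on \<open>S\<close> alone. Elements of \<open>LU\<close> below are prescribed only
  there.\<close>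

lemma bounded_operators_cong:
  assumes "\<And>f. f \<in> S \<Longrightarrow> a f = b f" "csubspace S" "b \<in> bounded_operators S"
  shows "a \<in> bounded_operators S"
proof -
  obtain K where "\<And>f. f \<in> S \<Longrightarrow> norm (b f) \<le> K * norm f"
    using bounded_operators_bound[OF assms(3)] by blast
  then show ?thesis
    using assms bounded_operatorsD[OF assms(3)] csubspaceD[OF assms(2)]
    by (intro bounded_operatorsI[where K = K]) auto
qed

context
  fixes S :: "'a::complex_inner set" and a :: "'a \<Rightarrow> 'a"
  assumes S: "csubspace S" and a: "a \<in> bounded_operators S"
begin

lemma bounded_operators_zero: "a 0 = 0"
  using bounded_operatorsD(3)[OF a csubspaceD(1)[OF S], of 0] by simp

lemma bounded_operators_minus: "f \<in> S \<Longrightarrow> a (- f) = - a f"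
  using bounded_operatorsD(3)[OF a, of f "-1"] by simp

lemma bounded_operators_diff: "f \<in> S \<Longrightarrow> g \<in> S \<Longrightarrow> a (f - g) = a f - a g"
  using bounded_operatorsD(2)[OF a, of f "- g"] csubspaceD(4)[OF S, of g]
  by (simp add: bounded_operators_minus)

lemma bounded_operators_scaleR: "f \<in> S \<Longrightarrow> a (r *\<^sub>R f) = r *\<^sub>R a f"
  by (simp add: scaleR_scaleC bounded_operatorsD(3)[OF a])

lemma bounded_operators_sum: "(\<And>i. i \<in> I \<Longrightarrow> f i \<in> S) \<Longrightarrow> a (sum f I) = (\<Sum>i\<in>I. a (f i))"
  by (induction I rule: infinite_finite_induct)
    (auto simp: bounded_operators_zero bounded_operatorsD(2)[OF a] csubspace_sum[OF S])

end

lemma id_bounded [simp]: "id \<in> bounded_operators S"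
  by (rule bounded_operatorsI[where K = 1]) auto

lemma comp_bounded:
  assumes "a \<in> bounded_operators S" "b \<in> bounded_operators S"
  shows "a \<circ> b \<in> bounded_operators S"
proof -
  obtain K where K: "K \<ge> 0" "\<And>f. f \<in> S \<Longrightarrow> norm (a f) \<le> K * norm f"
    using bounded_operators_bound[OF assms(1)] by metis
  obtain L where L: "L \<ge> 0" "\<And>f. f \<in> S \<Longrightarrow> norm (b f) \<le> L * norm f"
    using bounded_operators_bound[OF assms(2)] by metis
  have "norm (a (b f)) \<le> (K * L) * norm f" if "f \<in> S" for f
    using K(2)[OF bounded_operatorsD(1)[OF assms(2) that]] mult_left_mono[OF L(2)[OF that] K(1)]
    by (simp add: mult.assoc)
  then show ?thesis
    by (intro bounded_operatorsI[where K = "K * L"])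
      (auto simp: bounded_operatorsD[OF assms(1)] bounded_operatorsD[OF assms(2)])
qed

lemma add_bounded:
  assumes "csubspace S" "a \<in> bounded_operators S" "b \<in> bounded_operators S"
  shows "(\<lambda>f. a f + b f) \<in> bounded_operators S"
proof -
  obtain K where K: "K \<ge> 0" "\<And>f. f \<in> S \<Longrightarrow> norm (a f) \<le> K * norm f"
    using bounded_operators_bound[OF assms(2)] by metis
  obtain L where L: "L \<ge> 0" "\<And>f. f \<in> S \<Longrightarrow> norm (b f) \<le> L * norm f"
    using bounded_operators_bound[OF assms(3)] by metis
  have "norm (a f + b f) \<le> (K + L) * norm f" if "f \<in> S" for f
    using norm_triangle_ineq[of "a f" "b f"] K(2)[OF that] L(2)[OF that] by (simp add: distrib_right)
  then show ?thesis
    by (intro bounded_operatorsI[where K = "K + L"])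
      (auto simp: bounded_operatorsD[OF assms(2)] bounded_operatorsD[OF assms(3)] scaleC_add_right
        csubspaceD[OF assms(1)])
qed

lemma scaleC_bounded:
  assumes "csubspace S" "a \<in> bounded_operators S"
  shows "(\<lambda>f. c *\<^sub>C a f) \<in> bounded_operators S"
proof -
  obtain K where K: "K \<ge> 0" "\<And>f. f \<in> S \<Longrightarrow> norm (a f) \<le> K * norm f"
    using bounded_operators_bound[OF assms(2)] by metis
  then show ?thesis
    by (intro bounded_operatorsI[where K = "cmod c * K"])
      (auto simp: bounded_operatorsD[OF assms(2)] scaleC_add_right scaleC_scaleC
        norm_scaleC mult.assoc mult_left_mono csubspaceD[OF assms(1)] mult.commute[of c])
qed

section \<open>Closure properties of commutants\<close>

context
  fixes S :: "'a::complex_inner set" and X :: "('a \<Rightarrow> 'a) set"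
  assumes S: "csubspace S" and X: "X \<subseteq> bounded_operators S"
begin

lemma id_commutant: "id \<in> commutant S X"
  by (simp add: commutant_def)

lemma comp_commutant: "a \<in> commutant S X \<Longrightarrow> b \<in> commutant S X \<Longrightarrow> a \<circ> b \<in> commutant S X"
  unfolding commutant_def using comp_bounded[of a S b] by (auto simp: bounded_operatorsD(1))

lemma add_commutant:
  assumes "a \<in> commutant S X" "b \<in> commutant S X"
  shows "(\<lambda>f. a f + b f) \<in> commutant S X"
proof -
  have "c (a f + b f) = c (a f) + c (b f)" if "c \<in> X" "f \<in> S" for c f
    using assms X that by (auto simp: commutant_def bounded_operatorsD)
  then show ?thesis
    using assms add_bounded[OF S, of a b] by (auto simp: commutant_def)
qed

lemma scaleC_commutant:
  assumes "a \<in> commutant S X"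
  shows "(\<lambda>f. c *\<^sub>C a f) \<in> commutant S X"
proof -
  have "b (c *\<^sub>C a f) = c *\<^sub>C b (a f)" if "b \<in> X" "f \<in> S" for b f
    using assms X that by (auto simp: commutant_def bounded_operatorsD)
  then show ?thesis
    using assms scaleC_bounded[OF S, of a] by (auto simp: commutant_def)
qed

lemma diff_commutant:
  assumes "a \<in> commutant S X" "b \<in> commutant S X"
  shows "(\<lambda>f. a f - b f) \<in> commutant S X"
  using add_commutant[OF assms(1) scaleC_commutant[OF assms(2), of "-1"]] by simp

lemma sum_commutant:
  assumes "\<And>i. i \<in> I \<Longrightarrow> a i \<in> commutant S X"
  shows "(\<lambda>f. \<Sum>i\<in>I. a i f) \<in> commutant S X"
proof -
  have zero: "(\<lambda>f. 0) \<in> commutant S X"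
    using diff_commutant[OF id_commutant id_commutant] by simp
  show ?thesis
    using assms
    by (induction I rule: infinite_finite_induct) (simp_all add: zero add_commutant)
qed

end

lemma commutant_bounded: "commutant S X \<subseteq> bounded_operators S"
  by (auto simp: commutant_def)

section \<open>Adjoints and unitaries\<close>

lemma adjoint_pair_sym: "adjoint_pair S a b \<Longrightarrow> adjoint_pair S b a"
  unfolding adjoint_pair_def by (metis cinner_commute)

lemma adjoint_pair_comp:
  assumes "adjoint_pair UNIV a a'" "adjoint_pair UNIV b b'"
  shows "adjoint_pair UNIV (\<lambda>f. a (b f)) (\<lambda>f. b' (a' f))"
  using assms by (simp add: adjoint_pair_def)

lemma unitary_norm:
  assumes "unitary_operator S u" "f \<in> S"
  shows "norm (u f) = norm f"
proof -
  have "cinner (u f) (u f) = cinner f f"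
    using assms by (auto simp: unitary_operator_def adjoint_pair_def bounded_operatorsD(1))
  then show ?thesis
    by (simp add: norm_eq_sqrt_inner inner_cinner)
qed

lemma unitary_id: "unitary_operator S id"
  by (auto simp: unitary_operator_def adjoint_pair_def intro!: bexI[of _ id])

lemma unitary_comp:
  assumes "unitary_operator S u" "unitary_operator S v"
  shows "unitary_operator S (u \<circ> v)"
proof -
  obtain u' where u': "u' \<in> bounded_operators S" "adjoint_pair S u u'"
      "\<And>f. f \<in> S \<Longrightarrow> u' (u f) = f \<and> u (u' f) = f"
    using assms(1) by (auto simp: unitary_operator_def)
  obtain v' where v': "v' \<in> bounded_operators S" "adjoint_pair S v v'"
      "\<And>f. f \<in> S \<Longrightarrow> v' (v f) = f \<and> v (v' f) = f"
    using assms(2) by (auto simp: unitary_operator_def)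
  have u: "u \<in> bounded_operators S" and v: "v \<in> bounded_operators S"
    using assms by (auto simp: unitary_operator_def)
  show ?thesis
    unfolding unitary_operator_def
    by (intro conjI bexI[of _ "v' \<circ> u'"] ballI comp_bounded u v u'(1) v'(1))
      (use u'(2,3) v'(2,3) in \<open>auto simp: adjoint_pair_def bounded_operatorsD(1)[OF u]
        bounded_operatorsD(1)[OF v] bounded_operatorsD(1)[OF u'(1)] bounded_operatorsD(1)[OF v'(1)]\<close>)
qed

text \<open>Commutation passes to the inverse by inserting \<open>u (v f)\<close> for
  \<open>f\<close> and moving \<open>u\<close> past \<open>b\<close>. Hence the inverse stays in the
  commutant without any argument about adjoints of elements of \<open>X\<close>.\<close>

lemma unitary_inverse:
  assumes "unitary_operator S u" "u \<in> commutant S X" "X \<subseteq> bounded_operators S"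
  obtains v where "v \<in> commutant S X" "unitary_operator S v" "adjoint_pair S u v"
    "\<And>f. f \<in> S \<Longrightarrow> v (u f) = f" "\<And>f. f \<in> S \<Longrightarrow> u (v f) = f"
proof -
  obtain v where v: "v \<in> bounded_operators S" "adjoint_pair S u v"
      "\<And>f. f \<in> S \<Longrightarrow> v (u f) = f" "\<And>f. f \<in> S \<Longrightarrow> u (v f) = f"
    using assms(1) by (auto simp: unitary_operator_def)
  have u: "u \<in> bounded_operators S"
    using assms by (auto simp: unitary_operator_def)
  have "unitary_operator S v"
    unfolding unitary_operator_def
    by (intro conjI bexI[of _ u] v u ballI adjoint_pair_sym)
  moreover have "v (b f) = b (v f)" if "b \<in> X" "f \<in> S" for b f
  proof -
    have vf: "v f \<in> S" "b (v f) \<in> S"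
      using v(1) assms(3) that by (auto simp: bounded_operatorsD(1) subset_iff)
    have "v (b f) = v (b (u (v f)))"
      using v(4) that by simp
    also have "\<dots> = v (u (b (v f)))"
      using assms(2) that vf by (auto simp: commutant_def)
    finally show ?thesis
      using v(3)[OF vf(2)] by simp
  qed
  ultimately show ?thesis
    using v by (intro that[of v]) (simp_all add: commutant_def)
qed


section \<open>The Cayley transform of a skew-adjoint operator\<close>

context
  fixes S :: "'a::complex_inner set" and K :: "'a \<Rightarrow> 'a"
  assumes S: "csubspace S" and complete_S: "complete S" and K: "K \<in> bounded_operators S"
    and skew: "adjoint_pair S K (\<lambda>f. - K f)"
begin

lemma skew_orthogonal: "f \<in> S \<Longrightarrow> inner f (K f) = 0"
  using skew inner_commute[of f "K f"]
  by (simp add: adjoint_pair_def inner_cinner cinner_minus_right)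

lemma norm_combination:
  assumes "f \<in> S"
  shows "(norm (r *\<^sub>R f + t *\<^sub>R K f))\<^sup>2 = r\<^sup>2 * (norm f)\<^sup>2 + t\<^sup>2 * (norm (K f))\<^sup>2"
  using skew_orthogonal[OF assms]
  by (simp add: power2_norm_eq_inner inner_add_left inner_add_right inner_commute[of "K f" f]
      power2_eq_square[of r] power2_eq_square[of t])

text \<open>Pythagoras, since \<open>f\<close> and \<open>K f\<close> are orthogonal in the real
  inner product. The first bound makes \<open>1 - K\<close> injective; the equality makes the Cayley
  transform isometric.\<close>

lemma norm_le_resolvent:
  assumes "f \<in> S"
  shows "norm f \<le> norm (f - K f)" "norm (f + K f) = norm (f - K f)"
proof -
  have *: "(norm (f - K f))\<^sup>2 = (norm f)\<^sup>2 + (norm (K f))\<^sup>2"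
    "(norm (f + K f))\<^sup>2 = (norm f)\<^sup>2 + (norm (K f))\<^sup>2"
    using norm_combination[OF assms, of 1 "-1"] norm_combination[OF assms, of 1 1] by simp_all
  show "norm f \<le> norm (f - K f)"
    by (rule power2_le_imp_le) (simp_all add: *)
  show "norm (f + K f) = norm (f - K f)"
    using * by (metis norm_ge_zero power2_eq_iff_nonneg)
qed

lemma resolvent_unique:
  assumes "f \<in> S" "g \<in> S" "f - K f = g - K g"
  shows "f = g"
proof -
  have "norm (f - g) \<le> norm ((f - g) - K (f - g))"
    using assms csubspaceD[OF S] by (intro norm_le_resolvent) auto
  also have "(f - g) - K (f - g) = 0"
    using assms by (simp add: bounded_operators_diff[OF S K] algebra_simps)
  finally show ?thesis by simp
qed

text \<open>With \<open>t = 1 / (1 + L\<^sup>2)\<close>, where \<open>L\<close> bounds \<open>K\<close>, the map \<open>f \<mapsto> f - t (f - K f - h)\<close> has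
  Lipschitz constant \<open>sqrt (1 - t)\<close>, because \<open>K f\<close> is orthogonal to \<open>f\<close> in the real inner product.\<close>

lemma resolvent_exists:
  assumes "h \<in> S"
  shows "\<exists>f\<in>S. f - K f = h"
proof -
  obtain L where L: "L \<ge> 0" "\<And>f. f \<in> S \<Longrightarrow> norm (K f) \<le> L * norm f"
    using bounded_operators_bound[OF K] by metis
  define t where "t = 1 / (1 + L\<^sup>2)"
  have pos: "1 + L\<^sup>2 > 0"
    by (smt (verit) zero_le_power2)
  have t: "0 < t" "t \<le> 1" "t * (1 + L\<^sup>2) = 1"
    using pos by (auto simp: t_def)
  define T where "T f = f - t *\<^sub>R (f - K f - h)" for f
  have lipschitz: "dist (T f) (T g) \<le> sqrt (1 - t) * dist f g" if fg: "f \<in> S" "g \<in> S" for f g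
  proof -
    have d: "f - g \<in> S"
      using csubspaceD(5)[OF S] fg by blast
    have "(1 - t)\<^sup>2 + t\<^sup>2 * L\<^sup>2 = 1 - 2 * t + t * (t * (1 + L\<^sup>2))"
      by (simp add: power2_eq_square algebra_simps)
    then have c: "(1 - t)\<^sup>2 + t\<^sup>2 * L\<^sup>2 = 1 - t"
      unfolding t(3) by simp
    have "T f - T g = (1 - t) *\<^sub>R (f - g) + t *\<^sub>R K (f - g)"
      by (simp add: T_def bounded_operators_diff[OF S K fg] algebra_simps)
    then have "(dist (T f) (T g))\<^sup>2 = (1 - t)\<^sup>2 * (norm (f - g))\<^sup>2 + t\<^sup>2 * (norm (K (f - g)))\<^sup>2"
      by (simp add: dist_norm norm_combination[OF d])
    also have "\<dots> \<le> (1 - t)\<^sup>2 * (norm (f - g))\<^sup>2 + t\<^sup>2 * (L * norm (f - g))\<^sup>2"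
      using L(2)[OF d] by (intro add_left_mono mult_left_mono power_mono) auto
    also have "\<dots> = ((1 - t)\<^sup>2 + t\<^sup>2 * L\<^sup>2) * (norm (f - g))\<^sup>2"
      by (simp add: power_mult_distrib algebra_simps)
    also have "\<dots> = (sqrt (1 - t) * dist f g)\<^sup>2"
      using t by (simp add: c power_mult_distrib dist_norm)
    finally show ?thesis
      by (rule power2_le_imp_le) (use t in simp)
  qed
  have TS: "T ` S \<subseteq> S"
    using assms bounded_operatorsD(1)[OF K] by (auto simp: T_def intro!: csubspaceD[OF S])
  have "\<exists>!f\<in>S. T f = f"
    by (rule Banach_fix[OF complete_S _ _ _ TS lipschitz]) (use t csubspaceD(1)[OF S] in auto)
  then obtain f where f: "f \<in> S" "T f = f"
    by blast
  then have "f - K f - h = 0"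
    using t(1) by (simp add: T_def)
  then show ?thesis
    using f(1) by (intro bexI[of _ f]) simp_all
qed

lemma resolvent:
  obtains R where "\<And>f. f \<in> S \<Longrightarrow> R f \<in> S" "\<And>f. f \<in> S \<Longrightarrow> R f - K (R f) = f"
    "\<And>f. f \<in> S \<Longrightarrow> R (f - K f) = f"
proof -
  obtain R where R: "\<And>f. f \<in> S \<Longrightarrow> R f \<in> S \<and> R f - K (R f) = f"
    using resolvent_exists by metis
  moreover have "R (f - K f) = f" if f: "f \<in> S" for f
    using R[OF csubspaceD(5)[OF S f bounded_operatorsD(1)[OF K f]]] f resolvent_unique by blast
  ultimately show ?thesis
    using that by blast
qed

end

text \<open>\<open>C\<close> is \<open>(1 + K) (1 - K)^-1\<close>. It satisfies
  \<open>C f - K (C f) = f + K f\<close>, so applying \<open>1 - K\<close> to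
  \<open>C f - K f\<close> and to \<open>C f - f\<close> gives \<open>f + K (K f)\<close> and
  \<open>2 K f\<close>; as \<open>1 - K\<close> does not decrease norms, both estimates follow. Thus
  \<open>C\<close> is close to \<open>K\<close> where \<open>K\<close> squares to about
  \<open>-1\<close>, and close to the identity where \<open>K\<close> almost vanishes.\<close>

lemma cayley_transform:
  fixes S :: "'a::complex_inner set"
  assumes S: "csubspace S" and "complete S" and skew: "adjoint_pair S K (\<lambda>f. - K f)"
    and X: "X \<subseteq> bounded_operators S" and KX: "K \<in> commutant S X"
  obtains C where "C \<in> commutant S X" "unitary_operator S C"
    "\<And>f. f \<in> S \<Longrightarrow> norm (C f - K f) \<le> norm (f + K (K f))"
    "\<And>f. f \<in> S \<Longrightarrow> norm (C f - f) \<le> 2 * norm (K f)"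
proof -
  have K: "K \<in> bounded_operators S"
    using KX commutant_bounded by blast
  \<comment> \<open>The resolvent of \<open>- K\<close> inverts \<open>1 + K\<close>, which is
    needed for the inverse \<open>C'\<close> of \<open>C\<close>.\<close>
  define K' where "K' f = - K f" for f
  have K': "K' \<in> bounded_operators S"
    using scaleC_bounded[OF S K, of "-1"] by (simp add: K'_def[abs_def])
  have skew': "adjoint_pair S K' (\<lambda>f. - K' f)"
    using skew by (auto simp: adjoint_pair_def K'_def cinner_minus_left cinner_minus_right)
  note KS = bounded_operatorsD(1)[OF K] and sub = csubspaceD[OF S]
  note lin = bounded_operatorsD(2,3)[OF K] bounded_operators_diff[OF S K]
  obtain R where R: "\<And>f. f \<in> S \<Longrightarrow> R f \<in> S" "\<And>f. f \<in> S \<Longrightarrow> R f - K (R f) = f"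
      "\<And>f. f \<in> S \<Longrightarrow> R (f - K f) = f"
    using resolvent[OF S assms(2) K skew] by blast
  obtain R' where R': "\<And>f. f \<in> S \<Longrightarrow> R' f \<in> S" "\<And>f. f \<in> S \<Longrightarrow> R' f + K (R' f) = f"
      "\<And>f. f \<in> S \<Longrightarrow> R' (f + K f) = f"
    using resolvent[OF S assms(2) K' skew'] by (auto simp: K'_def)
  define C where "C f = R f + K (R f)" for f
  define C' where "C' f = R' f - K (R' f)" for f
  have CS: "C f \<in> S" "C' f \<in> S" if "f \<in> S" for f
    using that by (auto simp: C_def C'_def R R' KS sub)
  have C: "C (f - K f) = f + K f" "C' (f + K f) = f - K f" if "f \<in> S" for f
    using that by (auto simp: C_def C'_def R R' KS sub)
  \<comment> \<open>Every property of \<open>C\<close> is checked on vectors written as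
    \<open>g - K g\<close>, where \<open>C\<close> is simply the exchange with
    \<open>g + K g\<close>.\<close>
  have surj: "\<exists>g\<in>S. f = g - K g" "\<exists>g\<in>S. f = g + K g" if "f \<in> S" for f
    using R(1,2)[OF that] R'(1,2)[OF that] by metis+
  have Cb: "C \<in> bounded_operators S"
  proof (rule bounded_operatorsI[where K = 1])
    fix f g c assume "f \<in> S" "g \<in> S"
    then obtain f' g' where *: "f' \<in> S" "f = f' - K f'" "g' \<in> S" "g = g' - K g'"
      using surj(1) by blast
    have "f + g = (f' + g') - K (f' + g')"
      using * by (simp add: lin)
    then have "C (f + g) = (f' + g') + K (f' + g')"
      using * C(1)[of "f' + g'"] by (simp only: sub)
    then show "C (f + g) = C f + C g"
      using * by (simp add: C lin)
  next
    fix f c assume "f \<in> S"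
    then obtain f' where *: "f' \<in> S" "f = f' - K f'"
      using surj(1) by blast
    have "c *\<^sub>C f = (c *\<^sub>C f') - K (c *\<^sub>C f')"
      using * by (simp add: lin scaleC_diff_right)
    then have "C (c *\<^sub>C f) = (c *\<^sub>C f') + K (c *\<^sub>C f')"
      using * C(1)[of "c *\<^sub>C f'"] by (simp only: sub)
    then show "C (c *\<^sub>C f) = c *\<^sub>C C f"
      using * by (simp add: C lin scaleC_add_right)
    show "norm (C f) \<le> 1 * norm f"
      using * norm_le_resolvent(2)[OF S assms(2) K skew, of f'] by (simp add: C)
  qed (rule CS)
  have C'b: "C' \<in> bounded_operators S"
  proof (rule bounded_operatorsI[where K = 1])
    fix f g c assume "f \<in> S" "g \<in> S"
    then obtain f' g' where *: "f' \<in> S" "f = f' + K f'" "g' \<in> S" "g = g' + K g'"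
      using surj(2) by blast
    have "f + g = (f' + g') + K (f' + g')"
      using * by (simp add: lin)
    then have "C' (f + g) = (f' + g') - K (f' + g')"
      using * C(2)[of "f' + g'"] by (simp only: sub)
    then show "C' (f + g) = C' f + C' g"
      using * by (simp add: C lin)
  next
    fix f c assume "f \<in> S"
    then obtain f' where *: "f' \<in> S" "f = f' + K f'"
      using surj(2) by blast
    have "c *\<^sub>C f = (c *\<^sub>C f') + K (c *\<^sub>C f')"
      using * by (simp add: lin scaleC_add_right)
    then have "C' (c *\<^sub>C f) = (c *\<^sub>C f') - K (c *\<^sub>C f')"
      using * C(2)[of "c *\<^sub>C f'"] by (simp only: sub)
    then show "C' (c *\<^sub>C f) = c *\<^sub>C C' f"
      using * by (simp add: C lin scaleC_diff_right)
    show "norm (C' f) \<le> 1 * norm f"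
      using * norm_le_resolvent(2)[OF S assms(2) K skew, of f'] by (simp add: C)
  qed (rule CS)
  have inv: "C' (C f) = f" "C (C' f) = f" if "f \<in> S" for f
    using surj[OF that] by (metis C)+
  have "cinner (C f) g = cinner f (C' g)" if fg: "f \<in> S" "g \<in> S" for f g
  proof -
    obtain f' g' where *: "f' \<in> S" "f = f' - K f'" "g' \<in> S" "g = g' + K g'"
      using surj(1)[OF fg(1)] surj(2)[OF fg(2)] by blast
    have "cinner (K f') g' = - cinner f' (K g')"
      using skew *(1,3) by (simp add: adjoint_pair_def cinner_minus_right)
    then show ?thesis
      using * by (simp add: C cinner_add_left cinner_add_right cinner_diff_left cinner_diff_right)
  qed
  then have unitary: "unitary_operator S C"
    unfolding unitary_operator_def adjoint_pair_def using Cb C'b inv by blast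
  have commutes: "C (b f) = b (C f)" if b: "b \<in> X" and f: "f \<in> S" for b f
  proof -
    have b': "b \<in> bounded_operators S"
      using b X by blast
    obtain g where g: "g \<in> S" "f = g - K g"
      using surj(1)[OF f] by blast
    have "b (K g) = K (b g)"
      using KX b g by (auto simp: commutant_def)
    then show ?thesis
      using g C(1)[of g] C(1)[of "b g"]
      by (simp add: bounded_operatorsD[OF b'] bounded_operators_diff[OF S b'] KS)
  qed
  have key: "C f - K (C f) = f + K f" if "f \<in> S" for f
  proof -
    obtain g where g: "g \<in> S" "f = g - K g"
      using surj(1)[OF \<open>f \<in> S\<close>] by blast
    then show ?thesis
      using C(1)[of g] by (simp add: lin KS)
  qed
  have K_bound: "norm (C f - K f) \<le> norm (f + K (K f))" if "f \<in> S" for f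
  proof -
    have "norm (C f - K f) \<le> norm ((C f - K f) - K (C f - K f))"
      using that CS KS sub by (intro norm_le_resolvent(1)[OF S assms(2) K skew]) auto
    also have "(C f - K f) - K (C f - K f) = f + K (K f)"
      using key[OF that] that CS KS by (simp add: lin algebra_simps)
    finally show ?thesis .
  qed
  have id_bound: "norm (C f - f) \<le> 2 * norm (K f)" if "f \<in> S" for f
  proof -
    have "norm (C f - f) \<le> norm ((C f - f) - K (C f - f))"
      using that CS KS sub by (intro norm_le_resolvent(1)[OF S assms(2) K skew]) auto
    also have "(C f - f) - K (C f - f) = 2 *\<^sub>R K f"
      using key[OF that] that CS KS by (simp add: lin algebra_simps scaleR_2)
    finally show ?thesis by simp
  qed
  show ?thesis
    by (rule that[of C]) (use Cb commutes unitary K_bound id_bound in \<open>simp_all add: commutant_def\<close>)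
qed

section \<open>The group of local unitaries\<close>

text \<open>A product over an arbitrary list of sites, so that induction on the list is possible;
  \<open>local_product N\<close> is the instance \<open>[1..<Suc N]\<close>.\<close>

definition site_product :: "(nat \<Rightarrow> 'a \<Rightarrow> 'a) \<Rightarrow> nat list \<Rightarrow> 'a \<Rightarrow> 'a" where
  "site_product u xs = foldr (\<lambda>x T. u x \<circ> T) xs id"

lemma site_product_simps [simp]:
  "site_product u [] f = f"
  "site_product u (x # xs) f = u x (site_product u xs f)"
  by (simp_all add: site_product_def)

lemma local_product_eq: "local_product N u = site_product u [1..<Suc N]"
  by (simp only: local_product_def site_product_def)

text \<open>Used twice: for the given algebras on \<open>\<H>\<close>, and for the joint collection
  on \<open>qudits N d\<close>. Presenting \<open>M x\<close> as a commutant supplies its algebraic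
  closure properties at once, and commutation is asked for only on \<open>S\<close>.\<close>

locale commuting_commutants =
  fixes S :: "'a::complex_inner set" and N :: nat
    and A :: "nat \<Rightarrow> ('a \<Rightarrow> 'a) set" and M :: "nat \<Rightarrow> ('a \<Rightarrow> 'a) set"
  assumes subspace: "csubspace S"
    and A_bounded: "x \<in> {1..N} \<Longrightarrow> A x \<subseteq> bounded_operators S"
    and M_eq: "x \<in> {1..N} \<Longrightarrow> M x = commutant S (A x)"
    and commute: "x \<in> {1..N} \<Longrightarrow> y \<in> {1..N} \<Longrightarrow> x \<noteq> y \<Longrightarrow> a \<in> M x \<Longrightarrow> b \<in> M y
      \<Longrightarrow> f \<in> S \<Longrightarrow> a (b f) = b (a f)"
begin

lemma M_bounded: "x \<in> {1..N} \<Longrightarrow> a \<in> M x \<Longrightarrow> a \<in> bounded_operators S"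
  using M_eq commutant_bounded by blast

lemma M_closed: "x \<in> {1..N} \<Longrightarrow> a \<in> M x \<Longrightarrow> f \<in> S \<Longrightarrow> a f \<in> S"
  using M_bounded bounded_operatorsD(1) by blast

lemma
  assumes x: "x \<in> {1..N}"
  shows id_M: "id \<in> M x"
    and comp_M: "a \<in> M x \<Longrightarrow> b \<in> M x \<Longrightarrow> a \<circ> b \<in> M x"
    and add_M: "a \<in> M x \<Longrightarrow> b \<in> M x \<Longrightarrow> (\<lambda>f. a f + b f) \<in> M x"
    and scaleC_M: "a \<in> M x \<Longrightarrow> (\<lambda>f. c *\<^sub>C a f) \<in> M x"
    and diff_M: "a \<in> M x \<Longrightarrow> b \<in> M x \<Longrightarrow> (\<lambda>f. a f - b f) \<in> M x"
  unfolding M_eq[OF x]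
  by (fact id_commutant[OF subspace A_bounded[OF x]] comp_commutant[OF subspace A_bounded[OF x]]
      add_commutant[OF subspace A_bounded[OF x]] scaleC_commutant[OF subspace A_bounded[OF x]]
      diff_commutant[OF subspace A_bounded[OF x]])+

definition local_unitaries :: "(nat \<Rightarrow> 'a \<Rightarrow> 'a) \<Rightarrow> bool" where
  "local_unitaries u \<longleftrightarrow> (\<forall>x\<in>{1..N}. u x \<in> M x \<and> unitary_operator S (u x))"

section \<open>Products over a list of sites\<close>

lemma site_product_bounded:
  assumes "set xs \<subseteq> {1..N}" "\<And>x. x \<in> set xs \<Longrightarrow> u x \<in> M x"
  shows "site_product u xs \<in> bounded_operators S"
  using assms
proof (induction xs)
  case Nil
  show ?case
    using id_bounded[of S] by (simp add: site_product_def id_def)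
next
  case (Cons x xs)
  then have "u x \<in> bounded_operators S"
    by (intro M_bounded[of x]) auto
  then have "u x \<circ> site_product u xs \<in> bounded_operators S"
    using Cons by (intro comp_bounded) auto
  then show ?case
    by (simp add: site_product_def comp_def)
qed

lemma site_product_commute:
  assumes "set xs \<subseteq> {1..N}" "\<And>x. x \<in> set xs \<Longrightarrow> u x \<in> M x"
    and "\<And>f. f \<in> S \<Longrightarrow> b f \<in> S" "\<And>x f. x \<in> set xs \<Longrightarrow> f \<in> S \<Longrightarrow> u x (b f) = b (u x f)"
    and "f \<in> S"
  shows "site_product u xs (b f) = b (site_product u xs f)"
  using assms
proof (induction xs)
  case (Cons x xs)
  let ?U = "site_product u xs"
  have "?U f \<in> S"
    using Cons.prems by (intro bounded_operatorsD(1)[OF site_product_bounded]) auto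
  then have "u x (b (?U f)) = b (u x (?U f))"
    using Cons.prems(4) by simp
  moreover have "?U (b f) = b (?U f)"
    using Cons.prems by (intro Cons.IH) auto
  ultimately show ?case
    by (simp only: site_product_simps comp_apply)
qed simp

text \<open>The factor \<open>v x\<close> at the head has to pass the operators \<open>u y\<close>
  of the remaining sites. This is possible because distinctness of \<open>xs\<close> makes these
  sites different from \<open>x\<close>.\<close>

lemma site_product_comp:
  assumes "set xs \<subseteq> {1..N}" "distinct xs" "\<And>x. x \<in> set xs \<Longrightarrow> u x \<in> M x"
    and "\<And>x. x \<in> set xs \<Longrightarrow> v x \<in> M x" "f \<in> S"
  shows "site_product (\<lambda>x. u x \<circ> v x) xs f
    = site_product u xs (site_product v xs f)"
  using assms
proof (induction xs)
  case (Cons x xs)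
  let ?V = "site_product v xs" and ?U = "site_product u xs"
  have VS: "?V f \<in> S"
    using Cons.prems by (intro bounded_operatorsD(1)[OF site_product_bounded]) auto
  have x: "x \<in> {1..N}" "v x \<in> M x"
    using Cons.prems by auto
  have "u y (v x g) = v x (u y g)" if "y \<in> set xs" "g \<in> S" for y g
    using Cons.prems that by (intro commute[of y x]) auto
  then have "?U (v x (?V f)) = v x (?U (?V f))"
    using Cons.prems VS M_closed[OF x] by (intro site_product_commute) auto
  moreover have "site_product (\<lambda>x. u x \<circ> v x) xs f = ?U (?V f)"
    using Cons.prems by (intro Cons.IH) auto
  ultimately show ?case
    by (simp add: comp_def)
qed simp

lemma site_product_id:
  assumes "\<And>x f. x \<in> set xs \<Longrightarrow> f \<in> S \<Longrightarrow> u x f = f" "f \<in> S"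
  shows "site_product u xs f = f"
  using assms by (induction xs) auto

lemma local_product_comp:
  assumes "local_unitaries u" "local_unitaries v" "f \<in> S"
  shows "local_product N (\<lambda>x. u x \<circ> v x) f = local_product N u (local_product N v f)"
  unfolding local_product_eq using assms
  by (intro site_product_comp) (auto simp: local_unitaries_def)

text \<open>Agreement with a local product is required on \<open>S\<close> only. Compositions and
  inverses of local products have the product form merely on \<open>S\<close>, so this is the
  version that behaves like a group.\<close>

definition LU :: "('a \<Rightarrow> 'a) set" where
  "LU = {g. \<exists>u. local_unitaries u \<and> (\<forall>f\<in>S. g f = local_product N u f)}"

lemma LU_bounded:
  assumes "g \<in> LU"
  shows "g \<in> bounded_operators S"
proof -
  obtain u where u: "local_unitaries u" "\<And>f. f \<in> S \<Longrightarrow> g f = local_product N u f"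
    using assms by (auto simp: LU_def)
  show ?thesis
  proof (rule bounded_operators_cong[OF u(2) subspace])
    show "local_product N u \<in> bounded_operators S"
      unfolding local_product_eq using u(1) by (intro site_product_bounded) (auto simp: local_unitaries_def)
  qed
qed

lemma LU_comp:
  assumes "g \<in> LU" "h \<in> LU"
  shows "g \<circ> h \<in> LU"
proof -
  obtain u where u: "local_unitaries u" "\<And>f. f \<in> S \<Longrightarrow> g f = local_product N u f"
    using assms by (auto simp: LU_def)
  obtain v where v: "local_unitaries v" "\<And>f. f \<in> S \<Longrightarrow> h f = local_product N v f"
    using assms by (auto simp: LU_def)
  have "local_unitaries (\<lambda>x. u x \<circ> v x)"
    using u(1) v(1) by (auto simp: local_unitaries_def intro: comp_M unitary_comp)
  moreover have "(g \<circ> h) f = local_product N (\<lambda>x. u x \<circ> v x) f" if "f \<in> S" for f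
    using u v that bounded_operatorsD(1)[OF LU_bounded[OF assms(2)] that]
    by (simp add: local_product_comp)
  ultimately show ?thesis
    by (auto simp: LU_def)
qed

lemma local_unitaries_inverse:
  assumes "local_unitaries u"
  obtains v where "local_unitaries v"
    "\<And>x f. x \<in> {1..N} \<Longrightarrow> f \<in> S \<Longrightarrow> v x (u x f) = f \<and> u x (v x f) = f"
proof -
  have "\<exists>v. v \<in> M x \<and> unitary_operator S v \<and> (\<forall>f\<in>S. v (u x f) = f \<and> u x (v f) = f)"
    if x: "x \<in> {1..N}" for x
  proof -
    have "unitary_operator S (u x)" "u x \<in> commutant S (A x)"
      using assms x M_eq by (auto simp: local_unitaries_def)
    then show ?thesis
      by (rule unitary_inverse[OF _ _ A_bounded[OF x]]) (use M_eq[OF x] in auto)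
  qed
  then obtain v where "\<And>x. x \<in> {1..N} \<Longrightarrow> v x \<in> M x \<and> unitary_operator S (v x)
      \<and> (\<forall>f\<in>S. v x (u x f) = f \<and> u x (v x f) = f)"
    by metis
  then show ?thesis
    using that[of v] by (auto simp: local_unitaries_def)
qed

lemma LU_inverse:
  assumes "g \<in> LU"
  obtains h where "h \<in> LU" "\<And>f. f \<in> S \<Longrightarrow> h (g f) = f" "\<And>f. f \<in> S \<Longrightarrow> g (h f) = f"
proof -
  obtain u where u: "local_unitaries u" "\<And>f. f \<in> S \<Longrightarrow> g f = local_product N u f"
    using assms by (auto simp: LU_def)
  obtain v where v: "local_unitaries v"
    "\<And>x f. x \<in> {1..N} \<Longrightarrow> f \<in> S \<Longrightarrow> v x (u x f) = f \<and> u x (v x f) = f"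
    using local_unitaries_inverse[OF u(1)] by blast
  have h: "local_product N v \<in> LU"
    using v(1) by (auto simp: LU_def)
  have id: "local_product N (\<lambda>x. w x \<circ> w' x) f = f"
    if "\<And>x f. x \<in> {1..N} \<Longrightarrow> f \<in> S \<Longrightarrow> w x (w' x f) = f" "f \<in> S" for w w' f
    unfolding local_product_eq by (rule site_product_id) (use that in auto)
  have "local_product N v (local_product N u f) = f" "local_product N u (local_product N v f) = f"
    if "f \<in> S" for f
    using id[of v u f] id[of u v f] v(2) that
      local_product_comp[OF u(1) v(1) that] local_product_comp[OF v(1) u(1) that]
    by simp_all
  then show ?thesis
    using that[OF h] u(2) bounded_operatorsD(1)[OF LU_bounded[OF h]] by simp
qed

lemma LU_site:
  assumes "x \<in> {1..N}" "v \<in> M x" "unitary_operator S v"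
  shows "v \<in> LU"
proof -
  let ?u = "\<lambda>y. if y = x then v else id"
  have "site_product ?u xs f = (if x \<in> set xs then v f else f)" if "distinct xs" for xs f
    using that by (induction xs) auto
  from this[of "[1..<Suc N]"] have "local_product N ?u = v"
    using assms(1) by (simp add: fun_eq_iff local_product_eq del: upt_Suc)
  moreover have "local_unitaries ?u"
    using assms by (auto simp: local_unitaries_def id_M unitary_id)
  ultimately show ?thesis
    by (auto simp: LU_def intro!: exI[of _ ?u])
qed

lemma LU_id: "id \<in> LU"
proof -
  have "id f = local_product N (\<lambda>_. id) f" if "f \<in> S" for f
    unfolding local_product_eq using site_product_id[of _ "\<lambda>_. id" f] that by simp
  moreover have "local_unitaries (\<lambda>_. id)"
    by (auto simp: local_unitaries_def id_M unitary_id)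
  ultimately show ?thesis
    by (auto simp: LU_def intro!: exI[of _ "\<lambda>_. id"])
qed

lemma LU_norm:
  assumes "g \<in> LU" "f \<in> S"
  shows "norm (g f) = norm f"
proof -
  obtain u where u: "local_unitaries u" "\<And>f. f \<in> S \<Longrightarrow> g f = local_product N u f"
    using assms by (auto simp: LU_def)
  have "norm (site_product u xs f) = norm f" if "set xs \<subseteq> {1..N}" for xs
    using that
  proof (induction xs)
    case (Cons x xs)
    then have "site_product u xs f \<in> S"
      using u(1) assms(2)
      by (intro bounded_operatorsD(1)[OF site_product_bounded]) (auto simp: local_unitaries_def)
    moreover have "unitary_operator S (u x)"
      using Cons.prems u(1) by (auto simp: local_unitaries_def)
    moreover have "norm (site_product u xs f) = norm f"
      using Cons by simp
    ultimately show ?case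
      by (simp only: site_product_simps comp_apply unitary_norm)
  qed simp
  from this[of "[1..<Suc N]"] show ?thesis
    using u(2)[OF assms(2)] by (simp add: local_product_eq atLeastLessThanSuc_atLeastAtMost del: upt_Suc)
qed

text \<open>Sitewise, \<open>u\<close> is the composition of a family trivial away from
  \<open>x\<close> and a family trivial at \<open>x\<close>. The product of the second involves only
  other parties and so commutes with \<open>M x\<close>.\<close>

lemma LU_split:
  assumes "g \<in> LU" "x \<in> {1..N}"
  obtains v h where "v \<in> M x" "unitary_operator S v" "h \<in> LU"
    "\<And>f. f \<in> S \<Longrightarrow> g f = v (h f)" "\<And>a f. a \<in> M x \<Longrightarrow> f \<in> S \<Longrightarrow> h (a f) = a (h f)"
proof -
  obtain u where u: "local_unitaries u" "\<And>f. f \<in> S \<Longrightarrow> g f = local_product N u f"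
    using assms by (auto simp: LU_def)
  let ?w = "u(x := id)" and ?v = "\<lambda>y. if y = x then u x else id"
  have w: "local_unitaries ?w"
    using u(1) by (auto simp: local_unitaries_def id_M unitary_id)
  have v: "local_unitaries ?v"
    using u(1) by (auto simp: local_unitaries_def id_M unitary_id)
  have "site_product ?v xs f = (if x \<in> set xs then u x f else f)" if "distinct xs" for xs f
    using that by (induction xs) auto
  from this[of "[1..<Suc N]"] have pv: "local_product N ?v = u x"
    using assms(2) by (simp add: fun_eq_iff local_product_eq del: upt_Suc)
  have "(\<lambda>y. ?v y \<circ> ?w y) = u"
    by (auto simp: fun_eq_iff)
  then have split: "g f = u x (local_product N ?w f)" if "f \<in> S" for f
    using u(2)[OF that] local_product_comp[OF v w that] pv by simp
  have "local_product N ?w (a f) = a (local_product N ?w f)" if "a \<in> M x" "f \<in> S" for a f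
    unfolding local_product_eq
  proof (rule site_product_commute)
    fix y g assume y: "y \<in> set [1..<Suc N]" "g \<in> S"
    show "(u(x := id)) y (a g) = a ((u(x := id)) y g)"
      using y commute[of y x "u y" a g] that(1) assms(2) u(1) by (auto simp: local_unitaries_def)
  next
    fix y assume "y \<in> set [1..<Suc N]"
    then show "(u(x := id)) y \<in> M y"
      using w[unfolded local_unitaries_def, rule_format, of y] by (simp del: fun_upd_apply upt_Suc)
  qed (use that M_closed[OF assms(2)] in auto)
  moreover have "local_product N ?w \<in> LU"
    using w by (auto simp: LU_def)
  ultimately show ?thesis
    using that[of "u x" "local_product N ?w"] split u(1) assms(2) by (auto simp: local_unitaries_def)
qed

lemma approx_LU_iff:
  assumes "\<Phi> \<in> S"
  shows "approx_LU_equivalent S N M \<Psi> \<Phi> \<longleftrightarrow> (\<forall>\<epsilon>>0. \<exists>g\<in>LU. norm (\<Psi> - g \<Phi>) < \<epsilon>)"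
  unfolding approx_LU_equivalent_def
proof (intro iff_allI imp_cong refl iffI)
  fix \<epsilon> :: real
  assume "\<exists>u. (\<forall>x\<in>{1..N}. u x \<in> M x \<and> unitary_operator S (u x))
    \<and> norm (\<Psi> - local_product N u \<Phi>) < \<epsilon>"
  then obtain u where "local_unitaries u" "norm (\<Psi> - local_product N u \<Phi>) < \<epsilon>"
    by (auto simp: local_unitaries_def)
  then show "\<exists>g\<in>LU. norm (\<Psi> - g \<Phi>) < \<epsilon>"
    by (auto simp: LU_def intro!: bexI[of _ "local_product N u"])
next
  fix \<epsilon> :: real
  assume "\<exists>g\<in>LU. norm (\<Psi> - g \<Phi>) < \<epsilon>"
  then show "\<exists>u. (\<forall>x\<in>{1..N}. u x \<in> M x \<and> unitary_operator S (u x))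
    \<and> norm (\<Psi> - local_product N u \<Phi>) < \<epsilon>"
    using assms by (auto simp: LU_def local_unitaries_def)
qed

end

section \<open>Approximate eigenvectors\<close>

text \<open>This is \<open>k\<^sup>2 \<le> L k\<close> for a positive operator \<open>k\<close>
  bounded by \<open>L\<close>. It comes from expanding positivity at the vector
  \<open>f - L^-1 k f\<close> and bounding the quadratic term by Cauchy-Schwarz.\<close>

lemma norm_le_numerical_range:
  fixes k :: "'a::complex_inner \<Rightarrow> 'a"
  assumes k: "k \<in> bounded_operators UNIV" and sa: "adjoint_pair UNIV k k"
    and nonneg: "\<And>f. inner f (k f) \<ge> 0"
    and L: "L > 0" "\<And>f. norm (k f) \<le> L * norm f"
  shows "(norm (k f))\<^sup>2 \<le> L * inner f (k f)"
proof -
  note lin = bounded_operators_diff[OF csubspace_UNIV k UNIV_I UNIV_I]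
    bounded_operators_scaleR[OF csubspace_UNIV k UNIV_I]
  have sym: "inner f (k (k f)) = (norm (k f))\<^sup>2"
    using sa by (simp add: adjoint_pair_def inner_cinner power2_norm_eq_inner)
  have "inner (k f) (k (k f)) \<le> norm (k f) * (L * norm (k f))"
    by (rule order_trans[OF norm_cauchy_schwarz mult_left_mono[OF L(2)]]) simp
  then have "inverse L * (inverse L * inner (k f) (k (k f))) \<le> inverse L * (inverse L * (L * (norm (k f))\<^sup>2))"
    using L(1) by (intro mult_left_mono) (auto simp: power2_eq_square mult_ac)
  also have "\<dots> = inverse L * (norm (k f))\<^sup>2"
    using L(1) by simp
  finally have q: "inverse L * (inverse L * inner (k f) (k (k f))) \<le> inverse L * (norm (k f))\<^sup>2" .
  have "0 \<le> inner (f - inverse L *\<^sub>R k f) (k (f - inverse L *\<^sub>R k f))"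
    by (rule nonneg)
  also have "\<dots> = inner f (k f) - 2 * (inverse L * (norm (k f))\<^sup>2)
      + inverse L * (inverse L * inner (k f) (k (k f)))"
    by (simp add: lin inner_diff_left inner_diff_right sym power2_norm_eq_inner right_diff_distrib)
  finally have "inverse L * (norm (k f))\<^sup>2 \<le> inner f (k f)"
    using q by linarith
  then show ?thesis
    using L(1) by (simp add: field_simps)
qed

lemma affine_selfadjoint:
  fixes h :: "'a::complex_inner \<Rightarrow> 'a"
  assumes h: "h \<in> bounded_operators UNIV" and sa: "adjoint_pair UNIV h h"
  shows "(\<lambda>f. r *\<^sub>R f + t *\<^sub>R h f) \<in> bounded_operators UNIV"
    and "adjoint_pair UNIV (\<lambda>f. r *\<^sub>R f + t *\<^sub>R h f) (\<lambda>f. r *\<^sub>R f + t *\<^sub>R h f)"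
proof -
  have "(\<lambda>f. r *\<^sub>R id f) \<in> bounded_operators UNIV" "(\<lambda>f. t *\<^sub>R h f) \<in> bounded_operators UNIV"
    unfolding scaleR_scaleC by (intro scaleC_bounded csubspace_UNIV id_bounded h)+
  then show "(\<lambda>f. r *\<^sub>R f + t *\<^sub>R h f) \<in> bounded_operators UNIV"
    using add_bounded[OF csubspace_UNIV] by fastforce
  show "adjoint_pair UNIV (\<lambda>f. r *\<^sub>R f + t *\<^sub>R h f) (\<lambda>f. r *\<^sub>R f + t *\<^sub>R h f)"
    using sa by (simp add: adjoint_pair_def scaleR_scaleC cinner_add_left cinner_add_right
        cinner_scaleC_left cinner_scaleC_right)
qed

text \<open>The operator \<open>k = m - h\<close> is positive. A unit vector that almost attains the
  supremum makes \<open>inner f (k f)\<close> small, and the preceding bound turns this into a small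
  \<open>norm (k f)\<close>.\<close>

lemma approx_eigenvector:
  fixes h :: "'a::complex_inner \<Rightarrow> 'a"
  assumes h: "h \<in> bounded_operators UNIV" and sa: "adjoint_pair UNIV h h"
    and below: "\<And>f. norm f = 1 \<Longrightarrow> inner f (h f) \<le> m"
    and near: "\<And>e. e > 0 \<Longrightarrow> \<exists>f. norm f = 1 \<and> inner f (h f) > m - e"
    and \<eta>: "\<eta> > 0"
  shows "\<exists>f. norm f = 1 \<and> norm (h f - m *\<^sub>R f) < \<eta>"
proof -
  define k where "k f = m *\<^sub>R f + (-1) *\<^sub>R h f" for f
  have k: "k \<in> bounded_operators UNIV" "adjoint_pair UNIV k k"
    using affine_selfadjoint[OF h sa, of m "-1"] by (simp_all add: k_def[abs_def])
  obtain L where "L \<ge> 0" and L: "\<And>f. norm (k f) \<le> L * norm f"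
    using bounded_operators_bound[OF k(1)] by (metis UNIV_I)
  have L1: "norm (k f) \<le> (L + 1) * norm f" for f
    using L[of f] norm_ge_zero[of f] unfolding distrib_right by linarith
  have unit: "inner f (k f) = m - inner f (h f)" if "norm f = 1" for f
    using that by (simp add: k_def inner_diff_right power2_norm_eq_inner[symmetric])
  have nonneg: "inner f (k f) \<ge> 0" for f
  proof (cases "f = 0")
    case False
    let ?g = "inverse (norm f) *\<^sub>R f"
    have "inner ?g (k ?g) \<ge> 0"
      using unit[of ?g] below[of ?g] False by simp
    then have "inverse (norm f) * (inverse (norm f) * inner f (k f)) \<ge> 0"
      by (simp add: bounded_operators_scaleR[OF csubspace_UNIV k(1)])
    then show ?thesis
      using False by (simp add: zero_le_mult_iff)
  qed simp
  \<comment> \<open>The tolerance cancels the factor \<open>L + 1\<close> of the numerical range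
    bound. Using \<open>L + 1\<close> instead of \<open>L\<close> keeps the constant
    positive.\<close>
  obtain f where f: "norm f = 1" "inner f (h f) > m - \<eta>\<^sup>2 / (L + 1)"
    using near[of "\<eta>\<^sup>2 / (L + 1)"] \<eta> \<open>L \<ge> 0\<close> by auto
  have "(norm (k f))\<^sup>2 \<le> (L + 1) * inner f (k f)"
    using \<open>L \<ge> 0\<close> by (intro norm_le_numerical_range k nonneg L1) auto
  also have "\<dots> < (L + 1) * (\<eta>\<^sup>2 / (L + 1))"
    using f \<open>L \<ge> 0\<close> by (intro mult_strict_left_mono) (auto simp: unit)
  also have "\<dots> = \<eta>\<^sup>2"
    using \<open>L \<ge> 0\<close> by simp
  finally have "norm (k f) < \<eta>"
    using \<eta> by (simp add: power_less_imp_less_base)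
  then show ?thesis
    using f(1) by (intro exI[of _ f]) (simp add: k_def norm_minus_commute)
qed

text \<open>The two eigenvalues are the extremes of the numerical range.\<close>

lemma selfadjoint_approx_eigenvalues:
  fixes h :: "'a::complex_inner \<Rightarrow> 'a"
  assumes h: "h \<in> bounded_operators UNIV" and sa: "adjoint_pair UNIV h h"
    and nonscalar: "\<And>r. h \<noteq> (\<lambda>f. r *\<^sub>R f)"
  obtains l m :: real where "l < m"
    "\<And>\<eta>. \<eta> > 0 \<Longrightarrow> \<exists>f. norm f = 1 \<and> norm (h f - l *\<^sub>R f) < \<eta>"
    "\<And>\<eta>. \<eta> > 0 \<Longrightarrow> \<exists>f. norm f = 1 \<and> norm (h f - m *\<^sub>R f) < \<eta>"
proof -
  define V where "V = (\<lambda>f. inner f (h f)) ` {f. norm f = 1}"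
  obtain K where K: "\<And>f. norm (h f) \<le> K * norm f"
    using bounded_operators_bound[OF h] by (metis UNIV_I)
  have "\<bar>inner f (h f)\<bar> \<le> K" if "norm f = 1" for f
    using Cauchy_Schwarz_ineq2[of f "h f"] K[of f] that by simp
  then have "r \<le> K \<and> - K \<le> r" if "r \<in> V" for r
    using that by (force simp: V_def)
  then have bdd: "bdd_above V" "bdd_below V"
    by (meson bdd_aboveI bdd_belowI)+
  \<comment> \<open>If there were no unit vector, the space would be zero and \<open>h\<close> would
    be the scalar \<open>0\<close>.\<close>
  have "V \<noteq> {}"
  proof
    assume "V = {}"
    then have no_unit: "norm f \<noteq> 1" for f :: 'a
      unfolding V_def by blast
    have zero: "f = 0" for f :: 'a
    proof (rule ccontr)
      assume "f \<noteq> 0"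
      then show False
        using no_unit[of "inverse (norm f) *\<^sub>R f"] by simp
    qed
    have "h = (\<lambda>f. 0 *\<^sub>R f)"
    proof
      show "h f = 0 *\<^sub>R f" for f
        using zero[of "h f"] by simp
    qed
    then show False
      using nonscalar by blast
  qed
  define l m where "l = Inf V" and "m = Sup V"
  have lm: "l \<le> inner f (h f)" "inner f (h f) \<le> m" if "norm f = 1" for f
    using that bdd by (auto simp: l_def m_def V_def intro!: cInf_lower cSup_upper)
  have "l < m"
  proof (rule ccontr)
    assume "\<not> l < m"
    then have eq: "inner f (h f) = l" if "norm f = 1" for f
      using lm[OF that] by linarith
    \<comment> \<open>If \<open>l = m\<close>, then \<open>k = h - l\<close> has numerical range
      zero, hence vanishes by the same bound, and \<open>h\<close> is a scalar.\<close>
    define k where "k f = (-l) *\<^sub>R f + 1 *\<^sub>R h f" for f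
    have k: "k \<in> bounded_operators UNIV" "adjoint_pair UNIV k k"
      using affine_selfadjoint[OF h sa, of "-l" 1] by (simp_all add: k_def[abs_def])
    have zero: "inner f (k f) = 0" for f
    proof (cases "f = 0")
      case False
      let ?g = "inverse (norm f) *\<^sub>R f"
      have g: "norm ?g = 1"
        using False by simp
      then have "inner ?g (k ?g) = 0"
        using eq[OF g] by (simp only: k_def inner_add_right inner_scaleR_right power2_norm_eq_inner[symmetric] g) simp
      then show ?thesis
        using False by (simp add: bounded_operators_scaleR[OF csubspace_UNIV k(1)])
    qed simp
    obtain L where "L \<ge> 0" and L: "\<And>f. norm (k f) \<le> L * norm f"
      using bounded_operators_bound[OF k(1)] by (metis UNIV_I)
    have L1: "norm (k f) \<le> (L + 1) * norm f" for f
      using L[of f] norm_ge_zero[of f] unfolding distrib_right by linarith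
    have "k f = 0" for f
      using norm_le_numerical_range[OF k _ _ L1, of f] zero \<open>L \<ge> 0\<close> by simp
    then have "h = (\<lambda>f. l *\<^sub>R f)"
      by (auto simp: k_def fun_eq_iff)
    then show False
      using nonscalar by blast
  qed
  moreover have "\<exists>f. norm f = 1 \<and> norm (h f - m *\<^sub>R f) < \<eta>" if "\<eta> > 0" for \<eta>
  proof (rule approx_eigenvector[OF h sa lm(2) _ that])
    fix e :: real assume "e > 0"
    then have "m - e < Sup V"
      by (simp add: m_def)
    then show "\<exists>f. norm f = 1 \<and> m - e < inner f (h f)"
      using less_cSup_iff[OF \<open>V \<noteq> {}\<close> bdd(1)] by (auto simp: V_def)
  qed
  moreover have "\<exists>f. norm f = 1 \<and> norm (h f - l *\<^sub>R f) < \<eta>" if "\<eta> > 0" for \<eta>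
  proof -
    \<comment> \<open>The infimum for \<open>h\<close> is treated as the supremum for
      \<open>- h\<close>.\<close>
    define h' where "h' f = 0 *\<^sub>R f + (-1) *\<^sub>R h f" for f
    have h': "h' \<in> bounded_operators UNIV" "adjoint_pair UNIV h' h'"
      using affine_selfadjoint[OF h sa, of 0 "-1"] by (simp_all add: h'_def[abs_def])
    have "\<exists>f. norm f = 1 \<and> norm (h' f - (- l) *\<^sub>R f) < \<eta>"
    proof (rule approx_eigenvector[OF h' _ _ that])
      fix e :: real assume "e > 0"
      then have "Inf V < l + e"
        by (simp add: l_def)
      then obtain f where "norm f = 1" "inner f (h f) < l + e"
        using cInf_less_iff[OF \<open>V \<noteq> {}\<close> bdd(2)] by (auto simp: V_def)
      then show "\<exists>f. norm f = 1 \<and> - l - e < inner f (h' f)"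
        by (intro exI[of _ f]) (simp add: h'_def)
    qed (use lm(1) in \<open>simp add: h'_def\<close>)
    then obtain f where f: "norm f = 1" "norm (h' f - (- l) *\<^sub>R f) < \<eta>"
      by blast
    have "h' f - (- l) *\<^sub>R f = - (h f - l *\<^sub>R f)"
      by (simp add: h'_def)
    then have "norm (h f - l *\<^sub>R f) < \<eta>"
      using f(2) by (metis norm_minus_cancel)
    with f(1) show ?thesis
      by blast
  qed
  ultimately show ?thesis
    using that by blast
qed

section \<open>Consequences of LU transitivity\<close>

locale transitive_collection = commuting_commutants UNIV N A M
  for N :: nat and A M :: "nat \<Rightarrow> ('a::complex_inner \<Rightarrow> 'a) set" +
  assumes adjoint_M: "x \<in> {1..N} \<Longrightarrow> a \<in> M x \<Longrightarrow> \<exists>b\<in>M x. adjoint_pair UNIV a b"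
    and transitive: "norm \<Psi> = 1 \<Longrightarrow> norm \<Phi> = 1 \<Longrightarrow> \<epsilon> > 0 \<Longrightarrow> \<exists>g\<in>LU. norm (\<Psi> - g \<Phi>) < \<epsilon>"
    and two_parties: "N \<ge> 2"
    and nonscalar: "x \<in> {1..N} \<Longrightarrow> \<exists>a\<in>M x. \<forall>c. a \<noteq> (\<lambda>\<psi>. c *\<^sub>C \<psi>)"
begin

lemma M_linear:
  assumes "x \<in> {1..N}" "a \<in> M x"
  shows "a (f + g) = a f + a g" "a (f - g) = a f - a g" "a (c *\<^sub>C f) = c *\<^sub>C a f"
    "a (r *\<^sub>R f) = r *\<^sub>R a f" "a 0 = 0"
  using M_bounded[OF assms] bounded_operatorsD[of a UNIV] bounded_operators_diff[of UNIV a]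
    bounded_operators_scaleR[of UNIV a] bounded_operators_zero[of UNIV a]
  by simp_all

lemma M_inverse:
  assumes "x \<in> {1..N}" "v \<in> M x" "unitary_operator UNIV v"
  obtains v' where "v' \<in> M x" "unitary_operator UNIV v'" "adjoint_pair UNIV v v'"
    "\<And>f. v' (v f) = f" "\<And>f. v (v' f) = f"
proof -
  have "v \<in> commutant UNIV (A x)"
    using assms M_eq by blast
  then show ?thesis
    by (rule unitary_inverse[OF assms(3) _ A_bounded[OF assms(1)]])
      (use that M_eq[OF assms(1)] in auto)
qed

text \<open>The unitaries of the other parties commute with \<open>M x\<close> and therefore drop out.\<close>

lemma state_transfer:
  assumes x: "x \<in> {1..N}" and \<Psi>\<^sub>0: "norm \<Psi>\<^sub>0 = 1" and \<delta>: "\<delta> > 0"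
  obtains v where "v \<in> M x" "unitary_operator UNIV v"
    "\<And>q B. q \<in> M x \<Longrightarrow> (\<And>f. norm (q f) \<le> B * norm f)
      \<Longrightarrow> norm (q (v \<Psi>)) \<le> norm \<Psi> * (norm (q \<Psi>\<^sub>0) + B * \<delta>)"
proof (cases "\<Psi> = 0")
  case True
  then show ?thesis
    using that[of id] x by (auto simp: id_M unitary_id M_linear)
next
  case False
  define \<Phi> where "\<Phi> = inverse (norm \<Psi>) *\<^sub>R \<Psi>"
  have \<Phi>: "norm \<Phi> = 1" "\<Psi> = norm \<Psi> *\<^sub>R \<Phi>"
    using False by (simp_all add: \<Phi>_def)
  obtain g where g: "g \<in> LU" "norm (\<Psi>\<^sub>0 - g \<Phi>) < \<delta>"
    using transitive[OF \<Psi>\<^sub>0 \<Phi>(1) \<delta>] by blast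
  obtain v h where vh: "v \<in> M x" "unitary_operator UNIV v" "h \<in> LU"
      "\<And>f. g f = v (h f)" "\<And>a f. a \<in> M x \<Longrightarrow> h (a f) = a (h f)"
    using LU_split[OF g(1) x] by (metis UNIV_I)
  have "norm (q (v \<Psi>)) \<le> norm \<Psi> * (norm (q \<Psi>\<^sub>0) + B * \<delta>)"
    if q: "q \<in> M x" "\<And>f. norm (q f) \<le> B * norm f" for q B
  proof -
    have "B \<ge> 0"
      using order_trans[OF norm_ge_zero q(2)[of \<Psi>\<^sub>0]] \<Psi>\<^sub>0 by simp
    \<comment> \<open>The isometry \<open>h\<close> commutes with \<open>q\<close> and
      \<open>v\<close>, so
      \<open>h (q (v \<Phi>)) = q (v (h \<Phi>)) = q (g \<Phi>)\<close>.\<close>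
    have "norm (q (v \<Phi>)) = norm (h (q (v \<Phi>)))"
      using LU_norm[OF vh(3)] by simp
    also have "\<dots> = norm (q (g \<Phi>))"
      by (simp add: vh(4) vh(5)[OF q(1)] vh(5)[OF vh(1)])
    also have "q (g \<Phi>) = q \<Psi>\<^sub>0 - q (\<Psi>\<^sub>0 - g \<Phi>)"
      by (simp add: M_linear[OF x q(1)])
    also have "norm \<dots> \<le> norm (q \<Psi>\<^sub>0) + norm (q (\<Psi>\<^sub>0 - g \<Phi>))"
      by (rule norm_triangle_ineq4)
    also have "\<dots> \<le> norm (q \<Psi>\<^sub>0) + B * \<delta>"
      using order_trans[OF q(2) mult_left_mono[OF less_imp_le[OF g(2)] \<open>B \<ge> 0\<close>]] by simp
    finally have "norm \<Psi> * norm (q (v \<Phi>)) \<le> norm \<Psi> * (norm (q \<Psi>\<^sub>0) + B * \<delta>)"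
      by (intro mult_left_mono) auto
    moreover have "norm (q (v \<Psi>)) = norm \<Psi> * norm (q (v \<Phi>))"
      by (subst \<Phi>(2)) (simp add: M_linear[OF x vh(1)] M_linear[OF x q(1)])
    ultimately show ?thesis
      by simp
  qed
  then show ?thesis
    using that vh(1,2) by blast
qed

text \<open>With \<open>b\<close> adjoint to a nonscalar \<open>a\<close>, the operators
  \<open>a + b\<close> and \<open>\<i> (a - b)\<close> are selfadjoint and together determine
  \<open>a\<close>. If both were real scalars, \<open>a\<close> would be a scalar too.\<close>

lemma selfadjoint_nonscalar:
  assumes x: "x \<in> {1..N}"
  obtains h where "h \<in> M x" "adjoint_pair UNIV h h" "\<And>r. h \<noteq> (\<lambda>f. r *\<^sub>R f)"
proof -
  obtain a where a: "a \<in> M x" "\<And>c. a \<noteq> (\<lambda>\<psi>. c *\<^sub>C \<psi>)"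
    using nonscalar[OF x] by blast
  obtain b where b: "b \<in> M x" "adjoint_pair UNIV a b"
    using adjoint_M[OF x a(1)] by blast
  have ab: "cinner (a f) g = cinner f (b g)" "cinner (b f) g = cinner f (a g)" for f g
    using b(2) adjoint_pair_sym[OF b(2)] by (auto simp: adjoint_pair_def)
  define h\<^sub>1 h\<^sub>2 where "h\<^sub>1 f = a f + b f" and "h\<^sub>2 f = \<i> *\<^sub>C (a f - b f)" for f
  have h: "h\<^sub>1 \<in> M x" "h\<^sub>2 \<in> M x"
    unfolding h\<^sub>1_def[abs_def] h\<^sub>2_def[abs_def] using a b
    by (intro add_M scaleC_M diff_M x; simp)+
  have sa: "adjoint_pair UNIV h\<^sub>1 h\<^sub>1" "adjoint_pair UNIV h\<^sub>2 h\<^sub>2"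
    by (simp_all add: adjoint_pair_def h\<^sub>1_def h\<^sub>2_def ab cinner_add_left cinner_add_right
        cinner_scaleC_left cinner_scaleC_right cinner_diff_left cinner_diff_right algebra_simps)
  have "\<not> (\<exists>r t. h\<^sub>1 = (\<lambda>f. r *\<^sub>R f) \<and> h\<^sub>2 = (\<lambda>f. t *\<^sub>R f))"
  proof
    assume "\<exists>r t. h\<^sub>1 = (\<lambda>f. r *\<^sub>R f) \<and> h\<^sub>2 = (\<lambda>f. t *\<^sub>R f)"
    then obtain r t where rt: "\<And>f. h\<^sub>1 f = r *\<^sub>R f" "\<And>f. h\<^sub>2 f = t *\<^sub>R f"
      by metis
    have "a f = (complex_of_real (r / 2) - \<i> * complex_of_real (t / 2)) *\<^sub>C f" for f
    proof -
      have "2 *\<^sub>C a f = h\<^sub>1 f - \<i> *\<^sub>C h\<^sub>2 f"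
        using scaleC_add_left[of 1 1 "a f"] by (simp add: h\<^sub>1_def h\<^sub>2_def scaleC_scaleC)
      also have "\<dots> = complex_of_real r *\<^sub>C f + (- (\<i> * complex_of_real t)) *\<^sub>C f"
        by (simp add: rt scaleR_scaleC scaleC_scaleC scaleC_minus_left)
      finally have "(1/2) *\<^sub>C 2 *\<^sub>C a f
          = (1/2) *\<^sub>C (complex_of_real r + (- (\<i> * complex_of_real t))) *\<^sub>C f"
        by (simp only: scaleC_add_left)
      then show ?thesis
        by (simp add: scaleC_scaleC diff_divide_distrib)
    qed
    then show False
      using a(2) by blast
  qed
  then show ?thesis
    using that h sa by metis
qed

text \<open>An affine rescaling of a selfadjoint element moves two of its approximate eigenvalues to
  \<open>0\<close> and \<open>1\<close>. The operator \<open>z\<close> is chosen before the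
  tolerance \<open>\<eta>\<close>, so its norm bound does not depend on the accuracy; only the
  vectors do.\<close>

lemma approx_projection:
  assumes x: "x \<in> {1..N}"
  obtains z where "z \<in> M x" "adjoint_pair UNIV z z"
    "\<And>\<eta>. \<eta> > 0 \<Longrightarrow> \<exists>\<chi>\<^sub>0 \<chi>\<^sub>1. norm \<chi>\<^sub>0 = 1 \<and> norm \<chi>\<^sub>1 = 1 \<and> norm (z \<chi>\<^sub>0) < \<eta> \<and> norm (z \<chi>\<^sub>1 - \<chi>\<^sub>1) < \<eta>"
proof -
  obtain h where h: "h \<in> M x" "adjoint_pair UNIV h h" "\<And>r. h \<noteq> (\<lambda>f. r *\<^sub>R f)"
    using selfadjoint_nonscalar[OF x] by blast
  obtain l m where lm: "l < m"
    "\<And>\<eta>. \<eta> > 0 \<Longrightarrow> \<exists>f. norm f = 1 \<and> norm (h f - l *\<^sub>R f) < \<eta>"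
    "\<And>\<eta>. \<eta> > 0 \<Longrightarrow> \<exists>f. norm f = 1 \<and> norm (h f - m *\<^sub>R f) < \<eta>"
    using selfadjoint_approx_eigenvalues[OF M_bounded[OF x h(1)] h(2,3)] by metis
  define s where "s = inverse (m - l)"
  have s: "s > 0" "s * (m - l) = 1"
    using lm(1) by (simp_all add: s_def)
  define z where "z f = (- (s * l)) *\<^sub>R f + s *\<^sub>R h f" for f
  have "(\<lambda>f. complex_of_real (- (s * l)) *\<^sub>C id f + complex_of_real s *\<^sub>C h f) \<in> M x"
    by (intro add_M scaleC_M id_M x h)
  then have z: "z \<in> M x"
    by (simp add: z_def[abs_def] scaleR_scaleC)
  have "adjoint_pair UNIV z z"
    using affine_selfadjoint(2)[OF M_bounded[OF x h(1)] h(2), of "- (s * l)" s] by (simp add: z_def[abs_def])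
  moreover have "\<exists>\<chi>\<^sub>0 \<chi>\<^sub>1. norm \<chi>\<^sub>0 = 1 \<and> norm \<chi>\<^sub>1 = 1 \<and> norm (z \<chi>\<^sub>0) < \<eta> \<and> norm (z \<chi>\<^sub>1 - \<chi>\<^sub>1) < \<eta>"
    if \<eta>: "\<eta> > 0" for \<eta>
  proof -
    obtain \<chi>\<^sub>0 \<chi>\<^sub>1 where \<chi>: "norm \<chi>\<^sub>0 = 1" "norm (h \<chi>\<^sub>0 - l *\<^sub>R \<chi>\<^sub>0) < \<eta> / s"
        "norm \<chi>\<^sub>1 = 1" "norm (h \<chi>\<^sub>1 - m *\<^sub>R \<chi>\<^sub>1) < \<eta> / s"
      using lm(2,3)[of "\<eta> / s"] \<eta> s(1) by auto
    have "z \<chi>\<^sub>0 = s *\<^sub>R (h \<chi>\<^sub>0 - l *\<^sub>R \<chi>\<^sub>0)"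
      by (simp add: z_def algebra_simps)
    moreover have "z \<chi>\<^sub>1 - \<chi>\<^sub>1 = z \<chi>\<^sub>1 - (s * (m - l)) *\<^sub>R \<chi>\<^sub>1"
      by (simp add: s(2))
    then have "z \<chi>\<^sub>1 - \<chi>\<^sub>1 = s *\<^sub>R (h \<chi>\<^sub>1 - m *\<^sub>R \<chi>\<^sub>1)"
      by (simp add: z_def algebra_simps)
    ultimately have "norm (z \<chi>\<^sub>0) < \<eta>" "norm (z \<chi>\<^sub>1 - \<chi>\<^sub>1) < \<eta>"
      using \<chi>(2,4) s(1) by (simp_all only: norm_scaleR) (simp_all add: pos_less_divide_eq mult.commute)
    then show ?thesis
      using \<chi>(1,3) by blast
  qed
  ultimately show ?thesis
    using that z by blast
qed

section \<open>Splitting approximate projections\<close>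

lemma comp_M': "x \<in> {1..N} \<Longrightarrow> a \<in> M x \<Longrightarrow> b \<in> M x \<Longrightarrow> (\<lambda>f. a (b f)) \<in> M x"
  using comp_M by (simp add: comp_def)

text \<open>The vector \<open>\<Psi> k\<close> shows the same bit \<open>k\<close> to both parties.
  It is an approximate eigenvector for party \<open>x\<close>, moved by a unitary of party
  \<open>y\<close> until \<open>M y\<close> sees the vector state of one of its own approximate
  eigenvectors. That unitary commutes with \<open>M x\<close> and leaves the first property
  intact.\<close>

lemma joint_approx_eigenvectors:
  assumes x: "x \<in> {1..N}" and y: "y \<in> {1..N}" and "x \<noteq> y"
  obtains z t :: "bool \<Rightarrow> 'a \<Rightarrow> 'a" and B :: real where "B \<ge> 1"
    "\<And>k. z k \<in> M x" "\<And>k. adjoint_pair UNIV (z k) (z k)" "\<And>k f. norm (z k f) \<le> B * norm f"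
    "\<And>k. t k \<in> M y" "\<And>k f. norm (t k f) \<le> B * norm f"
    "\<And>\<kappa>. \<kappa> > 0 \<Longrightarrow> \<exists>\<Psi>. \<forall>k. norm (\<Psi> k) = 1 \<and>
      (\<forall>i. norm (z i (\<Psi> k) - (if i = k then \<Psi> k else 0)) < \<kappa>) \<and>
      (\<forall>i. norm (t i (\<Psi> k) - (if i = k then \<Psi> k else 0)) < \<kappa>)"
proof -
  obtain p where p: "p \<in> M x" "adjoint_pair UNIV p p"
    "\<And>\<eta>. \<eta> > 0 \<Longrightarrow> \<exists>\<xi>\<^sub>0 \<xi>\<^sub>1. norm \<xi>\<^sub>0 = 1 \<and> norm \<xi>\<^sub>1 = 1 \<and> norm (p \<xi>\<^sub>0) < \<eta> \<and> norm (p \<xi>\<^sub>1 - \<xi>\<^sub>1) < \<eta>"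
    using approx_projection[OF x] by blast
  obtain q where q: "q \<in> M y"
    "\<And>\<eta>. \<eta> > 0 \<Longrightarrow> \<exists>\<xi>\<^sub>0 \<xi>\<^sub>1. norm \<xi>\<^sub>0 = 1 \<and> norm \<xi>\<^sub>1 = 1 \<and> norm (q \<xi>\<^sub>0) < \<eta> \<and> norm (q \<xi>\<^sub>1 - \<xi>\<^sub>1) < \<eta>"
    using approx_projection[OF y] by metis
  define z where "z k = (if k then p else (\<lambda>f. f - p f))" for k
  define t where "t k = (if k then q else (\<lambda>f. f - q f))" for k
  obtain K where K: "K \<ge> 0" "\<And>f. norm (p f) \<le> K * norm f"
    using bounded_operators_bound[OF M_bounded[OF x p(1)]] by (metis UNIV_I)
  obtain L where L: "L \<ge> 0" "\<And>f. norm (q f) \<le> L * norm f"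
    using bounded_operators_bound[OF M_bounded[OF y q(1)]] by (metis UNIV_I)
  define B where "B = K + L + 1"
  have KB: "K * norm f \<le> (B - 1) * norm f" "L * norm f \<le> (B - 1) * norm f" for f :: 'a
    using K(1) L(1) by (auto simp: B_def intro: mult_right_mono)
  have "B \<ge> 1"
    using K(1) L(1) by (simp add: B_def)
  moreover have zM: "z k \<in> M x" for k
    using p(1) diff_M[OF x id_M[OF x] p(1)] by (simp add: z_def)
  moreover have "adjoint_pair UNIV (z k) (z k)" for k
    using p(2) by (auto simp: z_def adjoint_pair_def cinner_diff_left cinner_diff_right)
  moreover have tM: "t k \<in> M y" for k
    using q(1) diff_M[OF y id_M[OF y] q(1)] by (simp add: t_def)
  moreover have "norm (z k f) \<le> B * norm f" for k f
    using K(2)[of f] KB(1)[of f] norm_triangle_ineq4[of f "p f"] norm_ge_zero[of f]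
    by (auto simp: z_def left_diff_distrib simp del: norm_ge_zero)
  moreover have tB: "norm (t k f) \<le> B * norm f" for k f
    using L(2)[of f] KB(2)[of f] norm_triangle_ineq4[of f "q f"] norm_ge_zero[of f]
    by (auto simp: t_def left_diff_distrib simp del: norm_ge_zero)
  moreover have "\<exists>\<Psi>. \<forall>k. norm (\<Psi> k) = 1 \<and>
      (\<forall>i. norm (z i (\<Psi> k) - (if i = k then \<Psi> k else 0)) < \<kappa>) \<and>
      (\<forall>i. norm (t i (\<Psi> k) - (if i = k then \<Psi> k else 0)) < \<kappa>)" if "\<kappa> > 0" for \<kappa>
  proof -
    \<comment> \<open>The defect operator \<open>r\<close> of party \<open>y\<close> has bound
      \<open>B + 1\<close>, so transfer costs \<open>\<delta> + (B + 1) * \<delta>\<close>, which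
      stays strictly below \<open>(B + 3) * \<delta>\<close>.\<close>
    define \<delta> where "\<delta> = \<kappa> / (B + 3)"
    have \<delta>: "\<delta> > 0" "(B + 3) * \<delta> = \<kappa>"
      using \<open>B \<ge> 1\<close> \<open>\<kappa> > 0\<close> by (simp_all add: \<delta>_def)
    have \<delta>': "\<delta> + (B + 1) * \<delta> < \<kappa>" "\<delta> < \<kappa>"
      using \<delta> mult_right_mono[OF \<open>B \<ge> 1\<close> less_imp_le[OF \<delta>(1)]] unfolding distrib_right by linarith+
    obtain \<xi>\<^sub>0 \<xi>\<^sub>1 where \<xi>01: "norm \<xi>\<^sub>0 = 1" "norm \<xi>\<^sub>1 = 1" "norm (p \<xi>\<^sub>0) < \<delta>" "norm (p \<xi>\<^sub>1 - \<xi>\<^sub>1) < \<delta>"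
      using p(3)[OF \<delta>(1)] by blast
    obtain \<theta>\<^sub>0 \<theta>\<^sub>1 where \<theta>01: "norm \<theta>\<^sub>0 = 1" "norm \<theta>\<^sub>1 = 1" "norm (q \<theta>\<^sub>0) < \<delta>" "norm (q \<theta>\<^sub>1 - \<theta>\<^sub>1) < \<delta>"
      using q(2)[OF \<delta>(1)] by blast
    define \<xi> \<theta> where "\<xi> k = (if k then \<xi>\<^sub>1 else \<xi>\<^sub>0)" and "\<theta> k = (if k then \<theta>\<^sub>1 else \<theta>\<^sub>0)" for k
    have \<xi>: "norm (\<xi> k) = 1" "norm (z i (\<xi> k) - (if i = k then \<xi> k else 0)) < \<delta>" for i k
      using \<xi>01 by (auto simp: \<xi>_def z_def norm_minus_commute)
    have \<theta>: "norm (\<theta> k) = 1" "norm (t i (\<theta> k) - (if i = k then \<theta> k else 0)) < \<delta>" for i k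
      using \<theta>01 by (auto simp: \<theta>_def t_def norm_minus_commute)
    have "\<exists>\<Psi>. norm \<Psi> = 1 \<and>
      (\<forall>i. norm (z i \<Psi> - (if i = k then \<Psi> else 0)) < \<kappa>) \<and>
      (\<forall>i. norm (t i \<Psi> - (if i = k then \<Psi> else 0)) < \<kappa>)" for k
    proof -
      obtain w where w: "w \<in> M y" "unitary_operator UNIV w"
        "\<And>r C. r \<in> M y \<Longrightarrow> (\<And>f. norm (r f) \<le> C * norm f)
          \<Longrightarrow> norm (r (w (\<xi> k))) \<le> norm (\<xi> k) * (norm (r (\<theta> k)) + C * \<delta>)"
        using state_transfer[OF y \<theta>(1)[of k] \<delta>(1), of "\<xi> k"] by metis
      have "norm (z i (w (\<xi> k)) - (if i = k then w (\<xi> k) else 0)) < \<kappa>" for i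
      proof -
        have "z i (w (\<xi> k)) - (if i = k then w (\<xi> k) else 0) = w (z i (\<xi> k) - (if i = k then \<xi> k else 0))"
          using commute[OF x y \<open>x \<noteq> y\<close> zM w(1)] by (simp add: M_linear[OF y w(1)])
        then show ?thesis
          using \<xi>(2)[of i k] \<delta>'(2) by (simp add: unitary_norm[OF w(2)])
      qed
      moreover have "norm (t i (w (\<xi> k)) - (if i = k then w (\<xi> k) else 0)) < \<kappa>" for i
      proof -
        define r where "r f = t i f - (if i = k then f else 0)" for f
        have "r \<in> M y"
          using diff_M[OF y tM id_M[OF y]] tM by (cases "i = k") (simp_all add: r_def[abs_def])
        moreover have "norm (r f) \<le> (B + 1) * norm f" for f
          using norm_triangle_ineq4[of "t i f" f] tB[of i f] norm_ge_zero[of f]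
          by (auto simp: r_def distrib_right simp del: norm_ge_zero)
        ultimately have "norm (r (w (\<xi> k))) \<le> norm (r (\<theta> k)) + (B + 1) * \<delta>"
          using w(3) \<xi>(1)[of k] by fastforce
        then show ?thesis
          using \<theta>(2)[of i k] \<delta>'(1) by (simp add: r_def)
      qed
      ultimately show ?thesis
        using unitary_norm[OF w(2)] \<xi>(1) by (intro exI[of _ "w (\<xi> k)"]) auto
    qed
    then show ?thesis
      by (rule choice[OF allI])
  qed
  ultimately show ?thesis
    using that by blast
qed

text \<open>The operators need to look like orthogonal projections only on the witnesses
  \<open>\<Psi> j\<close>. The norm bound \<open>C\<close> precedes \<open>\<epsilon>\<close>: the
  induction below picks its accuracy in terms of \<open>C\<close>.\<close>

definition approx_projections :: "nat \<Rightarrow> nat \<Rightarrow> bool" where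
  "approx_projections x m \<longleftrightarrow> (\<exists>C\<ge>1. \<forall>\<epsilon>>0. \<exists>p \<Psi>. \<forall>i<m.
     p i \<in> M x \<and> adjoint_pair UNIV (p i) (p i) \<and> (\<forall>f. norm (p i f) \<le> C * norm f) \<and> norm (\<Psi> i) = 1 \<and>
     (\<forall>j<m. norm (p i (\<Psi> j) - (if i = j then \<Psi> j else 0)) < \<epsilon>))"

lemma approx_projections_one:
  assumes x: "x \<in> {1..N}"
  shows "approx_projections x (Suc 0)"
proof -
  obtain \<xi> :: 'a where \<xi>: "norm \<xi> = 1"
    using approx_projection[OF x] by (metis zero_less_one)
  show ?thesis
    unfolding approx_projections_def using \<xi> id_M[OF x]
    by (intro exI[of _ 1] conjI allI impI exI[of _ "\<lambda>_. id"] exI[of _ "\<lambda>_. \<xi>"])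
      (auto simp: adjoint_pair_def)
qed

text \<open>A vector \<open>s = \<Psi> True + \<Psi> False\<close>, entangled between the parties \<open>x\<close> and \<open>y\<close>, is moved to the range of
  the last projection. As the operators of \<open>y\<close> separate the two summands without disturbing \<open>M x\<close>, the
  conjugated projection fixes both summands, and the operators of \<open>x\<close> split it into two.\<close>

lemma approx_projections_Suc:
  assumes x: "x \<in> {1..N}" and "approx_projections x (Suc n)"
  shows "approx_projections x (Suc (Suc n))"
proof -
  have "(if x = 1 then 2 else 1) \<in> {1..N}" "x \<noteq> (if x = 1 then 2 else 1)"
    using two_parties by auto
  then obtain y where y: "y \<in> {1..N}" "x \<noteq> y"
    by blast
  obtain z t :: "bool \<Rightarrow> 'a \<Rightarrow> 'a" and B where B: "B \<ge> 1"
    and z: "\<And>k. z k \<in> M x" "\<And>k. adjoint_pair UNIV (z k) (z k)" "\<And>k f. norm (z k f) \<le> B * norm f"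
    and t: "\<And>k. t k \<in> M y" "\<And>k f. norm (t k f) \<le> B * norm f"
    and joint: "\<And>\<kappa>. \<kappa> > 0 \<Longrightarrow> \<exists>\<Psi>. \<forall>k. norm (\<Psi> k) = 1 \<and>
      (\<forall>i. norm (z i (\<Psi> k) - (if i = k then \<Psi> k else 0)) < \<kappa>) \<and>
      (\<forall>i. norm (t i (\<Psi> k) - (if i = k then \<Psi> k else 0)) < \<kappa>)"
    by (rule joint_approx_eigenvectors[OF x y]) blast
  obtain C where C: "C \<ge> 1" and sep: "\<And>\<epsilon>. \<epsilon> > 0 \<Longrightarrow> \<exists>p \<Psi>. \<forall>i<Suc n.
     p i \<in> M x \<and> adjoint_pair UNIV (p i) (p i) \<and> (\<forall>f. norm (p i f) \<le> C * norm f) \<and> norm (\<Psi> i) = 1 \<and>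
     (\<forall>j<Suc n. norm (p i (\<Psi> j) - (if i = j then \<Psi> j else 0)) < \<epsilon>)"
    using assms(2) unfolding approx_projections_def by blast
  define D where "D = C * B"
  have D: "D \<ge> 1" "C \<le> D"
    using mult_mono[OF C B] mult_left_mono[OF B, of C] C by (simp_all add: D_def)
  have CD: "C \<le> C * D"
    using mult_left_mono[OF D(1), of C] C by simp
  have "\<exists>P V. \<forall>i<Suc (Suc n).
     P i \<in> M x \<and> adjoint_pair UNIV (P i) (P i) \<and> (\<forall>f. norm (P i f) \<le> (C * D) * norm f) \<and> norm (V i) = 1 \<and>
     (\<forall>j<Suc (Suc n). norm (P i (V j) - (if i = j then V j else 0)) < \<epsilon>)"
    if \<epsilon>: "\<epsilon> > 0" for \<epsilon>
  proof -
    \<comment> \<open>The largest error collected below is at most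
      \<open>21 * (D * (D * \<kappa>))\<close>, so the factor 31 leaves room for strictness.\<close>
    define \<kappa> where "\<kappa> = \<epsilon> / (31 * (D * D))"
    have "D * D \<ge> 1"
      using mult_mono[OF D(1) D(1)] D(1) by simp
    then have \<kappa>: "\<kappa> > 0" "31 * (D * (D * \<kappa>)) = \<epsilon>"
      using \<epsilon> D(1) by (simp_all add: \<kappa>_def field_simps)
    have \<kappa>D: "\<kappa> \<le> D * \<kappa>" "C * \<kappa> \<le> D * \<kappa>" "D * \<kappa> \<le> D * (D * \<kappa>)" "\<kappa> \<le> C * \<kappa>"
      using mult_right_mono[OF D(1), of \<kappa>] mult_right_mono[OF D(2), of \<kappa>]
        mult_right_mono[OF D(1), of "D * \<kappa>"] mult_right_mono[OF C, of \<kappa>] \<kappa>(1) D(1) by simp_all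
    have small: "\<kappa> < \<epsilon>" "10 * (D * \<kappa>) < \<epsilon>" "0 \<le> D * \<kappa>"
      using \<kappa> \<kappa>D(1,3) by linarith+
    obtain p \<Psi>' where "\<forall>i<Suc n. p i \<in> M x \<and> adjoint_pair UNIV (p i) (p i) \<and>
        (\<forall>f. norm (p i f) \<le> C * norm f) \<and> norm (\<Psi>' i) = 1 \<and>
        (\<forall>j<Suc n. norm (p i (\<Psi>' j) - (if i = j then \<Psi>' j else 0)) < \<kappa>)"
      using sep[OF \<kappa>(1)] by blast
    then have p: "\<And>i. i \<le> n \<Longrightarrow> p i \<in> M x" "\<And>i. i \<le> n \<Longrightarrow> adjoint_pair UNIV (p i) (p i)"
        "\<And>i f. i \<le> n \<Longrightarrow> norm (p i f) \<le> C * norm f"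
      and \<Psi>': "\<And>i. i \<le> n \<Longrightarrow> norm (\<Psi>' i) = 1"
        "\<And>i j. i \<le> n \<Longrightarrow> j \<le> n \<Longrightarrow> norm (p i (\<Psi>' j) - (if i = j then \<Psi>' j else 0)) < \<kappa>"
      by (simp_all add: less_Suc_eq_le)
    obtain \<Psi> where \<Psi>: "\<And>k. norm (\<Psi> k) = 1"
        "\<And>i k. norm (z i (\<Psi> k) - (if i = k then \<Psi> k else 0)) < \<kappa>"
        "\<And>i k. norm (t i (\<Psi> k) - (if i = k then \<Psi> k else 0)) < \<kappa>"
      using joint[OF \<kappa>(1)] by metis
    \<comment> \<open>No normalisation of \<open>s\<close> is required: the bound of
      \<open>state_transfer\<close> is homogeneous, and \<open>norm s \<le> 2\<close>
      suffices.\<close>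
    define s where "s = \<Psi> True + \<Psi> False"
    have s: "norm s \<le> 2"
      using norm_triangle_ineq[of "\<Psi> True" "\<Psi> False"] \<Psi>(1) by (simp add: s_def)
    obtain v where v: "v \<in> M x" "unitary_operator UNIV v"
      "\<And>q B. q \<in> M x \<Longrightarrow> (\<And>f. norm (q f) \<le> B * norm f)
        \<Longrightarrow> norm (q (v s)) \<le> norm s * (norm (q (\<Psi>' n)) + B * \<kappa>)"
      using state_transfer[OF x \<Psi>'(1)[OF order_refl] \<kappa>(1), of s] by metis
    obtain v' where v': "v' \<in> M x" "unitary_operator UNIV v'" "adjoint_pair UNIV v v'"
        "\<And>f. v' (v f) = f" "\<And>f. v (v' f) = f"
      using M_inverse[OF x v(1,2)] by metis
    note iso = unitary_norm[OF v(2) UNIV_I] unitary_norm[OF v'(2) UNIV_I]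
    define p' where "p' i f = v' (p i (v f))" for i f
    \<comment> \<open>\<open>R i\<close> is the defect of \<open>p' i\<close> from acting on
      \<open>s\<close> as it should: as the identity for \<open>i = n\<close>, as zero
      otherwise.\<close>
    define R where "R i f = p' i f - (if i = n then f else 0)" for i f
    have p': "p' i \<in> M x" "adjoint_pair UNIV (p' i) (p' i)" "norm (p' i f) \<le> C * norm f"
      if "i \<le> n" for i f
    proof -
      show "p' i \<in> M x"
        unfolding p'_def[abs_def] by (rule comp_M'[OF x v'(1) comp_M'[OF x p(1)[OF that] v(1)]])
      show "adjoint_pair UNIV (p' i) (p' i)"
        using adjoint_pair_comp[OF adjoint_pair_sym[OF v'(3)] adjoint_pair_comp[OF p(2)[OF that] v'(3)]]
        by (simp add: p'_def[abs_def])
      show "norm (p' i f) \<le> C * norm f"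
        using p(3)[OF that, of "v f"] by (simp add: p'_def iso)
    qed
    note p'_lin = M_linear[OF x p'(1)] and z_lin = M_linear[OF x z(1)] and v'_lin = M_linear[OF x v'(1)]
    have R: "R i \<in> M x" "norm (R i f) \<le> (2 * C) * norm f" if "i \<le> n" for i f
    proof -
      show "R i \<in> M x"
        using diff_M[OF x p'(1)[OF that] id_M[OF x]] p'(1)[OF that]
        by (cases "i = n") (simp_all add: R_def[abs_def])
      have "norm (R i f) \<le> C * norm f + norm f"
        using norm_triangle_ineq4[of "p' i f" f] p'(3)[OF that, of f] norm_ge_zero[of f]
        by (auto simp: R_def simp del: norm_ge_zero)
      also have "\<dots> \<le> (2 * C) * norm f"
        using mult_right_mono[OF C norm_ge_zero[of f]] by simp
      finally show "norm (R i f) \<le> (2 * C) * norm f" .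
    qed
    have Rs: "norm (R i s) \<le> 6 * (C * \<kappa>)" if i: "i \<le> n" for i
    proof -
      define r where "r f = p i f - (if i = n then f else 0)" for f
      have rM: "r \<in> M x"
        using diff_M[OF x p(1)[OF i] id_M[OF x]] p(1)[OF i]
        by (cases "i = n") (simp_all add: r_def[abs_def])
      have rB: "norm (r f) \<le> (C + 1) * norm f" for f
        using norm_triangle_ineq4[of "p i f" f] p(3)[OF i, of f] norm_ge_zero[of f]
        by (auto simp: r_def distrib_right simp del: norm_ge_zero)
      have "norm (R i s) = norm (r (v s))"
        using iso(2)[of "r (v s)"] by (simp add: R_def p'_def r_def v'_lin v'(4) split: if_splits)
      also have "\<dots> \<le> norm s * (norm (r (\<Psi>' n)) + (C + 1) * \<kappa>)"
        by (rule v(3)[OF rM rB])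
      also have "\<dots> \<le> 2 * (\<kappa> + (C + 1) * \<kappa>)"
        using s \<Psi>'(2)[OF i, of n] C \<kappa>(1) by (intro mult_mono) (auto simp: r_def)
      also have "\<dots> \<le> 6 * (C * \<kappa>)"
        using \<kappa>D(4) by (simp add: distrib_right)
      finally show ?thesis .
    qed
    \<comment> \<open>Here party \<open>y\<close> enters: \<open>t k\<close> extracts
      \<open>\<Psi> k\<close> from \<open>s\<close> up to \<open>2 * \<kappa>\<close> and commutes
      with \<open>R i\<close>, so smallness of \<open>R i s\<close> passes to each summand.\<close>
    have R\<Psi>: "norm (R i (\<Psi> k)) \<le> 10 * (D * \<kappa>)" if i: "i \<le> n" for i k
    proof -
      have "t k s - \<Psi> k = (t k (\<Psi> k) - \<Psi> k) + t k (\<Psi> (\<not> k))"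
        by (cases k) (simp_all add: s_def M_linear[OF y(1) t(1)])
      also have "norm \<dots> \<le> 2 * \<kappa>"
        using norm_triangle_ineq[of "t k (\<Psi> k) - \<Psi> k" "t k (\<Psi> (\<not> k))"] \<Psi>(3)[of k k] \<Psi>(3)[of k "\<not> k"]
        by simp
      finally have d: "norm (t k s - \<Psi> k) \<le> 2 * \<kappa>" .
      have "R i (\<Psi> k) = t k (R i s) - R i (t k s - \<Psi> k)"
        using commute[OF x y R(1)[OF i] t(1)[of k]] by (simp add: M_linear[OF x R(1)[OF i]])
      also have "norm \<dots> \<le> norm (t k (R i s)) + norm (R i (t k s - \<Psi> k))"
        by (rule norm_triangle_ineq4)
      also have "\<dots> \<le> B * (6 * (C * \<kappa>)) + (2 * C) * (2 * \<kappa>)"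
        by (rule add_mono[OF order_trans[OF t(2) mult_left_mono]
              order_trans[OF R(2)[OF i] mult_left_mono]]) (use Rs[OF i] d B C in auto)
      also have "\<dots> \<le> 10 * (D * \<kappa>)"
        using \<kappa>D(2) by (simp add: D_def mult_ac)
      finally show ?thesis .
    qed
    \<comment> \<open>Keeping \<open>norm (p' n f)\<close> on the right serves both the uniform
      bound on the new operators and their smallness on the old witnesses.\<close>
    have pzp: "norm (p' n (z k (p' n f))) \<le> D * (norm (p' n f))" for k f
    proof -
      have "norm (p' n (z k (p' n f))) \<le> C * (B * norm (p' n f))"
        by (rule order_trans[OF p'(3)[OF order_refl] mult_left_mono[OF z(3)]]) (use C in simp)
      then show ?thesis
        by (simp add: D_def mult_ac)
    qed
    \<comment> \<open>The last projection is replaced by two: index \<open>n\<close> uses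
      \<open>z False\<close> and \<open>Suc n\<close> uses \<open>z True\<close>, with witnesses
      \<open>\<Psi> False\<close> and \<open>\<Psi> True\<close>. Sandwiching \<open>z\<close>
      between copies of \<open>p' n\<close> keeps it selfadjoint and small on the pulled back old
      witnesses.\<close>
    define P where "P i = (if i < n then p' i else (\<lambda>f. p' n (z (i \<noteq> n) (p' n f))))" for i
    define V where "V j = (if j < n then v' (\<Psi>' j) else \<Psi> (j \<noteq> n))" for j
    have "P i \<in> M x" for i
      using p'(1)[of i] comp_M'[OF x p'(1)[OF order_refl] comp_M'[OF x z(1) p'(1)[OF order_refl]]]
      by (simp add: P_def)
    moreover have "adjoint_pair UNIV (P i) (P i)" for i
      using p'(2)[of i] adjoint_pair_comp[OF p'(2)[OF order_refl] adjoint_pair_comp[OF z(2) p'(2)[OF order_refl]]]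
      by (simp add: P_def)
    moreover have "norm (P i f) \<le> (C * D) * norm f" for i f
    proof (cases "i < n")
      case True
      then show ?thesis
        using order_trans[OF p'(3)[of i f] mult_right_mono[OF CD norm_ge_zero]] by (simp add: P_def)
    next
      case False
      have "norm (p' n (z (i \<noteq> n) (p' n f))) \<le> D * (C * norm f)"
        using D(1) by (intro order_trans[OF pzp] mult_left_mono p') auto
      with False show ?thesis
        by (simp add: P_def mult_ac)
    qed
    moreover have "norm (V i) = 1" if "i < Suc (Suc n)" for i
      using that \<Psi>(1) \<Psi>'(1) by (simp add: V_def iso)
    moreover have "norm (P i (V j) - (if i = j then V j else 0)) < \<epsilon>"
      if ij: "i < Suc (Suc n)" "j < Suc (Suc n)" for i j
    proof -
      consider "i < n" "j < n" | "i < n" "j \<ge> n" | "i \<ge> n" "j < n" | "i \<ge> n" "j \<ge> n"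
        by linarith
      then show ?thesis
      proof cases
        case 1
        then have "P i (V j) - (if i = j then V j else 0) = v' (p i (\<Psi>' j) - (if i = j then \<Psi>' j else 0))"
          by (simp add: P_def V_def p'_def v'(5) v'_lin)
        then show ?thesis
          using order.strict_trans[OF \<Psi>'(2)[of i j] small(1)] 1 by (simp only: iso)
      next
        case 2
        then have "P i (V j) - (if i = j then V j else 0) = R i (\<Psi> (j \<noteq> n))"
          by (simp add: P_def V_def R_def)
        then show ?thesis
          using order.strict_trans1[OF R\<Psi>[of i "j \<noteq> n"] small(2)] 2 by simp
      next
        case 3
        have "norm (p' n (V j)) < \<kappa>"
          using \<Psi>'(2)[of n j] 3 by (simp add: V_def p'_def v'(5) iso)
        then have "D * norm (p' n (V j)) \<le> D * \<kappa>"
          using D(1) by (intro mult_left_mono) auto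
        then have "norm (p' n (z (i \<noteq> n) (p' n (V j)))) < \<epsilon>"
          using pzp[of "i \<noteq> n" "V j"] small by linarith
        then show ?thesis
          using 3 by (simp add: P_def)
      next
        case 4
        define a b where "a \<longleftrightarrow> i \<noteq> n" and "b \<longleftrightarrow> j \<noteq> n"
        have ab: "i = j \<longleftrightarrow> a = b"
          using 4 ij by (auto simp: a_def b_def)
        let ?d = "\<lambda>f. if a = b then f else 0"
        have "P i (V j) - (if i = j then V j else 0) = p' n (z a (p' n (\<Psi> b))) - ?d (\<Psi> b)"
          using 4 by (simp add: P_def V_def ab a_def[symmetric] b_def[symmetric])
        \<comment> \<open>Writing \<open>p' n (\<Psi> b) = \<Psi> b + R n (\<Psi> b)\<close> twice
          leaves the eigenvector defect of \<open>z a\<close> and two terms containing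
          \<open>R n (\<Psi> b)\<close>.\<close>
        also have "\<dots> = p' n (z a (R n (\<Psi> b))) + p' n (z a (\<Psi> b) - ?d (\<Psi> b)) + ?d (R n (\<Psi> b))"
          by (simp add: R_def p'_lin[OF order_refl] z_lin)
        also have "norm \<dots> \<le> norm (p' n (z a (R n (\<Psi> b)))) + norm (p' n (z a (\<Psi> b) - ?d (\<Psi> b)))
            + norm (?d (R n (\<Psi> b)))"
          by (intro norm_triangle_le add_mono norm_triangle_ineq order_refl)
        also have "\<dots> \<le> D * (10 * (D * \<kappa>)) + C * \<kappa> + 10 * (D * \<kappa>)"
        proof (intro add_mono)
          have "norm (p' n (z a (R n (\<Psi> b)))) \<le> C * (B * (10 * (D * \<kappa>)))"
            by (rule order_trans[OF p'(3)[OF order_refl] mult_left_mono[OF order_trans[OF z(3) mult_left_mono]]])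
              (use C B R\<Psi>[of n b] in auto)
          then show "norm (p' n (z a (R n (\<Psi> b)))) \<le> D * (10 * (D * \<kappa>))"
            by (simp add: D_def mult_ac)
          show "norm (p' n (z a (\<Psi> b) - ?d (\<Psi> b))) \<le> C * \<kappa>"
            by (rule order_trans[OF p'(3)[OF order_refl] mult_left_mono]) (use C \<Psi>(2)[of a b] in auto)
          show "norm (?d (R n (\<Psi> b))) \<le> 10 * (D * \<kappa>)"
            using R\<Psi>[of n b] small(3) by simp
        qed
        also have "\<dots> < \<epsilon>"
          using \<kappa> \<kappa>D by linarith
        finally show ?thesis .
      qed
    qed
    ultimately show ?thesis
      by blast
  qed
  moreover have "C * D \<ge> 1"
    using C CD by linarith
  ultimately show ?thesis
    unfolding approx_projections_def by blast
qed

section \<open>Approximate matrix units\<close>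

lemma approx_projections_exist: "x \<in> {1..N} \<Longrightarrow> approx_projections x (Suc n)"
  by (induction n) (simp_all add: approx_projections_one approx_projections_Suc)

text \<open>The unitary \<open>u j\<close> moves \<open>\<Psi>\<close> to where \<open>p j\<close>
  almost fixes it. The base vector is \<open>v \<Psi>\<close> with \<open>v = u 0\<close>, close to
  the range of \<open>p 0\<close>; this makes \<open>w' j (v \<Psi>)\<close> small for
  \<open>j \<noteq> 0\<close>, so that the reset barely disturbs a register already at
  \<open>0\<close>.\<close>

lemma approx_matrix_units:
  fixes d :: nat
  assumes x: "x \<in> {1..N}" and \<Psi>: "norm \<Psi> = 1" and "d > 0" and \<delta>: "\<delta> > 0"
  shows "\<exists>v w w'. v \<in> M x \<and> unitary_operator UNIV v \<and>
    (\<forall>j<d. w j \<in> M x \<and> w' j \<in> M x \<and> adjoint_pair UNIV (w j) (w' j) \<and>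
      (j \<noteq> 0 \<longrightarrow> norm (w' j (v \<Psi>)) < \<delta>) \<and>
      (\<forall>i<d. norm (w' i (w j (v \<Psi>)) - (if i = j then v \<Psi> else 0)) < \<delta>))"
proof -
  have "approx_projections x d"
    using approx_projections_exist[OF x, of "d - 1"] \<open>d > 0\<close> by simp
  then obtain C where C: "C \<ge> 1" and sep: "\<And>\<epsilon>. \<epsilon> > 0 \<Longrightarrow> \<exists>p \<Psi>. \<forall>i<d.
     p i \<in> M x \<and> adjoint_pair UNIV (p i) (p i) \<and> (\<forall>f. norm (p i f) \<le> C * norm f) \<and> norm (\<Psi> i) = 1 \<and>
     (\<forall>j<d. norm (p i (\<Psi> j) - (if i = j then \<Psi> j else 0)) < \<epsilon>)"
    unfolding approx_projections_def by blast
  \<comment> \<open>The final estimate is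
    \<open>3 * (C * (C * \<kappa>)) + 3 * (C * \<kappa>)\<close>, at most six times
    \<open>C * (C * \<kappa>)\<close>.\<close>
  define \<kappa> where "\<kappa> = \<delta> / (7 * (C * C))"
  have "C * C \<ge> 1"
    using mult_mono[OF C C] C by simp
  then have \<kappa>: "\<kappa> > 0" "7 * (C * (C * \<kappa>)) = \<delta>"
    using \<delta> C by (simp_all add: \<kappa>_def field_simps)
  have \<kappa>C: "\<kappa> \<le> C * \<kappa>" "C * \<kappa> \<le> C * (C * \<kappa>)"
    using mult_right_mono[OF C, of \<kappa>] mult_right_mono[OF C, of "C * \<kappa>"] \<kappa>(1) C by simp_all
  have small: "3 * (C * \<kappa>) < \<delta>"
    using \<kappa> \<kappa>C by linarith
  obtain p \<Phi> where "\<forall>i<d. p i \<in> M x \<and> adjoint_pair UNIV (p i) (p i) \<and>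
      (\<forall>f. norm (p i f) \<le> C * norm f) \<and> norm (\<Phi> i) = 1 \<and>
      (\<forall>j<d. norm (p i (\<Phi> j) - (if i = j then \<Phi> j else 0)) < \<kappa>)"
    using sep[OF \<kappa>(1)] by blast
  then have p: "\<And>i. i < d \<Longrightarrow> p i \<in> M x" "\<And>i. i < d \<Longrightarrow> adjoint_pair UNIV (p i) (p i)"
      "\<And>i f. i < d \<Longrightarrow> norm (p i f) \<le> C * norm f"
    and \<Phi>: "\<And>i. i < d \<Longrightarrow> norm (\<Phi> i) = 1"
      "\<And>i j. i < d \<Longrightarrow> j < d \<Longrightarrow> norm (p i (\<Phi> j) - (if i = j then \<Phi> j else 0)) < \<kappa>"
    by simp_all
  define Q where "Q j u u' \<longleftrightarrow> u \<in> M x \<and> u' \<in> M x \<and> unitary_operator UNIV u \<and> unitary_operator UNIV u' \<and>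
      adjoint_pair UNIV u u' \<and> (\<forall>f. u' (u f) = f) \<and>
      (\<forall>i<d. norm (p i (u \<Psi>) - (if i = j then u \<Psi> else 0)) \<le> 3 * (C * \<kappa>))" for j u u'
  have "\<exists>u u'. Q j u u'" if j: "j < d" for j
  proof -
    obtain u where u: "u \<in> M x" "unitary_operator UNIV u"
      "\<And>q B. q \<in> M x \<Longrightarrow> (\<And>f. norm (q f) \<le> B * norm f)
        \<Longrightarrow> norm (q (u \<Psi>)) \<le> norm \<Psi> * (norm (q (\<Phi> j)) + B * \<kappa>)"
      using state_transfer[OF x \<Phi>(1)[OF j] \<kappa>(1), of \<Psi>] by metis
    obtain u' where u': "u' \<in> M x" "unitary_operator UNIV u'" "adjoint_pair UNIV u u'" "\<And>f. u' (u f) = f"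
      using M_inverse[OF x u(1,2)] by metis
    have "norm (p i (u \<Psi>) - (if i = j then u \<Psi> else 0)) \<le> 3 * (C * \<kappa>)" if i: "i < d" for i
    proof -
      define r where "r f = p i f - (if i = j then f else 0)" for f
      have rM: "r \<in> M x"
        using diff_M[OF x p(1)[OF i] id_M[OF x]] p(1)[OF i]
        by (cases "i = j") (simp_all add: r_def[abs_def])
      have rB: "norm (r f) \<le> (C + 1) * norm f" for f
        using norm_triangle_ineq4[of "p i f" f] p(3)[OF i, of f] norm_ge_zero[of f]
        by (auto simp: r_def distrib_right simp del: norm_ge_zero)
      have "norm (r (u \<Psi>)) \<le> norm (r (\<Phi> j)) + (C + 1) * \<kappa>"
        using u(3)[OF rM rB] \<Psi> by simp
      also have "\<dots> \<le> 3 * (C * \<kappa>)"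
        using \<Phi>(2)[OF i j] \<kappa>C(1) by (simp add: r_def distrib_right)
      finally show ?thesis
        by (simp add: r_def)
    qed
    then show ?thesis
      using u u' unfolding Q_def by blast
  qed
  then obtain u u' where "\<And>j. j < d \<Longrightarrow> Q j (u j) (u' j)"
    by metis
  then have u: "\<And>j. j < d \<Longrightarrow> u j \<in> M x" "\<And>j. j < d \<Longrightarrow> u' j \<in> M x"
      "\<And>j. j < d \<Longrightarrow> unitary_operator UNIV (u j)" "\<And>j. j < d \<Longrightarrow> unitary_operator UNIV (u' j)"
      "\<And>j. j < d \<Longrightarrow> adjoint_pair UNIV (u j) (u' j)" "\<And>j f. j < d \<Longrightarrow> u' j (u j f) = f"
      "\<And>i j. i < d \<Longrightarrow> j < d \<Longrightarrow> norm (p i (u j \<Psi>) - (if i = j then u j \<Psi> else 0)) \<le> 3 * (C * \<kappa>)"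
    unfolding Q_def by blast+
  define w w' where "w j f = p j (u j (u' 0 f))" and "w' j f = u 0 (u' j (p j f))" for j f
  have iso: "norm (u 0 (u' j f)) = norm f" if "j < d" for j f
    using unitary_norm[OF u(3)[OF \<open>d > 0\<close>]] unitary_norm[OF u(4)[OF that]] by simp
  note lin = M_linear[OF x u(1)] M_linear[OF x u(2)] M_linear[OF x p(1)]
  show ?thesis
  proof (rule exI[of _ "u 0"], rule exI[of _ w], rule exI[of _ w'], intro conjI allI impI)
    fix j assume j: "j < d"
    show "w j \<in> M x" "w' j \<in> M x"
      unfolding w_def[abs_def] w'_def[abs_def]
      by (rule comp_M'[OF x p(1)[OF j] comp_M'[OF x u(1)[OF j] u(2)[OF \<open>d > 0\<close>]]],
          rule comp_M'[OF x u(1)[OF \<open>d > 0\<close>] comp_M'[OF x u(2)[OF j] p(1)[OF j]]])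
    show "adjoint_pair UNIV (w j) (w' j)"
      using p(2)[OF j] u(5)[OF j] adjoint_pair_sym[OF u(5)[OF \<open>d > 0\<close>]]
      by (simp add: adjoint_pair_def w_def w'_def)
    show "norm (w' j (u 0 \<Psi>)) < \<delta>" if "j \<noteq> 0"
      using u(7)[OF j \<open>d > 0\<close>] that iso[OF j] small by (simp add: w'_def)
  next
    fix i j assume ij: "i < d" "j < d"
    let ?d = "\<lambda>f. if i = j then f else 0"
    \<comment> \<open>After \<open>u' 0 (u 0 \<Psi>) = \<Psi>\<close>, two approximations remain:
      \<open>p j\<close> fixes \<open>u j \<Psi>\<close>, and then \<open>p i\<close> keeps or kills
      it.\<close>
    have "w' i (w j (u 0 \<Psi>)) - ?d (u 0 \<Psi>) = u 0 (u' i (p i (p j (u j \<Psi>)) - ?d (u j \<Psi>)))"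
      using ij \<open>d > 0\<close> by (simp add: w_def w'_def u(6) lin)
    also have "norm \<dots> = norm (p i (p j (u j \<Psi>) - u j \<Psi>) + (p i (u j \<Psi>) - ?d (u j \<Psi>)))"
      by (subst iso[OF ij(1)]) (simp add: M_linear[OF x p(1)[OF ij(1)]])
    also have "\<dots> \<le> norm (p i (p j (u j \<Psi>) - u j \<Psi>)) + norm (p i (u j \<Psi>) - ?d (u j \<Psi>))"
      by (rule norm_triangle_ineq)
    also have "\<dots> \<le> C * (3 * (C * \<kappa>)) + 3 * (C * \<kappa>)"
      by (rule add_mono[OF order_trans[OF p(3)[OF ij(1)] mult_left_mono] u(7)[OF ij]])
        (use u(7)[OF ij(2) ij(2)] C in auto)
    also have "\<dots> < \<delta>"
      using \<kappa> \<kappa>C by linarith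
    finally show "norm (w' i (w j (u 0 \<Psi>)) - ?d (u 0 \<Psi>)) < \<delta>" .
  qed (use u \<open>d > 0\<close> in auto)
qed

end

section \<open>Elementary vectors and site operators\<close>

text \<open>The elementary tensor of \<open>\<xi>\<close> with the basis vector \<open>|k>\<close>.
  Such vectors span \<open>qudits N d\<close>, so bounded operators there are determined by
  them.\<close>

definition ket :: "'a::complex_inner \<Rightarrow> 'i \<Rightarrow> ('i, 'a) dsum" where
  "ket \<xi> k = family_on {k} (\<lambda>_. \<xi>)"

lemma coord_ket: "coord (ket \<xi> k) i = (if i = k then \<xi> else 0)"
  by (simp add: ket_def family_on.rep_eq)

lemma coord_add: "coord (f + g) i = coord f i + coord g i"
  by (simp add: plus_dsum.rep_eq)

lemma coord_zero [simp]: "coord 0 i = 0"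
  by (simp add: zero_dsum.rep_eq)

lemma coord_scaleC: "coord (c *\<^sub>C f) i = c *\<^sub>C coord f i"
  by (simp add: scaleC_dsum.rep_eq)

lemma coord_minus: "coord (- f) i = - coord f i"
  by (simp add: uminus_dsum.rep_eq)

lemma coord_diff: "coord (f - g) i = coord f i - coord (g :: ('i, 'a::complex_inner) dsum) i"
  using coord_add[of f "- g" i] by (simp add: coord_minus)

lemma coord_sum: "coord (sum f J) i = (\<Sum>j\<in>J. coord (f j :: ('i, 'a::complex_inner) dsum) i)"
  by (induction J rule: infinite_finite_induct) (auto simp: coord_add)

lemma ket_linear:
  "ket (\<xi> + \<theta>) k = ket \<xi> k + ket \<theta> k" "ket (\<xi> - \<theta>) k = ket \<xi> k - ket \<theta> k"
  "ket (c *\<^sub>C \<xi>) k = c *\<^sub>C ket \<xi> k" "ket 0 k = 0" "ket (- \<xi>) k = - ket \<xi> k"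
  by (rule dsum_eqI, simp add: coord_ket coord_add coord_diff coord_scaleC coord_minus)+

lemma ket_sum: "ket (sum f J) k = (\<Sum>j\<in>J. ket (f j) k)"
  by (induction J rule: infinite_finite_induct) (auto simp: ket_linear)

lemma cinner_ket: "cinner (ket \<xi> k) (ket \<theta> l) = (if k = l then cinner \<xi> \<theta> else 0)"
  by (subst cinner_dsum_superset[of "{k}"]) (auto simp: coord_ket)

lemma norm_ket: "norm (ket \<xi> k) = norm \<xi>"
  by (simp add: norm_eq_sqrt_inner inner_cinner cinner_ket)

lemma ket_expansion:
  assumes "f \<in> supported_on I" "finite I"
  shows "f = (\<Sum>k\<in>I. ket (coord f k) k)"
proof (rule dsum_eqI)
  fix i
  have "coord (\<Sum>k\<in>I. ket (coord f k) k) i = (\<Sum>k\<in>I. if k = i then coord f i else 0)"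
    unfolding coord_sum coord_ket by (intro sum.cong) auto
  then show "coord f i = coord (\<Sum>k\<in>I. ket (coord f k) k) i"
    using assms by (auto simp: supported_on_def)
qed

lemma norm_coord_le: "norm (coord f k) \<le> norm f"
proof -
  have "inner (coord f k) (coord f k) \<le> (\<Sum>i\<in>insert k {i. coord f i \<noteq> 0}. inner (coord f i) (coord f i))"
    by (rule member_le_sum) auto
  also have "\<dots> = Re (cinner f f)"
    by (subst cinner_dsum_superset[of "insert k {i. coord f i \<noteq> 0}"]) (auto simp: inner_cinner)
  finally show ?thesis
    by (simp add: norm_eq_sqrt_inner inner_cinner)
qed

lemma norm_le_sum_coord:
  assumes "f \<in> supported_on I" "finite I"
  shows "norm f \<le> (\<Sum>k\<in>I. norm (coord f k))"
proof -
  have "norm (\<Sum>k\<in>I. ket (coord f k) k) \<le> (\<Sum>k\<in>I. norm (coord f k))"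
    by (rule order_trans[OF norm_sum]) (simp add: norm_ket)
  then show ?thesis
    using ket_expansion[OF assms] by simp
qed

section \<open>The register space as a complete subspace\<close>

lemma supported_on_csubspace: "csubspace (supported_on I :: ('i, 'a::complex_inner) dsum set)"
  by (auto simp: csubspace_def supported_on_def coord_add coord_scaleC)

text \<open>Only finitely many coordinates are involved, so coordinatewise limits suffice. The
  Cayley transform needs this, because the ambient type is incomplete.\<close>

lemma supported_on_complete:
  assumes "finite I"
  shows "complete (supported_on I :: ('i, 'a::{complex_inner, complete_space}) dsum set)"
  unfolding complete_def
proof (intro allI impI, elim conjE)
  fix f :: "nat \<Rightarrow> ('i, 'a) dsum"
  assume f: "\<forall>n. f n \<in> supported_on I" "Cauchy f"
  have "Cauchy (\<lambda>n. coord (f n) k)" for k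
  proof (rule metric_CauchyI)
    fix e :: real assume "e > 0"
    then obtain n\<^sub>0 where "\<And>m n. m \<ge> n\<^sub>0 \<Longrightarrow> n \<ge> n\<^sub>0 \<Longrightarrow> dist (f m) (f n) < e"
      using metric_CauchyD[OF f(2)] by blast
    moreover have "dist (coord (f m) k) (coord (f n) k) \<le> dist (f m) (f n)" for m n
      using norm_coord_le[of "f m - f n" k] by (simp add: dist_norm coord_diff)
    ultimately show "\<exists>n\<^sub>0. \<forall>m\<ge>n\<^sub>0. \<forall>n\<ge>n\<^sub>0. dist (coord (f m) k) (coord (f n) k) < e"
      by (meson le_less_trans)
  qed
  then have "\<exists>l. (\<lambda>n. coord (f n) k) \<longlonglongrightarrow> l" for k
    using Cauchy_convergent_iff convergent_def by blast
  then obtain L where L: "\<And>k. (\<lambda>n. coord (f n) k) \<longlonglongrightarrow> L k"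
    by metis
  define l where "l = family_on I L"
  have l: "l \<in> supported_on I" "\<And>k. k \<in> I \<Longrightarrow> coord l k = L k"
    using assms by (simp_all add: l_def supported_on_def family_on.rep_eq)
  have "(\<lambda>n. \<Sum>k\<in>I. norm (coord (f n) k - L k)) \<longlonglongrightarrow> (\<Sum>k\<in>I. norm (L k - L k))"
    by (intro tendsto_sum tendsto_norm tendsto_diff L tendsto_const)
  then have lim: "(\<lambda>n. \<Sum>k\<in>I. norm (coord (f n) k - L k)) \<longlonglongrightarrow> 0"
    by simp
  have "norm (dist (f n) l) \<le> (\<Sum>k\<in>I. norm (coord (f n) k - L k))" for n
  proof -
    have "f n - l \<in> supported_on I"
      using f(1) l(1) csubspaceD(5)[OF supported_on_csubspace] by blast
    from norm_le_sum_coord[OF this assms] show ?thesis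
      using l(2) by (simp add: dist_norm coord_diff)
  qed
  then have "(\<lambda>n. dist (f n) l) \<longlonglongrightarrow> 0"
    by (intro Lim_null_comparison[OF _ lim] always_eventually) simp
  then show "\<exists>l\<in>supported_on I. f \<longlonglongrightarrow> l"
    using l(1) tendsto_dist_iff by blast
qed

lemma ket_qudits: "k \<in> multi_indices N d \<Longrightarrow> ket \<xi> k \<in> qudits N d"
  by (auto simp: qudits_def supported_on_def coord_ket)

lemma csubspace_qudits: "csubspace (qudits N d :: (multi_index, 'a::complex_inner) dsum set)"
  by (simp add: qudits_def supported_on_csubspace)

lemma complete_qudits: "complete (qudits N d :: (multi_index, 'a::{complex_inner, complete_space}) dsum set)"
  by (simp add: qudits_def supported_on_complete)

lemma qudits_expansion: "f \<in> qudits N d \<Longrightarrow> f = (\<Sum>k\<in>multi_indices N d. ket (coord f k) k)"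
  unfolding qudits_def by (rule ket_expansion) simp_all

lemma operator_expansion:
  assumes "a \<in> bounded_operators (qudits N d)" "f \<in> qudits N d"
  shows "a f = (\<Sum>k\<in>multi_indices N d. a (ket (coord f k) k))"
  using bounded_operators_sum[OF csubspace_qudits assms(1), of "multi_indices N d" "\<lambda>k. ket (coord f k) k"]
    qudits_expansion[OF assms(2)] by (simp add: ket_qudits)

lemma operators_eqI:
  assumes "a \<in> bounded_operators (qudits N d)" "b \<in> bounded_operators (qudits N d)"
    and "\<And>\<xi> k. k \<in> multi_indices N d \<Longrightarrow> a (ket \<xi> k) = b (ket \<xi> k)" "f \<in> qudits N d"
  shows "a f = b f"
  using assms(3) by (simp add: operator_expansion[OF assms(1,4)] operator_expansion[OF assms(2,4)])

lemma adjoint_pair_qudits: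
  assumes "a \<in> bounded_operators (qudits N d)" "b \<in> bounded_operators (qudits N d)"
    and "\<And>\<xi> \<theta> k l. k \<in> multi_indices N d \<Longrightarrow> l \<in> multi_indices N d
      \<Longrightarrow> cinner (a (ket \<xi> k)) (ket \<theta> l) = cinner (ket \<xi> k) (b (ket \<theta> l))"
  shows "adjoint_pair (qudits N d) a b"
  unfolding adjoint_pair_def
proof (intro ballI)
  fix f g :: "(multi_index, 'a) dsum" assume fg: "f \<in> qudits N d" "g \<in> qudits N d"
  show "cinner (a f) g = cinner f (b g)"
    unfolding operator_expansion[OF assms(1) fg(1)] operator_expansion[OF assms(2) fg(2)]
    apply (subst qudits_expansion[OF fg(2)], subst (2) qudits_expansion[OF fg(1)])
    by (simp add: cinner_sum_left cinner_sum_right assms(3))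
qed

lemma tensor_op_bounded:
  assumes a: "a \<in> bounded_operators UNIV"
  shows "tensor_op N d a T \<in> bounded_operators (qudits N d)"
proof -
  obtain K where K: "K \<ge> 0" "\<And>f. norm (a f) \<le> K * norm f"
    using bounded_operators_bound[OF a] by (metis UNIV_I)
  let ?I = "multi_indices N d"
  have co: "coord (tensor_op N d a T f) k = (if k \<in> ?I then \<Sum>l\<in>?I. T k l *\<^sub>C a (coord f l) else 0)" for f k
    by (simp add: tensor_op_def family_on.rep_eq)
  note lin = bounded_operatorsD[OF a]
  show ?thesis
  proof (rule bounded_operatorsI[where K = "\<Sum>k\<in>?I. \<Sum>l\<in>?I. cmod (T k l) * K"])
    fix f g :: "(multi_index, 'a) dsum" and c
    show in_S: "tensor_op N d a T f \<in> qudits N d"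
      by (simp add: qudits_def supported_on_def co)
    show "tensor_op N d a T (f + g) = tensor_op N d a T f + tensor_op N d a T g"
      by (rule dsum_eqI) (simp add: co coord_add lin scaleC_add_right sum.distrib)
    have sumC: "(\<Sum>l\<in>J. c *\<^sub>C h l) = c *\<^sub>C (\<Sum>l\<in>J. h l)" for J and h :: "multi_index \<Rightarrow> 'a"
      by (induction J rule: infinite_finite_induct) (auto simp: scaleC_add_right)
    show "tensor_op N d a T (c *\<^sub>C f) = c *\<^sub>C tensor_op N d a T f"
      by (rule dsum_eqI) (simp add: co coord_scaleC lin scaleC_scaleC mult.commute[of _ c] sumC[symmetric])
    have "norm (tensor_op N d a T f) \<le> (\<Sum>k\<in>?I. norm (coord (tensor_op N d a T f) k))"
      using in_S by (intro norm_le_sum_coord) (auto simp: qudits_def)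
    also have "\<dots> \<le> (\<Sum>k\<in>?I. \<Sum>l\<in>?I. (cmod (T k l) * K) * norm f)"
    proof (intro sum_mono)
      fix k assume "k \<in> ?I"
      have "norm (T k l *\<^sub>C a (coord f l)) \<le> (cmod (T k l) * K) * norm f" for l
        using order_trans[OF K(2) mult_left_mono[OF norm_coord_le K(1)], of f l]
        by (simp add: norm_scaleC mult.assoc mult_left_mono)
      then show "norm (coord (tensor_op N d a T f) k) \<le> (\<Sum>l\<in>?I. (cmod (T k l) * K) * norm f)"
        using \<open>k \<in> ?I\<close> by (simp add: co sum_norm_le)
    qed
    finally show "norm (tensor_op N d a T f) \<le> (\<Sum>k\<in>?I. \<Sum>l\<in>?I. cmod (T k l) * K) * norm f"
      by (simp add: sum_distrib_right)
  qed
qed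

section \<open>Operators acting on one register\<close>

lemma multi_index_update: "k \<in> multi_indices N d \<Longrightarrow> x \<in> {1..N} \<Longrightarrow> i < d \<Longrightarrow> k(x := i) \<in> multi_indices N d"
  by (auto simp: multi_indices_def PiE_iff extensional_def)

lemma multi_index_less: "k \<in> multi_indices N d \<Longrightarrow> x \<in> {1..N} \<Longrightarrow> k x < d"
  by (auto simp: multi_indices_def PiE_iff)

definition site_mat :: "nat \<Rightarrow> nat \<Rightarrow> (nat \<Rightarrow> nat \<Rightarrow> complex) \<Rightarrow> multi_index \<Rightarrow> multi_index \<Rightarrow> complex" where
  "site_mat N x b = tensor_mat N (\<lambda>y. if y = x then b else id_mat)"

lemma site_mat_in: "site_mat N x b \<in> site_algebra N x"
  by (auto simp: site_mat_def site_algebra_def)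

lemma site_mat_update:
  assumes "x \<in> {1..N}"
  shows "site_mat N x b (k(x := i)) k = b i (k x)"
proof -
  have "site_mat N x b (k(x := i)) k = (\<Prod>y\<in>{1..N}. if y = x then b i (k x) else 1)"
    unfolding site_mat_def tensor_mat_def by (intro prod.cong) (auto simp: id_mat_def)
  then show ?thesis
    using assms by simp
qed

lemma site_mat_zero:
  assumes "k \<in> multi_indices N d" "l \<in> multi_indices N d" "\<And>i. l \<noteq> k(x := i)"
  shows "site_mat N x b l k = 0"
proof -
  \<comment> \<open>Multi-indices are extensional, so they agree outside \<open>{1..N}\<close>. A
    difference not explained by entry \<open>x\<close> therefore meets an off-diagonal entry of
    \<open>id_mat\<close>.\<close>
  have "\<exists>y\<in>{1..N}. y \<noteq> x \<and> l y \<noteq> k y"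
  proof (rule ccontr)
    assume "\<not> ?thesis"
    then have "l y = (k(x := l x)) y" for y
      using assms(1,2) by (cases "y \<in> {1..N}") (auto simp: multi_indices_def PiE_iff extensional_def)
    then show False
      using assms(3) by blast
  qed
  then show ?thesis
    unfolding site_mat_def tensor_mat_def by (auto intro!: prod_zero simp: id_mat_def)
qed

lemma site_op_ket:
  assumes a: "a \<in> bounded_operators UNIV" and x: "x \<in> {1..N}" and k: "k \<in> multi_indices N d"
  shows "tensor_op N d a (site_mat N x b) (ket \<xi> k) = (\<Sum>i<d. ket (b i (k x) *\<^sub>C a \<xi>) (k(x := i)))"
proof -
  let ?I = "multi_indices N d"
  have a0: "a 0 = 0"
    using bounded_operators_zero[OF csubspace_UNIV a] .
  have "tensor_op N d a (site_mat N x b) (ket \<xi> k) = (\<Sum>l\<in>?I. ket (site_mat N x b l k *\<^sub>C a \<xi>) l)"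
  proof (rule dsum_eqI)
    fix l
    have "(\<Sum>m\<in>?I. site_mat N x b l m *\<^sub>C a (if m = k then \<xi> else 0))
        = (\<Sum>m\<in>?I. if m = k then site_mat N x b l k *\<^sub>C a \<xi> else 0)"
      by (intro sum.cong) (auto simp: a0)
    also have "\<dots> = site_mat N x b l k *\<^sub>C a \<xi>"
      using k by simp
    finally show "coord (tensor_op N d a (site_mat N x b) (ket \<xi> k)) l
        = coord (\<Sum>l\<in>?I. ket (site_mat N x b l k *\<^sub>C a \<xi>) l) l"
      by (simp add: tensor_op_def family_on.rep_eq coord_sum coord_ket)
  qed
  also have "\<dots> = (\<Sum>l\<in>(\<lambda>i. k(x := i)) ` {..<d}. ket (site_mat N x b l k *\<^sub>C a \<xi>) l)"
  proof (rule sum.mono_neutral_right)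
    show "(\<lambda>i. k(x := i)) ` {..<d} \<subseteq> ?I"
      using multi_index_update[OF k x] by auto
    show "\<forall>l\<in>?I - (\<lambda>i. k(x := i)) ` {..<d}. ket (site_mat N x b l k *\<^sub>C a \<xi>) l = 0"
    proof
      fix l assume l: "l \<in> ?I - (\<lambda>i. k(x := i)) ` {..<d}"
      have "l \<noteq> k(x := i)" for i
        using l multi_index_less[of l N d x] x by (cases "i < d") auto
      then show "ket (site_mat N x b l k *\<^sub>C a \<xi>) l = 0"
        using l k by (simp add: site_mat_zero ket_linear)
    qed
  qed simp
  also have "\<dots> = (\<Sum>i<d. ket (site_mat N x b (k(x := i)) k *\<^sub>C a \<xi>) (k(x := i)))"
    by (rule sum.reindex_cong[of "\<lambda>i. k(x := i)"]) (auto simp: inj_on_def fun_upd_eqD)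
  finally show ?thesis
    by (simp add: site_mat_update[OF x])
qed

text \<open>The matrix unit \<open>|i><j|\<close>.\<close>

definition unit_mat :: "nat \<Rightarrow> nat \<Rightarrow> nat \<Rightarrow> nat \<Rightarrow> complex" where
  "unit_mat i j k l = (if k = i \<and> l = j then 1 else 0)"

lemma unit_site_op_ket:
  assumes "a \<in> bounded_operators UNIV" "x \<in> {1..N}" "k \<in> multi_indices N d" "i < d"
  shows "tensor_op N d a (site_mat N x (unit_mat i j)) (ket \<xi> k)
    = (if k x = j then ket (a \<xi>) (k(x := i)) else 0)"
proof -
  have "(\<Sum>i'<d. ket (unit_mat i j i' (k x) *\<^sub>C a \<xi>) (k(x := i')))
      = (\<Sum>i'<d. if i' = i then (if k x = j then ket (a \<xi>) (k(x := i)) else 0) else 0)"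
    by (intro sum.cong) (auto simp: unit_mat_def ket_linear)
  then show ?thesis
    using assms(4) by (simp add: site_op_ket[OF assms(1-3)])
qed

lemma id_site_op_ket:
  assumes "a \<in> bounded_operators UNIV" "x \<in> {1..N}" "k \<in> multi_indices N d"
  shows "tensor_op N d a (site_mat N x id_mat) (ket \<xi> k) = ket (a \<xi>) k"
proof -
  have "(\<Sum>i<d. ket (id_mat i (k x) *\<^sub>C a \<xi>) (k(x := i))) = (\<Sum>i<d. if i = k x then ket (a \<xi>) k else 0)"
    by (intro sum.cong) (auto simp: id_mat_def ket_linear)
  then show ?thesis
    using multi_index_less[OF assms(3,2)] by (simp add: site_op_ket[OF assms])
qed

lemma site_ops_commute:
  assumes a: "a \<in> bounded_operators UNIV" "a' \<in> bounded_operators UNIV" "\<And>\<xi>. a (a' \<xi>) = a' (a \<xi>)"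
    and x: "x \<in> {1..N}" "y \<in> {1..N}" "x \<noteq> y" and f: "f \<in> qudits N d"
  shows "tensor_op N d a (site_mat N x b) (tensor_op N d a' (site_mat N y b') f)
    = tensor_op N d a' (site_mat N y b') (tensor_op N d a (site_mat N x b) f)"
proof -
  let ?t = "tensor_op N d a (site_mat N x b)" and ?t' = "tensor_op N d a' (site_mat N y b')"
  have t: "?t \<in> bounded_operators (qudits N d)" "?t' \<in> bounded_operators (qudits N d)"
    using a by (simp_all add: tensor_op_bounded)
  \<comment> \<open>All parameters are generalised, since the formula is used for both orders of the
    two operators.\<close>
  have double: "tensor_op N d a (site_mat N x b) (tensor_op N d a' (site_mat N y b') (ket \<xi> k))
      = (\<Sum>j<d. \<Sum>i<d. ket ((b i (k x) * b' j (k y)) *\<^sub>C a (a' \<xi>)) (k(y := j, x := i)))"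
    if "a \<in> bounded_operators UNIV" "a' \<in> bounded_operators UNIV" "x \<in> {1..N}" "y \<in> {1..N}" "x \<noteq> y"
      and k: "k \<in> multi_indices N d" for a a' x y b b' \<xi> k
  proof -
    have "tensor_op N d a (site_mat N x b) (tensor_op N d a' (site_mat N y b') (ket \<xi> k))
      = (\<Sum>j<d. tensor_op N d a (site_mat N x b) (ket (b' j (k y) *\<^sub>C a' \<xi>) (k(y := j))))"
      unfolding site_op_ket[OF that(2,4) k] using multi_index_update[OF k that(4)]
      by (intro bounded_operators_sum[OF csubspace_qudits tensor_op_bounded[OF that(1)]] ket_qudits) auto
    then show ?thesis
      using that(5) by (simp add: site_op_ket[OF that(1,3) multi_index_update[OF k that(4)]]
          bounded_operatorsD(3)[OF that(1)] scaleC_scaleC)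
  qed
  have "(?t \<circ> ?t') f = (?t' \<circ> ?t) f"
  proof (rule operators_eqI[OF comp_bounded[OF t] comp_bounded[OF t(2,1)] _ f])
    fix \<xi> k assume k: "k \<in> multi_indices N d"
    have "(\<Sum>j<d. \<Sum>i<d. ket ((b i (k x) * b' j (k y)) *\<^sub>C a (a' \<xi>)) (k(y := j, x := i)))
        = (\<Sum>i<d. \<Sum>j<d. ket ((b' j (k y) * b i (k x)) *\<^sub>C a' (a \<xi>)) (k(x := i, y := j)))"
      by (subst sum.swap) (simp add: a(3) mult.commute fun_upd_twist[OF x(3)])
    then show "(?t \<circ> ?t') (ket \<xi> k) = (?t' \<circ> ?t) (ket \<xi> k)"
      using x k a(1,2) by (simp add: double)
  qed
  then show ?thesis
    by simp
qed

lemma unit_site_op_adjoint: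
  assumes a: "a \<in> bounded_operators UNIV" "a' \<in> bounded_operators UNIV" "adjoint_pair UNIV a a'"
    and x: "x \<in> {1..N}" and "i < d" "j < d"
  shows "adjoint_pair (qudits N d) (tensor_op N d a (site_mat N x (unit_mat i j)))
    (tensor_op N d a' (site_mat N x (unit_mat j i)))"
proof (rule adjoint_pair_qudits[OF tensor_op_bounded[OF a(1)] tensor_op_bounded[OF a(2)]])
  fix \<xi> \<theta> k l assume kl: "k \<in> multi_indices N d" "l \<in> multi_indices N d"
  have "k x = j \<and> k(x := i) = l \<longleftrightarrow> l x = i \<and> k = l(x := j)"
    by (auto simp: fun_eq_iff)
  then show "cinner (tensor_op N d a (site_mat N x (unit_mat i j)) (ket \<xi> k)) (ket \<theta> l)
    = cinner (ket \<xi> k) (tensor_op N d a' (site_mat N x (unit_mat j i)) (ket \<theta> l))"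
    using a(3) unfolding unit_site_op_ket[OF a(1) x kl(1) \<open>i < d\<close>] unit_site_op_ket[OF a(2) x kl(2) \<open>j < d\<close>]
    by (auto simp: cinner_ket adjoint_pair_def)
qed

section \<open>Local unitaries on the tensor product\<close>

text \<open>From here on the coefficient space has to be complete, so that \<open>qudits N d\<close>
  is complete and Cayley transforms exist on it.\<close>

locale tensored_collection = transitive_collection N A M
  for N :: nat and A M :: "nat \<Rightarrow> ('h::separable_hilbert_space \<Rightarrow> 'h) set" +
  fixes d :: nat
begin

abbreviation "S \<equiv> (qudits N d :: (multi_index, 'h) dsum set)"
abbreviation "I \<equiv> multi_indices N d"

definition elementary :: "nat \<Rightarrow> ((multi_index, 'h) dsum \<Rightarrow> (multi_index, 'h) dsum) set" where
  "elementary x = {tensor_op N d a T | a T. a \<in> M x \<and> T \<in> site_algebra N x}"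

lemma joint_eq: "joint_collection N d M x = commutant S (commutant S (elementary x))"
  by (simp add: joint_collection_def elementary_def)

lemma elementary_bounded:
  assumes "x \<in> {1..N}"
  shows "elementary x \<subseteq> bounded_operators S"
  using tensor_op_bounded[OF M_bounded[OF assms]] by (auto simp: elementary_def)

lemma elementary_joint: "x \<in> {1..N} \<Longrightarrow> elementary x \<subseteq> joint_collection N d M x"
  using elementary_bounded by (fastforce simp: joint_eq commutant_def)

lemma elementary_commute:
  assumes x: "x \<in> {1..N}" and y: "y \<in> {1..N}" and "x \<noteq> y"
    and "s \<in> elementary x" "t \<in> elementary y" "f \<in> S"
  shows "s (t f) = t (s f)"
proof -
  obtain a b where a: "a \<in> M x" "s = tensor_op N d a (site_mat N x b)"
    using assms(4) by (auto simp: elementary_def site_algebra_def site_mat_def)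
  obtain a' b' where a': "a' \<in> M y" "t = tensor_op N d a' (site_mat N y b')"
    using assms(5) by (auto simp: elementary_def site_algebra_def site_mat_def)
  show ?thesis
    unfolding a(2) a'(2)
    using M_bounded[OF x a(1)] M_bounded[OF y a'(1)] commute[OF x y assms(3) a(1) a'(1) UNIV_I]
      x y assms(3,6) by (rule site_ops_commute)
qed

text \<open>Commuting generators have commuting bicommutants.\<close>

sublocale joint: commuting_commutants S N "\<lambda>x. commutant S (elementary x)" "joint_collection N d M"
proof
  fix x y s t and f :: "(multi_index, 'h) dsum"
  assume xy: "x \<in> {1..N}" "y \<in> {1..N}" "x \<noteq> y"
    and st: "s \<in> joint_collection N d M x" "t \<in> joint_collection N d M y" and f: "f \<in> S"
  \<comment> \<open>First \<open>t\<close>, in the bicommutant of \<open>elementary y\<close>,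
    commutes with \<open>elementary x\<close>; then \<open>s\<close>, in the bicommutant of
    \<open>elementary x\<close>, commutes with \<open>t\<close>.\<close>
  have "elementary x \<subseteq> commutant S (elementary y)"
    using elementary_bounded[OF xy(1)] elementary_commute[OF xy] by (auto simp: commutant_def)
  then have "t \<in> commutant S (elementary x)"
    using st(2) by (auto simp: joint_eq commutant_def)
  then show "s (t f) = t (s f)"
    using st(1) f by (auto simp: joint_eq commutant_def)
qed (simp_all add: csubspace_qudits commutant_bounded joint_eq)

lemma site_op_joint: "x \<in> {1..N} \<Longrightarrow> a \<in> M x \<Longrightarrow> tensor_op N d a (site_mat N x b) \<in> joint_collection N d M x"
  using elementary_joint[of x] site_mat_in[of N x b] by (auto simp: elementary_def)

section \<open>Lifting unitaries to the tensor product\<close>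

lemma lift_unitary:
  assumes x: "x \<in> {1..N}" and v: "v \<in> M x" "unitary_operator UNIV v"
  shows "unitary_operator S (tensor_op N d v (site_mat N x id_mat))"
proof -
  obtain v' where v': "v' \<in> M x" "adjoint_pair UNIV v v'" "\<And>f. v' (v f) = f" "\<And>f. v (v' f) = f"
    using M_inverse[OF x v] by metis
  note b = M_bounded[OF x v(1)] M_bounded[OF x v'(1)]
  let ?t = "tensor_op N d v (site_mat N x id_mat)" and ?t' = "tensor_op N d v' (site_mat N x id_mat)"
  note t = tensor_op_bounded[OF b(1)] tensor_op_bounded[OF b(2)]
  have "adjoint_pair S ?t ?t'"
    using v'(2) by (intro adjoint_pair_qudits t)
      (simp add: id_site_op_ket[OF b(1) x] id_site_op_ket[OF b(2) x] cinner_ket adjoint_pair_def)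
  moreover have "(?t' \<circ> ?t) f = id f \<and> (?t \<circ> ?t') f = id f" if "f \<in> S" for f
  proof
    show "(?t' \<circ> ?t) f = id f"
      by (rule operators_eqI[OF comp_bounded[OF t(2,1)] id_bounded _ that])
        (simp add: id_site_op_ket[OF b(1) x] id_site_op_ket[OF b(2) x] v')
    show "(?t \<circ> ?t') f = id f"
      by (rule operators_eqI[OF comp_bounded[OF t] id_bounded _ that])
        (simp add: id_site_op_ket[OF b(1) x] id_site_op_ket[OF b(2) x] v')
  qed
  ultimately show ?thesis
    unfolding unitary_operator_def using t by auto
qed

text \<open>Tensoring each local unitary with the identity carries LU transitivity over to vectors
  sharing one register content, which connects the residual vectors at the end.\<close>

lemma lift_LU:
  assumes "g \<in> LU"
  obtains G where "G \<in> joint.LU" "\<And>\<xi> k. k \<in> I \<Longrightarrow> G (ket \<xi> k) = ket (g \<xi>) k"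
proof -
  obtain u where u: "local_unitaries u" "\<And>f. g f = local_product N u f"
    using assms by (auto simp: LU_def)
  let ?U = "\<lambda>x. tensor_op N d (u x) (site_mat N x id_mat)"
  have ux: "u x \<in> M x" "unitary_operator UNIV (u x)" if "x \<in> {1..N}" for x
    using u(1) that by (auto simp: local_unitaries_def)
  have "joint.local_unitaries ?U"
    unfolding joint.local_unitaries_def using ux by (blast intro: site_op_joint lift_unitary)
  then have "local_product N ?U \<in> joint.LU"
    by (auto simp: joint.LU_def)
  moreover have "site_product ?U xs (ket \<xi> k) = ket (site_product u xs \<xi>) k"
    if k: "k \<in> I" and "set xs \<subseteq> {1..N}" for \<xi> k xs
    using that(2)
  proof (induction xs)
    case (Cons x xs)
    then have x: "x \<in> {1..N}"
      by simp
    show ?case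
      using Cons by (simp add: id_site_op_ket[OF M_bounded[OF x ux(1)[OF x]] x k])
  qed simp
  then have "local_product N ?U (ket \<xi> k) = ket (g \<xi>) k" if "k \<in> I" for \<xi> k
    using that by (simp add: u(2) local_product_eq atLeastLessThanSuc_atLeastAtMost del: upt_Suc)
  ultimately show ?thesis
    using that by blast
qed

text \<open>The Cayley transform of \<open>\<Sum>\<^sub>j w\<^sub>j \<otimes> |0\<rangle>\<langle>j| - w\<^sub>j\<^sup>* \<otimes> |j\<rangle>\<langle>0|\<close> approximately
  resets the register of party \<open>x\<close> and records its former content by \<open>w\<^sub>j\<close>.\<close>

lemma reset_site:
  assumes x: "x \<in> {1..N}" and "d > 0" and \<Psi>: "norm \<Psi> = 1" and \<epsilon>: "\<epsilon> > 0" and J: "finite J"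
    and k: "\<And>j. j \<in> J \<Longrightarrow> k j \<in> I"
    and r: "\<And>j. j \<in> J \<Longrightarrow> r j \<in> bounded_operators UNIV"
      "\<And>j a f. j \<in> J \<Longrightarrow> a \<in> M x \<Longrightarrow> r j (a f) = a (r j f)"
  obtains G \<Psi>' w where "G \<in> joint.LU" "norm \<Psi>' = 1" "\<And>i. i < d \<Longrightarrow> w i \<in> M x"
    "norm (G (\<Sum>j\<in>J. ket (r j \<Psi>) (k j)) - (\<Sum>j\<in>J. ket (r j (w (k j x) \<Psi>')) ((k j)(x := 0)))) < \<epsilon>"
proof -
  have "\<exists>B\<ge>0. \<forall>f. norm (r j f) \<le> B * norm f" if "j \<in> J" for j
    using bounded_operators_bound[OF r(1)[OF that]] by (metis UNIV_I)
  then obtain B where B: "\<And>j. j \<in> J \<Longrightarrow> B j \<ge> 0" "\<And>j f. j \<in> J \<Longrightarrow> norm (r j f) \<le> B j * norm f"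
    by metis
  \<comment> \<open>Each summand will contribute at most
    \<open>2 * (real d * B j) * \<delta>\<close>. The added \<open>1\<close> keeps the denominator
    positive and the final inequality strict.\<close>
  define \<delta> where "\<delta> = \<epsilon> / ((\<Sum>j\<in>J. 2 * (real d * B j)) + 1)"
  have E: "(\<Sum>j\<in>J. 2 * (real d * B j)) \<ge> 0"
    using B(1) by (intro sum_nonneg) simp
  then have \<delta>: "\<delta> > 0" "((\<Sum>j\<in>J. 2 * (real d * B j)) + 1) * \<delta> = \<epsilon>"
    using \<epsilon> by (simp_all add: \<delta>_def)
  obtain v w w' where v: "v \<in> M x" "unitary_operator UNIV v"
    and ww': "\<forall>j<d. w j \<in> M x \<and> w' j \<in> M x \<and> adjoint_pair UNIV (w j) (w' j) \<and>
      (j \<noteq> 0 \<longrightarrow> norm (w' j (v \<Psi>)) < \<delta>) \<and>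
      (\<forall>i<d. norm (w' i (w j (v \<Psi>)) - (if i = j then v \<Psi> else 0)) < \<delta>)"
    using approx_matrix_units[OF x \<Psi> \<open>d > 0\<close> \<delta>(1)] by blast
  have w: "\<And>j. j < d \<Longrightarrow> w j \<in> M x" "\<And>j. j < d \<Longrightarrow> w' j \<in> M x"
      "\<And>j. j < d \<Longrightarrow> adjoint_pair UNIV (w j) (w' j)"
      "\<And>i j. i < d \<Longrightarrow> j < d \<Longrightarrow> norm (w' i (w j (v \<Psi>)) - (if i = j then v \<Psi> else 0)) < \<delta>"
      "\<And>j. j < d \<Longrightarrow> j \<noteq> 0 \<Longrightarrow> norm (w' j (v \<Psi>)) < \<delta>"
    using ww' by blast+
  define \<Psi>' where "\<Psi>' = v \<Psi>"
  \<comment> \<open>A register already at \<open>0\<close> is left alone, so the identity takes the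
    place of \<open>w 0\<close>. Accordingly the sum defining \<open>K\<close> starts at
    \<open>1\<close>.\<close>
  define W where "W j = (if j = 0 then id else w j)" for j
  define L where "L i f = tensor_op N d (w i) (site_mat N x (unit_mat 0 i)) f
      - tensor_op N d (w' i) (site_mat N x (unit_mat i 0)) f" for i f
  define K where "K f = (\<Sum>i\<in>{1..<d}. L i f)" for f
  have LM: "L i \<in> joint_collection N d M x" if "i \<in> {1..<d}" for i
    unfolding L_def[abs_def]
    by (rule joint.diff_M[OF x site_op_joint[OF x w(1)] site_op_joint[OF x w(2)]]) (use that in auto)
  have KM: "K \<in> joint_collection N d M x"
    unfolding K_def[abs_def] joint.M_eq[OF x]
    by (rule sum_commutant[OF csubspace_qudits joint.A_bounded[OF x] LM[unfolded joint.M_eq[OF x]]])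
  have "adjoint_pair S (L i) (\<lambda>f. - L i f)" if "i \<in> {1..<d}" for i
  proof -
    have "adjoint_pair S (tensor_op N d (w i) (site_mat N x (unit_mat 0 i)))
        (tensor_op N d (w' i) (site_mat N x (unit_mat i 0)))"
      by (rule unit_site_op_adjoint[OF M_bounded[OF x w(1)] M_bounded[OF x w(2)] w(3) x])
        (use that \<open>d > 0\<close> in auto)
    note this adjoint_pair_sym[OF this]
    then show ?thesis
      by (simp add: adjoint_pair_def L_def cinner_diff_left cinner_diff_right)
  qed
  then have skew: "adjoint_pair S K (\<lambda>f. - K f)"
    by (simp add: adjoint_pair_def K_def cinner_sum_left cinner_sum_right cinner_minus_right sum_negf)
  have wb: "w j \<in> bounded_operators UNIV" "w' j \<in> bounded_operators UNIV" if "j < d" for j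
    using M_bounded[OF x] w that by auto
  have L_ket: "L i (ket \<xi> l) = (if l x = i then ket (w i \<xi>) (l(x := 0)) else 0)
      - (if l x = 0 then ket (w' i \<xi>) (l(x := i)) else 0)" if "i \<in> {1..<d}" "l \<in> I" for i l \<xi>
    using that \<open>d > 0\<close> by (simp add: L_def unit_site_op_ket[OF wb(1) x] unit_site_op_ket[OF wb(2) x])
  have K_ket: "K (ket \<xi> l) = ket (w (l x) \<xi>) (l(x := 0))" if "l \<in> I" "l x \<noteq> 0" for \<xi> l
  proof -
    have "K (ket \<xi> l) = (\<Sum>i\<in>{1..<d}. if l x = i then ket (w i \<xi>) (l(x := 0)) else 0)"
      unfolding K_def using that by (intro sum.cong) (simp_all add: L_ket)
    then show ?thesis
      using that multi_index_less[OF that(1) x] by simp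
  qed
  have K_ket0: "K (ket \<xi> l) = - (\<Sum>i\<in>{1..<d}. ket (w' i \<xi>) (l(x := i)))" if "l \<in> I" "l x = 0" for \<xi> l
  proof -
    have "K (ket \<xi> l) = (\<Sum>i\<in>{1..<d}. - ket (w' i \<xi>) (l(x := i)))"
      unfolding K_def using that by (intro sum.cong) (auto simp: L_ket)
    then show ?thesis
      by (simp add: sum_negf)
  qed
  obtain C where C: "C \<in> joint_collection N d M x" "unitary_operator S C"
      "\<And>f. f \<in> S \<Longrightarrow> norm (C f - K f) \<le> norm (f + K (K f))"
      "\<And>f. f \<in> S \<Longrightarrow> norm (C f - f) \<le> 2 * norm (K f)"
    using cayley_transform[OF csubspace_qudits complete_qudits skew joint.A_bounded[OF x]] KM
    unfolding joint.M_eq[OF x] by metis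
  \<comment> \<open>The factor 2 stems from the bound on \<open>C f - f\<close>, which is used when
    the register holds \<open>0\<close>.\<close>
  have step: "norm (C (ket (r j \<Psi>') (k j)) - ket (r j (W (k j x) \<Psi>')) ((k j)(x := 0)))
      \<le> 2 * (real d * B j) * \<delta>" if j: "j \<in> J" for j
  proof -
    note k = k[OF j] and rj = r(2)[OF j] and rb = r(1)[OF j]
    have r_small: "norm (r j f) \<le> B j * \<delta>" if "norm f < \<delta>" for f
      using order_trans[OF B(2)[OF j] mult_left_mono[OF less_imp_le[OF that] B(1)[OF j]]] .
    have sum_small: "norm (\<Sum>i\<in>{1..<d}. ket (r j (h i)) (m i)) \<le> real d * B j * \<delta>"
      if "\<And>i. i \<in> {1..<d} \<Longrightarrow> norm (h i) < \<delta>" for h m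
    proof -
      have "norm (\<Sum>i\<in>{1..<d}. ket (r j (h i)) (m i)) \<le> (\<Sum>i\<in>{1..<d}. B j * \<delta>)"
        using r_small that by (intro sum_norm_le) (simp add: norm_ket)
      also have "\<dots> \<le> real d * (B j * \<delta>)"
        using B(1)[OF j] \<delta>(1) by (simp add: mult_right_mono)
      finally show ?thesis
        by simp
    qed
    have d_nonneg: "0 \<le> real d * B j * \<delta>"
      using B(1)[OF j] \<delta>(1) by simp
    show ?thesis
    proof (cases "k j x = 0")
      case True
      \<comment> \<open>Here \<open>K\<close> almost annihilates the vector, since every
        \<open>w' i \<Psi>'\<close> with \<open>i \<noteq> 0\<close> is small; hence
        \<open>C\<close> is close to the identity.\<close>
      have "norm (C (ket (r j \<Psi>') (k j)) - ket (r j \<Psi>') (k j)) \<le> 2 * norm (K (ket (r j \<Psi>') (k j)))"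
        by (rule C(4)[OF ket_qudits[OF k]])
      also have "K (ket (r j \<Psi>') (k j)) = - (\<Sum>i\<in>{1..<d}. ket (r j (w' i \<Psi>')) ((k j)(x := i)))"
        using K_ket0[OF k True] rj w(2) by simp
      also have "norm \<dots> \<le> real d * B j * \<delta>"
        unfolding norm_minus_cancel using w(5) by (intro sum_small) (simp add: \<Psi>'_def)
      finally show ?thesis
        using True fun_upd_triv[of "k j" x] by (simp add: W_def)
    next
      case False
      let ?l = "(k j)(x := 0)" and ?c = "k j x"
      have c: "?c < d" "?c \<in> {1..<d}"
        using multi_index_less[OF k x] False by auto
      have l: "?l \<in> I"
        by (rule multi_index_update[OF k x \<open>d > 0\<close>])
      \<comment> \<open>\<open>K\<close> moves content \<open>?c\<close> to \<open>0\<close> and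
        applies \<open>w ?c\<close>; applying \<open>K\<close> again yields about the negative of
        the original vector. So \<open>C\<close> is close to \<open>K\<close> here.\<close>
      have K1: "K (ket (r j \<Psi>') (k j)) = ket (r j (w ?c \<Psi>')) ?l"
        using K_ket[OF k False] rj w(1)[OF c(1)] by simp
      have "K (ket (r j (w ?c \<Psi>')) ?l) = - (\<Sum>i\<in>{1..<d}. ket (r j (w' i (w ?c \<Psi>'))) ((k j)(x := i)))"
        using K_ket0[OF l] rj w(2) by simp
      moreover have "ket (r j \<Psi>') (k j)
          = (\<Sum>i\<in>{1..<d}. if i = ?c then ket (r j \<Psi>') ((k j)(x := i)) else 0)"
        using c(2) by simp
      moreover have pointwise: "(if i = ?c then ket (r j \<Psi>') m else 0) - ket (r j (w' i (w ?c \<Psi>'))) m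
          = - ket (r j (w' i (w ?c \<Psi>') - (if i = ?c then \<Psi>' else 0))) m" for i m
        by (simp add: ket_linear bounded_operators_diff[OF csubspace_UNIV rb]
            bounded_operators_zero[OF csubspace_UNIV rb])
      ultimately have "ket (r j \<Psi>') (k j) + K (K (ket (r j \<Psi>') (k j)))
          = - (\<Sum>i\<in>{1..<d}. ket (r j (w' i (w ?c \<Psi>') - (if i = ?c then \<Psi>' else 0))) ((k j)(x := i)))"
        unfolding K1 sum_negf[symmetric] by (simp only: diff_conv_add_uminus[symmetric] sum_subtractf[symmetric]
            pointwise sum_negf)
      moreover have "norm (- (\<Sum>i\<in>{1..<d}. ket (r j (w' i (w ?c \<Psi>') - (if i = ?c then \<Psi>' else 0))) ((k j)(x := i))))
          \<le> real d * B j * \<delta>"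
        unfolding norm_minus_cancel \<Psi>'_def by (intro sum_small w(4)[OF _ c(1)]) simp
      ultimately have "norm (C (ket (r j \<Psi>') (k j)) - K (ket (r j \<Psi>') (k j))) \<le> real d * B j * \<delta>"
        using C(3)[OF ket_qudits[OF k], of "r j \<Psi>'"] by simp
      then show ?thesis
        using False d_nonneg by (simp add: K1 W_def)
    qed
  qed
  \<comment> \<open>\<open>T\<close> is \<open>v\<close> tensored with the identity; it first turns
    \<open>\<Psi>\<close> into the base vector \<open>\<Psi>'\<close> of the matrix units.\<close>
  define T where "T = tensor_op N d v (site_mat N x id_mat)"
  have CT: "C \<in> joint.LU" "T \<in> joint.LU"
    using C(1,2) x v by (auto simp: T_def intro!: joint.LU_site site_op_joint lift_unitary)
  have "T (\<Sum>j\<in>J. ket (r j \<Psi>) (k j)) = (\<Sum>j\<in>J. ket (r j \<Psi>') (k j))"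
    using bounded_operators_sum[OF csubspace_qudits joint.LU_bounded[OF CT(2)], of J "\<lambda>j. ket (r j \<Psi>) (k j)"] k r(2)
    by (simp add: ket_qudits T_def id_site_op_ket[OF M_bounded[OF x v(1)] x] \<Psi>'_def v(1))
  then have "(C \<circ> T) (\<Sum>j\<in>J. ket (r j \<Psi>) (k j)) = (\<Sum>j\<in>J. C (ket (r j \<Psi>') (k j)))"
    using bounded_operators_sum[OF csubspace_qudits joint.LU_bounded[OF CT(1)], of J "\<lambda>j. ket (r j \<Psi>') (k j)"] k
    by (simp add: ket_qudits)
  then have "norm ((C \<circ> T) (\<Sum>j\<in>J. ket (r j \<Psi>) (k j)) - (\<Sum>j\<in>J. ket (r j (W (k j x) \<Psi>')) ((k j)(x := 0))))
      \<le> (\<Sum>j\<in>J. 2 * (real d * B j) * \<delta>)"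
    using step by (simp add: sum_subtractf[symmetric] sum_norm_le)
  also have "\<dots> < \<epsilon>"
    using \<delta> by (simp add: sum_distrib_right[symmetric] distrib_right)
  finally have "norm ((C \<circ> T) (\<Sum>j\<in>J. ket (r j \<Psi>) (k j))
      - (\<Sum>j\<in>J. ket (r j (W (k j x) \<Psi>')) ((k j)(x := 0)))) < \<epsilon>" .
  moreover have "norm \<Psi>' = 1"
    using unitary_norm[OF v(2)] \<Psi> by (simp add: \<Psi>'_def)
  moreover have "W i \<in> M x" if "i < d" for i
    using w(1)[OF that] id_M[OF x] by (simp add: W_def)
  ultimately show ?thesis
    using that joint.LU_comp[OF CT] by blast
qed

section \<open>Resetting all registers and connecting the results\<close>

definition reset :: "nat \<Rightarrow> multi_index \<Rightarrow> multi_index" where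
  "reset t k = (\<lambda>y. if y \<in> {1..t} then 0 else k y)"

lemma reset_in: "d > 0 \<Longrightarrow> t \<le> N \<Longrightarrow> k \<in> I \<Longrightarrow> reset t k \<in> I"
  by (auto simp: reset_def multi_indices_def PiE_iff extensional_def)

lemma reset_Suc: "(reset t k)(Suc t := 0) = reset (Suc t) k"
  by (auto simp: reset_def fun_eq_iff le_Suc_eq)

text \<open>Induction over the parties. The sum stays indexed by the original content
  \<open>k\<close>, because different contents may coincide after resetting. The operator
  \<open>r k\<close> collects the coefficient and what the first \<open>t\<close> parties recorded;
  it commutes with the later algebras, as \<open>reset_site\<close> requires at the next
  party.\<close>

lemma reset_sites:
  assumes "d > 0" and \<Psi>: "norm \<Psi> = 1" and \<Phi>: "\<Phi> \<in> qudits N d" and "t \<le> N" and "\<epsilon> > 0"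
  shows "\<exists>G\<in>joint.LU. \<exists>\<Psi>' r. norm \<Psi>' = 1 \<and>
    (\<forall>k\<in>I. r k \<in> bounded_operators UNIV \<and> (\<forall>y\<in>{t<..N}. \<forall>a\<in>M y. \<forall>f. r k (a f) = a (r k f))) \<and>
    norm (G (tensor_vec \<Psi> \<Phi>) - (\<Sum>k\<in>I. ket (r k \<Psi>') (reset t k))) < \<epsilon>"
  using assms(4,5)
proof (induction t arbitrary: \<epsilon>)
  case 0
  have "tensor_vec \<Psi> \<Phi> \<in> qudits N d"
    using \<Phi> by (auto simp: qudits_def supported_on_def tensor_vec.rep_eq)
  then have "tensor_vec \<Psi> \<Phi> = (\<Sum>k\<in>I. ket (coord \<Phi> k *\<^sub>C \<Psi>) (reset 0 k))"
    using qudits_expansion by (fastforce simp: tensor_vec.rep_eq reset_def)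
  moreover have "(\<lambda>f. coord \<Phi> k *\<^sub>C f) \<in> bounded_operators UNIV" for k
    using scaleC_bounded[OF csubspace_UNIV id_bounded] by simp
  moreover have "\<forall>y\<in>{0<..N}. \<forall>a\<in>M y. \<forall>f. coord \<Phi> k *\<^sub>C a f = a (coord \<Phi> k *\<^sub>C f)" for k
  proof (intro ballI allI)
    fix y a f assume "y \<in> {0<..N}" "a \<in> M y"
    then show "coord \<Phi> k *\<^sub>C a f = a (coord \<Phi> k *\<^sub>C f)"
      using M_linear(3)[of y a] by simp
  qed
  ultimately show ?case
    using joint.LU_id \<Psi> "0.prems"
    by (intro bexI[of _ id] exI[of _ \<Psi>] exI[of _ "\<lambda>k f. coord \<Phi> k *\<^sub>C f"])
      auto
next
  case (Suc t)
  then have x: "Suc t \<in> {1..N}" and "t \<le> N"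
    by auto
  obtain G\<^sub>1 \<Psi>\<^sub>1 r where G\<^sub>1: "G\<^sub>1 \<in> joint.LU" and \<Psi>\<^sub>1: "norm \<Psi>\<^sub>1 = 1"
    and r: "\<forall>k\<in>I. r k \<in> bounded_operators UNIV \<and> (\<forall>y\<in>{t<..N}. \<forall>a\<in>M y. \<forall>f. r k (a f) = a (r k f))"
    and e\<^sub>1: "norm (G\<^sub>1 (tensor_vec \<Psi> \<Phi>) - (\<Sum>k\<in>I. ket (r k \<Psi>\<^sub>1) (reset t k))) < \<epsilon> / 2"
    using Suc.IH[OF \<open>t \<le> N\<close>, of "\<epsilon> / 2"] Suc.prems(2) by auto
  have r': "\<And>k. k \<in> I \<Longrightarrow> r k \<in> bounded_operators UNIV"
    "\<And>k y a f. k \<in> I \<Longrightarrow> y \<in> {t<..N} \<Longrightarrow> a \<in> M y \<Longrightarrow> r k (a f) = a (r k f)"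
    using r by blast+
  let ?F = "\<Sum>k\<in>I. ket (r k \<Psi>\<^sub>1) (reset t k)"
  obtain G\<^sub>2 \<Psi>\<^sub>2 w where G\<^sub>2: "G\<^sub>2 \<in> joint.LU" and \<Psi>\<^sub>2: "norm \<Psi>\<^sub>2 = 1"
    and w: "\<And>i. i < d \<Longrightarrow> w i \<in> M (Suc t)"
    and e\<^sub>2: "norm (G\<^sub>2 ?F - (\<Sum>k\<in>I. ket (r k (w (reset t k (Suc t)) \<Psi>\<^sub>2)) ((reset t k)(Suc t := 0)))) < \<epsilon> / 2"
  proof (rule reset_site[OF x \<open>d > 0\<close> \<Psi>\<^sub>1, of "\<epsilon> / 2" I "reset t" r])
    show "reset t k \<in> I" if "k \<in> I" for k
      using reset_in[OF \<open>d > 0\<close> \<open>t \<le> N\<close> that] .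
    show "r k (a f) = a (r k f)" if "k \<in> I" "a \<in> M (Suc t)" for k a f
      using r'(2)[OF that(1) _ that(2)] x by simp
  qed (use Suc.prems(2) r'(1) in auto)
  define r\<^sub>2 where "r\<^sub>2 k = r k \<circ> w (reset t k (Suc t))" for k
  let ?F' = "\<Sum>k\<in>I. ket (r\<^sub>2 k \<Psi>\<^sub>2) (reset (Suc t) k)"
  have wk: "w (reset t k (Suc t)) \<in> M (Suc t)" if "k \<in> I" for k
    using w multi_index_less[OF reset_in[OF \<open>d > 0\<close> \<open>t \<le> N\<close> that] x] .
  have "r\<^sub>2 k \<in> bounded_operators UNIV" if "k \<in> I" for k
    unfolding r\<^sub>2_def by (intro comp_bounded r'(1) M_bounded[OF x] wk that)
  moreover have "r\<^sub>2 k (a f) = a (r\<^sub>2 k f)" if "k \<in> I" "y \<in> {Suc t<..N}" "a \<in> M y" for k y a f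
    using commute[OF x _ _ wk[OF that(1)] that(3)] r'(2)[OF that(1) _ that(3)] that(2)
    by (simp add: r\<^sub>2_def)
  moreover have "norm ((G\<^sub>2 \<circ> G\<^sub>1) (tensor_vec \<Psi> \<Phi>) - ?F') < \<epsilon>"
  proof -
    have v: "tensor_vec \<Psi> \<Phi> \<in> S"
      using \<Phi> by (auto simp: qudits_def supported_on_def tensor_vec.rep_eq)
    have F: "?F \<in> S"
      using reset_in[OF \<open>d > 0\<close> \<open>t \<le> N\<close>] by (intro csubspace_sum csubspace_qudits ket_qudits) auto
    have G\<^sub>1v: "G\<^sub>1 (tensor_vec \<Psi> \<Phi>) \<in> S"
      using bounded_operatorsD(1)[OF joint.LU_bounded[OF G\<^sub>1] v] .
    \<comment> \<open>\<open>G\<^sub>2\<close> is isometric, so the error of the first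
      \<open>t\<close> parties is carried along unchanged.\<close>
    have split: "(G\<^sub>2 \<circ> G\<^sub>1) (tensor_vec \<Psi> \<Phi>) - ?F' = G\<^sub>2 (G\<^sub>1 (tensor_vec \<Psi> \<Phi>) - ?F) + (G\<^sub>2 ?F - ?F')"
      by (simp add: bounded_operators_diff[OF csubspace_qudits joint.LU_bounded[OF G\<^sub>2] G\<^sub>1v F])
    have "norm (G\<^sub>2 (G\<^sub>1 (tensor_vec \<Psi> \<Phi>) - ?F)) < \<epsilon> / 2"
      using e\<^sub>1 unfolding joint.LU_norm[OF G\<^sub>2 csubspaceD(5)[OF csubspace_qudits G\<^sub>1v F]] .
    moreover have "norm (G\<^sub>2 ?F - ?F') < \<epsilon> / 2"
      using e\<^sub>2 by (simp only: r\<^sub>2_def reset_Suc comp_apply)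
    ultimately have "norm (G\<^sub>2 (G\<^sub>1 (tensor_vec \<Psi> \<Phi>) - ?F) + (G\<^sub>2 ?F - ?F')) < \<epsilon> / 2 + \<epsilon> / 2"
      by (rule norm_add_less)
    then show ?thesis
      by (simp only: split field_sum_of_halves)
  qed
  ultimately show ?case
    using joint.LU_comp[OF G\<^sub>2 G\<^sub>1] \<Psi>\<^sub>2 by blast
qed

text \<open>The restriction to \<open>{1..N}\<close> makes the zero index extensional, hence an
  element of \<open>multi_indices N d\<close>.\<close>

definition origin :: multi_index where
  "origin = (\<lambda>y\<in>{1..N}. 0)"

lemma origin_in: "d > 0 \<Longrightarrow> origin \<in> I"
  by (auto simp: origin_def multi_indices_def)

text \<open>Once every party has reset its register, all indices equal \<open>origin\<close> and the
  sum collapses to one \<open>ket \<xi> origin\<close>. Since \<open>G\<close> is isometric,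
  \<open>\<xi>\<close> has norm close to 1 and may be normalised.\<close>

lemma reset_all:
  assumes "d > 0" and \<Psi>: "norm \<Psi> = 1" and \<Phi>: "\<Phi> \<in> qudits N d" "norm \<Phi> = 1" and \<epsilon>: "\<epsilon> > 0"
  obtains G \<theta> where "G \<in> joint.LU" "norm \<theta> = 1" "norm (G (tensor_vec \<Psi> \<Phi>) - ket \<theta> origin) < \<epsilon>"
proof -
  let ?v = "tensor_vec \<Psi> \<Phi>"
  \<comment> \<open>The bound by \<open>1\<close> ensures \<open>\<xi> \<noteq> 0\<close>; the bound
    by half of \<open>\<epsilon>\<close> pays for the normalisation.\<close>
  define \<delta> where "\<delta> = min 1 (\<epsilon> / 2)"
  have \<delta>: "\<delta> > 0" "\<delta> \<le> 1" "2 * \<delta> \<le> \<epsilon>"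
    using \<epsilon> by (auto simp: \<delta>_def)
  obtain G \<Psi>' r where G: "G \<in> joint.LU"
    and e: "norm (G ?v - (\<Sum>k\<in>I. ket (r k \<Psi>') (reset N k))) < \<delta>"
    using reset_sites[OF \<open>d > 0\<close> \<Psi> \<Phi>(1) order_refl \<delta>(1)] by blast
  define \<xi> where "\<xi> = (\<Sum>k\<in>I. r k \<Psi>')"
  have "reset N k = origin" if "k \<in> I" for k
    using that by (auto simp: reset_def origin_def multi_indices_def PiE_iff extensional_def fun_eq_iff)
  then have e: "norm (G ?v - ket \<xi> origin) < \<delta>"
    using e by (simp add: \<xi>_def ket_sum)
  have v: "?v \<in> S"
    using \<Phi>(1) by (auto simp: qudits_def supported_on_def tensor_vec.rep_eq)
  have "cinner ?v ?v = 1"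
    unfolding cinner_tensor_vec using \<Psi> \<Phi>(2) by (simp add: cinner_self)
  then have "norm (G ?v) = 1"
    using joint.LU_norm[OF G v] by (simp add: norm_eq_sqrt_inner inner_cinner)
  then have near: "\<bar>1 - norm \<xi>\<bar> < \<delta>"
    using norm_triangle_ineq3[of "G ?v" "ket \<xi> origin"] e by (simp add: norm_ket)
  then have "\<xi> \<noteq> 0"
    using \<delta>(2) by auto
  define \<theta> where "\<theta> = inverse (norm \<xi>) *\<^sub>R \<xi>"
  have \<theta>: "norm \<theta> = 1" "\<xi> = norm \<xi> *\<^sub>R \<theta>"
    using \<open>\<xi> \<noteq> 0\<close> by (simp_all add: \<theta>_def)
  have "\<xi> - \<theta> = (norm \<xi> - 1) *\<^sub>R \<theta>"
    using \<theta>(2) by (simp add: scaleR_left_diff_distrib)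
  then have "norm (ket \<xi> origin - ket \<theta> origin) < \<delta>"
    using near \<theta>(1) by (simp add: ket_linear[symmetric] norm_ket abs_minus_commute)
  then have "norm (G ?v - ket \<theta> origin) < \<epsilon>"
    using norm_triangle_ineq[of "G ?v - ket \<xi> origin" "ket \<xi> origin - ket \<theta> origin"] e \<delta>(3) by simp
  then show ?thesis
    using that G \<theta>(1) by blast
qed

text \<open>Both vectors are reset to \<open>\<theta>\<^sub>1\<close> and
  \<open>\<theta>\<^sub>2\<close> at \<open>origin\<close>, transitivity on \<open>\<H>\<close>
  carries \<open>\<theta>\<^sub>2\<close> near \<open>\<theta>\<^sub>1\<close>, and the first reset
  is undone. Each of these three approximations costs a third of \<open>\<epsilon>\<close>.\<close>

lemma embezzlement:
  assumes "d > 0" and \<Psi>: "norm \<Psi> = 1"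
    and \<Phi>\<^sub>1: "\<Phi>\<^sub>1 \<in> qudits N d" "norm \<Phi>\<^sub>1 = 1" and \<Phi>\<^sub>2: "\<Phi>\<^sub>2 \<in> qudits N d" "norm \<Phi>\<^sub>2 = 1"
  shows "approx_LU_equivalent S N (joint_collection N d M) (tensor_vec \<Psi> \<Phi>\<^sub>1) (tensor_vec \<Psi> \<Phi>\<^sub>2)"
proof -
  let ?v\<^sub>1 = "tensor_vec \<Psi> \<Phi>\<^sub>1" and ?v\<^sub>2 = "tensor_vec \<Psi> \<Phi>\<^sub>2"
  have v: "?v\<^sub>1 \<in> S" "?v\<^sub>2 \<in> S"
    using \<Phi>\<^sub>1(1) \<Phi>\<^sub>2(1) by (auto simp: qudits_def supported_on_def tensor_vec.rep_eq)
  have "\<exists>G\<in>joint.LU. norm (?v\<^sub>1 - G ?v\<^sub>2) < \<epsilon>" if "\<epsilon> > 0" for \<epsilon>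
  proof -
    have \<epsilon>: "\<epsilon> / 3 > 0"
      using that by simp
    obtain G\<^sub>1 \<theta>\<^sub>1 where 1: "G\<^sub>1 \<in> joint.LU" "norm \<theta>\<^sub>1 = 1" "norm (G\<^sub>1 ?v\<^sub>1 - ket \<theta>\<^sub>1 origin) < \<epsilon> / 3"
      using reset_all[OF \<open>d > 0\<close> \<Psi> \<Phi>\<^sub>1 \<epsilon>] by blast
    obtain G\<^sub>2 \<theta>\<^sub>2 where 2: "G\<^sub>2 \<in> joint.LU" "norm \<theta>\<^sub>2 = 1" "norm (G\<^sub>2 ?v\<^sub>2 - ket \<theta>\<^sub>2 origin) < \<epsilon> / 3"
      using reset_all[OF \<open>d > 0\<close> \<Psi> \<Phi>\<^sub>2 \<epsilon>] by blast
    obtain g where g: "g \<in> LU" "norm (\<theta>\<^sub>1 - g \<theta>\<^sub>2) < \<epsilon> / 3"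
      using transitive[OF 1(2) 2(2) \<epsilon>] by blast
    obtain H where H: "H \<in> joint.LU" "\<And>\<xi> k. k \<in> I \<Longrightarrow> H (ket \<xi> k) = ket (g \<xi>) k"
      using lift_LU[OF g(1)] by blast
    obtain G where G: "G \<in> joint.LU" "\<And>f. f \<in> S \<Longrightarrow> G (G\<^sub>1 f) = f"
      using joint.LU_inverse[OF 1(1)] by metis
    note closed = bounded_operatorsD(1)[OF joint.LU_bounded]
    have k: "ket \<theta>\<^sub>2 origin \<in> S"
      by (intro ket_qudits origin_in \<open>d > 0\<close>)
    have w: "G\<^sub>1 ?v\<^sub>1 \<in> S" "G\<^sub>2 ?v\<^sub>2 \<in> S" "H (G\<^sub>2 ?v\<^sub>2) \<in> S"
      using closed[OF 1(1) v(1)] closed[OF 2(1) v(2)] closed[OF H(1)] by blast+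
    have "?v\<^sub>1 - G (H (G\<^sub>2 ?v\<^sub>2)) = G (G\<^sub>1 ?v\<^sub>1 - H (G\<^sub>2 ?v\<^sub>2))"
      using bounded_operators_diff[OF csubspace_qudits joint.LU_bounded[OF G(1)] w(1,3)] G(2)[OF v(1)]
      by simp
    then have "norm (?v\<^sub>1 - G (H (G\<^sub>2 ?v\<^sub>2))) = norm (G\<^sub>1 ?v\<^sub>1 - H (G\<^sub>2 ?v\<^sub>2))"
      using joint.LU_norm[OF G(1) csubspaceD(5)[OF csubspace_qudits w(1,3)]] by simp
    also have "G\<^sub>1 ?v\<^sub>1 - H (G\<^sub>2 ?v\<^sub>2) = (G\<^sub>1 ?v\<^sub>1 - ket \<theta>\<^sub>1 origin) + ket (\<theta>\<^sub>1 - g \<theta>\<^sub>2) origin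
        + H (ket \<theta>\<^sub>2 origin - G\<^sub>2 ?v\<^sub>2)"
      using bounded_operators_diff[OF csubspace_qudits joint.LU_bounded[OF H(1)] k w(2)]
        H(2)[OF origin_in[OF \<open>d > 0\<close>]] by (simp add: ket_linear)
    also have "norm \<dots> \<le> norm (G\<^sub>1 ?v\<^sub>1 - ket \<theta>\<^sub>1 origin) + norm (ket (\<theta>\<^sub>1 - g \<theta>\<^sub>2) origin)
        + norm (H (ket \<theta>\<^sub>2 origin - G\<^sub>2 ?v\<^sub>2))"
      by (intro norm_triangle_le add_mono norm_triangle_ineq order_refl)
    also have "\<dots> < \<epsilon>"
      using 1(3) 2(3) g(2) joint.LU_norm[OF H(1) csubspaceD(5)[OF csubspace_qudits k w(2)]]
      by (simp add: norm_ket norm_minus_commute)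
    finally show ?thesis
      using joint.LU_comp[OF G(1) joint.LU_comp[OF H(1) 2(1)]] by (intro bexI[of _ "G \<circ> (H \<circ> G\<^sub>2)"]) auto
  qed
  then show ?thesis
    using joint.approx_LU_iff[OF v(2)] by blast
qed

end

section \<open>From von Neumann algebras to universal embezzlement\<close>

theorem lemma8p10:
  fixes M :: "nat \<Rightarrow> ('h::separable_hilbert_space \<Rightarrow> 'h) set" and N :: nat
  assumes "\<forall>x\<in>{1..N}. von_neumann_algebra UNIV (M x)"
    and "pairwise_commuting N M"
    and "LU_transitive N M"
    and "nontrivial_collection N M"
  shows "universal_embezzler N M"
proof -
  interpret H: commuting_commutants UNIV N "\<lambda>x. commutant UNIV (M x)" M
  proof
    fix x y a b and f :: 'h
    assume "x \<in> {1..N}" "y \<in> {1..N}" "x \<noteq> y" "a \<in> M x" "b \<in> M y"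
    then have "a \<circ> b = b \<circ> a"
      using assms(2) unfolding pairwise_commuting_def by blast
    then show "a (b f) = b (a f)"
      by (metis comp_apply)
  qed (use assms(1) in \<open>auto simp: von_neumann_algebra_def commutant_bounded\<close>)
  interpret transitive_collection N "\<lambda>x. commutant UNIV (M x)" M
  proof
    fix x a assume "x \<in> {1..N}" "a \<in> M x"
    then show "\<exists>b\<in>M x. adjoint_pair UNIV a b"
      using assms(1) unfolding von_neumann_algebra_def by blast
  next
    fix \<Psi> \<Phi> :: 'h and \<epsilon> :: real
    assume "norm \<Psi> = 1" "norm \<Phi> = 1" "\<epsilon> > 0"
    then show "\<exists>g\<in>H.LU. norm (\<Psi> - g \<Phi>) < \<epsilon>"
      using assms(3) H.approx_LU_iff[OF UNIV_I] unfolding LU_transitive_def by blast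
  next
    show "N \<ge> 2"
      using assms(4) by (simp add: nontrivial_collection_def)
  next
    fix x assume x: "x \<in> {1..N}"
    \<comment> \<open>As \<open>M x\<close> contains all scalars, being different from the set of
      scalars yields a nonscalar element.\<close>
    have "range (\<lambda>c \<psi>. c *\<^sub>C \<psi>) \<subseteq> M x"
      using H.scaleC_M[OF x H.id_M[OF x]] by auto
    then show "\<exists>a\<in>M x. \<forall>c. a \<noteq> (\<lambda>\<psi>. c *\<^sub>C \<psi>)"
      using assms(4) x unfolding nontrivial_collection_def by blast
  qed
  show ?thesis
    unfolding universal_embezzler_def embezzling_def
  proof (intro allI impI conjI ballI)
    fix \<Psi> :: 'h and d and \<Phi>\<^sub>1 \<Phi>\<^sub>2 :: "(multi_index, complex) dsum"
    assume \<Psi>: "norm \<Psi> = 1" and \<Phi>: "\<Phi>\<^sub>1 \<in> qudits N d" "\<Phi>\<^sub>2 \<in> qudits N d" "norm \<Phi>\<^sub>1 = 1" "norm \<Phi>\<^sub>2 = 1"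
    interpret tensored_collection N "\<lambda>x. commutant UNIV (M x)" M d ..
    \<comment> \<open>For \<open>d = 0\<close> there are no multi-indices, because
      \<open>N \<ge> 2\<close>; the register space is then zero and contains no unit vector.\<close>
    have "d \<noteq> 0"
    proof
      assume "d = 0"
      then have "multi_indices N d = {}"
        using two_parties by (auto simp: multi_indices_def PiE_eq_empty_iff)
      then have "\<Phi>\<^sub>1 = 0"
        using qudits_expansion[OF \<Phi>(1)] by simp
      then show False
        using \<Phi>(3) by simp
    qed
    then show "approx_LU_equivalent (qudits N d) N (joint_collection N d M)
        (tensor_vec \<Psi> \<Phi>\<^sub>1) (tensor_vec \<Psi> \<Phi>\<^sub>2)"
      using embezzlement \<Psi> \<Phi> by simp
  qed
qed

end
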